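(* Let $X$ be a Hausdorff space. Then (1) the following are equivalent: $X$ is a Lašnev space; $X$ is a Fr\'echet--Urysohn $k^*$-metrizable space; $X$ is a Fr\'echet--Urysohn $\mathrm{cs}^*$-metrizable space; $X$ is a sequential $\mathrm{cs}^*$-metrizable space not containing a topological copy of the Arens' fan $S_2$; (2) $X$ is $\mathrm{cs}$-metrizable if and only if $X$ is a $\mathrm{cs}^*$-metrizable space containing no subspace sequentially homeomorphic to $S_\omega$ or $S_2$; the same equivalence holds with "no subspace" replaced by "no sequentially closed subspace"; (3) $X$ is $k$-metrizable if and only if $X$ is a $k^*$-metrizable space containing no subspace sequentially homeomorphic to $S_\omega$ or $S_2$; the same equivalence holds with "no subspace" replaced by "no sequentially closed subspace"; (4) $X$ is metrizable iff $X$ is a sequential $\mathrm{cs}$-metrizable space iff $X$ is a $k$-metrizable $k$-space.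
   Context: All topological spaces are Hausdorff; "map" means continuous function. A subset is precompact if its closure is compact. A map $f:X\to Y$ is proper if $f^{-1}(K)$ is precompact in $X$ for every precompact $K\subset Y$; it is subproper if there is $Z\subset X$ with $f(Z)=Y$ such that $Z\cap f^{-1}(K)$ is precompact in $X$ for every precompact $K\subset Y$. A space is $k$-metrizable (resp. $k^*$-metrizable) if it is the image of a metrizable space under a proper (resp. subproper) map. A section of a map $f:X\to Y$ is a (possibly discontinuous) function $s:Y\to X$ with $f\circ s=\mathrm{id}_Y$. A function $s:Y\to X$ is sequentially continuous if for every convergent sequence $(y_n)$ in $Y$ the sequence $(s(y_n))$ converges in $X$; it is $\mathrm{cs}^*$-continuous if for every convergent sequence $(y_n)$ in $Y$ the sequence $(s(y_n))$ has an accumulation point in $X$ (a point each of whose neighborhoods contains $s(y_n)$ for infinitely many $n$). A space $X$ is $\mathrm{cs}$-metrizable (resp. $\mathrm{cs}^*$-metrizable) if it is the image of a metrizable space $M$ under a map $\pi:M\to X$ having a sequentially continuous (resp. $\mathrm{cs}^*$-continuous) section. A Lašnev space is a Hausdorff space that is the image of a metrizable space under a closed continuous map. $X$ is Fr\'echet--Urysohn if for each $A\subset X$ and $a\in\overline A$ there is a sequence in $A$ convergent to $a$. A subset is sequentially closed if it contains the limits of all its sequences convergent in $X$; $X$ is sequential if each sequentially closed subset is closed. $X$ is a $k$-space if a subset $F\subset X$ is closed iff $K\cap F$ is closed in $K$ for every compact $K\subset X$. Two spaces are sequentially homeomorphic if there is a bijection $h$ between them with $h$ and $h^{-1}$ sequentially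 continuous. $S_\omega$ (sequential, or Fr\'echet--Urysohn, fan) is the quotient space of $\{2^{-n}:n\le\infty\}\times\omega$ (with $2^{-\infty}=0$, and $\omega$ discrete) obtained by collapsing $\{0\}\times\omega$ to a point. The Arens' fan is $S_2=\{(0,0),(\frac1n,0),(\frac1n,\frac1m):n,m\in\mathbb N\}\subset\mathbb R^2$ endowed with the strongest topology inducing the original (planar) topology on each compact set $K_n=\{(0,0)\}\cup\{(\frac1k,0):k\in\mathbb N\}\cup\{(\frac1i,\frac1j):j\in\mathbb N,\ i\le n\}$, $n\in\mathbb N$. *)

theory Defs
  imports "HOL-Analysis.Analysis"
begin

section \<open>Precompact sets, proper and subproper maps\<close>

definition precompactin :: "'a topology \<Rightarrow> 'a set \<Rightarrow> bool" where
  "precompactin X S \<longleftrightarrow> S \<subseteq> topspace X \<and> compactin X (X closure_of S)"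

text \<open>
  Properness is defined by preimages of precompact sets. This is not the library notion
  \<^const>\<open>proper_map\<close>, which asks for a closed map with compact point preimages.
\<close>

definition kproper_map :: "'b topology \<Rightarrow> 'a topology \<Rightarrow> ('b \<Rightarrow> 'a) \<Rightarrow> bool" where
  "kproper_map M X f \<longleftrightarrow> continuous_map M X f \<and>
     (\<forall>K. precompactin X K \<longrightarrow> precompactin M {x \<in> topspace M. f x \<in> K})"

definition subproper_map :: "'b topology \<Rightarrow> 'a topology \<Rightarrow> ('b \<Rightarrow> 'a) \<Rightarrow> bool" where
  "subproper_map M X f \<longleftrightarrow> continuous_map M X f \<and>
     (\<exists>Z \<subseteq> topspace M. f ` Z = topspace X \<and>
        (\<forall>K. precompactin X K \<longrightarrow> precompactin M (Z \<inter> {x \<in> topspace M. f x \<in> K})))"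


section \<open>Sections and sequential continuity\<close>

definition section_of :: "'b topology \<Rightarrow> 'a topology \<Rightarrow> ('b \<Rightarrow> 'a) \<Rightarrow> ('a \<Rightarrow> 'b) \<Rightarrow> bool" where
  "section_of M X f s \<longleftrightarrow> s \<in> topspace X \<rightarrow> topspace M \<and> (\<forall>x \<in> topspace X. f (s x) = x)"

text \<open>
  The range condition is needed because \<^const>\<open>limitin\<close> only constrains the tail of a sequence.
\<close>

definition convergent_seq :: "'a topology \<Rightarrow> (nat \<Rightarrow> 'a) \<Rightarrow> bool" where
  "convergent_seq X y \<longleftrightarrow> range y \<subseteq> topspace X \<and> (\<exists>l. limitin X y l sequentially)"

definition accumulation_point :: "'a topology \<Rightarrow> (nat \<Rightarrow> 'a) \<Rightarrow> 'a \<Rightarrow> bool" where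
  "accumulation_point X y a \<longleftrightarrow> a \<in> topspace X \<and>
     (\<forall>U. openin X U \<and> a \<in> U \<longrightarrow> infinite {n. y n \<in> U})"

definition seq_continuous :: "'a topology \<Rightarrow> 'b topology \<Rightarrow> ('a \<Rightarrow> 'b) \<Rightarrow> bool" where
  "seq_continuous Y X s \<longleftrightarrow> s \<in> topspace Y \<rightarrow> topspace X \<and>
     (\<forall>y. convergent_seq Y y \<longrightarrow> convergent_seq X (\<lambda>n. s (y n)))"

definition cs_star_continuous :: "'a topology \<Rightarrow> 'b topology \<Rightarrow> ('a \<Rightarrow> 'b) \<Rightarrow> bool" where
  "cs_star_continuous Y X s \<longleftrightarrow> s \<in> topspace Y \<rightarrow> topspace X \<and>
     (\<forall>y. convergent_seq Y y \<longrightarrow> (\<exists>a. accumulation_point X (\<lambda>n. s (y n)) a))"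

definition seq_homeomorphic :: "'a topology \<Rightarrow> 'b topology \<Rightarrow> bool" where
  "seq_homeomorphic X Y \<longleftrightarrow>
     (\<exists>h. bij_betw h (topspace X) (topspace Y) \<and> seq_continuous X Y h \<and>
          seq_continuous Y X (inv_into (topspace X) h))"


section \<open>Sequential and Frechet--Urysohn spaces\<close>

definition seq_closedin :: "'a topology \<Rightarrow> 'a set \<Rightarrow> bool" where
  "seq_closedin X A \<longleftrightarrow> A \<subseteq> topspace X \<and>
     (\<forall>y l. range y \<subseteq> A \<and> limitin X y l sequentially \<longrightarrow> l \<in> A)"

definition sequential_space :: "'a topology \<Rightarrow> bool" where
  "sequential_space X \<longleftrightarrow> (\<forall>A. seq_closedin X A \<longrightarrow> closedin X A)"

definition frechet_urysohn_space :: "'a topology \<Rightarrow> bool" where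
  "frechet_urysohn_space X \<longleftrightarrow>
     (\<forall>A a. A \<subseteq> topspace X \<and> a \<in> X closure_of A \<longrightarrow>
        (\<exists>y. range y \<subseteq> A \<and> limitin X y a sequentially))"


section \<open>Generalized metrizable spaces\<close>

text \<open>
  A definition cannot quantify over the type of the metrizable space \<open>M\<close>. For \<open>X :: 'a topology\<close>
  it is taken on the type \<open>nat \<Rightarrow> 'a\<close>, which loses no generality: in each case \<open>M\<close> can be replaced
  by the closure of the image of a section of the given map, and the points of that closure are
  determined by sequences in \<open>X\<close>. The lemmas \<open>lasnev_spaceI\<close>, \<open>k_metrizableI\<close>, \<open>k_star_metrizableI\<close>,
  \<open>cs_metrizableI\<close> and \<open>cs_star_metrizableI\<close> below prove this for \<open>M\<close> on an arbitrary type.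
\<close>

definition lasnev_space :: "'a topology \<Rightarrow> bool" where
  "lasnev_space X \<longleftrightarrow> Hausdorff_space X \<and>
     (\<exists>(M :: (nat \<Rightarrow> 'a) topology) f. metrizable_space M \<and> continuous_map M X f \<and>
        closed_map M X f \<and> f ` topspace M = topspace X)"

definition k_metrizable :: "'a topology \<Rightarrow> bool" where
  "k_metrizable X \<longleftrightarrow>
     (\<exists>(M :: (nat \<Rightarrow> 'a) topology) f. metrizable_space M \<and> kproper_map M X f \<and>
        f ` topspace M = topspace X)"

definition k_star_metrizable :: "'a topology \<Rightarrow> bool" where
  "k_star_metrizable X \<longleftrightarrow>
     (\<exists>(M :: (nat \<Rightarrow> 'a) topology) f. metrizable_space M \<and> subproper_map M X f \<and>
        f ` topspace M = topspace X)"

definition cs_metrizable :: "'a topology \<Rightarrow> bool" where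
  "cs_metrizable X \<longleftrightarrow>
     (\<exists>(M :: (nat \<Rightarrow> 'a) topology) f s. metrizable_space M \<and> continuous_map M X f \<and>
        f ` topspace M = topspace X \<and> section_of M X f s \<and> seq_continuous X M s)"

definition cs_star_metrizable :: "'a topology \<Rightarrow> bool" where
  "cs_star_metrizable X \<longleftrightarrow>
     (\<exists>(M :: (nat \<Rightarrow> 'a) topology) f s. metrizable_space M \<and> continuous_map M X f \<and>
        f ` topspace M = topspace X \<and> section_of M X f s \<and> cs_star_continuous X M s)"


section \<open>The sequential fan and the Arens' fan\<close>

definition collapse :: "'a set \<Rightarrow> 'a \<Rightarrow> 'a set" where
  "collapse A x = (if x \<in> A then A else {x})"

definition quotient_top :: "'a topology \<Rightarrow> ('a \<Rightarrow> 'b) \<Rightarrow> 'b topology" where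
  "quotient_top X q =
     topology (\<lambda>U. U \<subseteq> q ` topspace X \<and> openin X {x \<in> topspace X. q x \<in> U})"

definition conv_seq_times_omega :: "(real \<times> nat) topology" where
  "conv_seq_times_omega =
     prod_topology (top_of_set (insert 0 (range (\<lambda>n::nat. 1 / 2 ^ n)))) (discrete_topology UNIV)"

definition S_omega :: "(real \<times> nat) set topology" where
  "S_omega = quotient_top conv_seq_times_omega (collapse ({0} \<times> UNIV))"

definition S2_set :: "(real \<times> real) set" where
  "S2_set = {(0, 0)} \<union> {(1 / real n, 0) | n. n \<ge> 1} \<union>
     {(1 / real n, 1 / real m) | n m. n \<ge> 1 \<and> m \<ge> 1}"

definition S2_compact :: "nat \<Rightarrow> (real \<times> real) set" where
  "S2_compact n = {(0, 0)} \<union> {(1 / real k, 0) | k. k \<ge> 1} \<union>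
     {(1 / real i, 1 / real j) | i j. j \<ge> 1 \<and> 1 \<le> i \<and> i \<le> n}"

text \<open>
  That this is the strongest topology inducing the planar topology on each \<open>S2_compact n\<close> is
  proved in \<open>subtopology_S2\<close> and \<open>S2_strongest\<close> below.
\<close>

definition S2 :: "(real \<times> real) topology" where
  "S2 = topology (\<lambda>U. U \<subseteq> S2_set \<and>
     (\<forall>n\<ge>1. openin (top_of_set (S2_compact n)) (S2_compact n \<inter> U)))"


section \<open>Adequacy of the two fans\<close>

lemma openin_quotient_top:
  "openin (quotient_top X q) U \<longleftrightarrow>
     U \<subseteq> q ` topspace X \<and> openin X {x \<in> topspace X. q x \<in> U}"
proof -
  have "istopology (\<lambda>U. U \<subseteq> q ` topspace X \<and> openin X {x \<in> topspace X. q x \<in> U})"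
    unfolding istopology_def
  proof (intro conjI allI impI)
    fix S T
    assume S: "S \<subseteq> q ` topspace X \<and> openin X {x \<in> topspace X. q x \<in> S}"
      and T: "T \<subseteq> q ` topspace X \<and> openin X {x \<in> topspace X. q x \<in> T}"
    then show "S \<inter> T \<subseteq> q ` topspace X" by blast
    have "{x \<in> topspace X. q x \<in> S \<inter> T} =
            {x \<in> topspace X. q x \<in> S} \<inter> {x \<in> topspace X. q x \<in> T}"
      by blast
    then show "openin X {x \<in> topspace X. q x \<in> S \<inter> T}"
      using S T by auto
  next
    fix \<K>
    assume K: "\<forall>K\<in>\<K>. K \<subseteq> q ` topspace X \<and> openin X {x \<in> topspace X. q x \<in> K}"
    then show "\<Union>\<K> \<subseteq> q ` topspace X" by blast
    have "{x \<in> topspace X. q x \<in> \<Union>\<K>} = (\<Union>K\<in>\<K>. {x \<in> topspace X. q x \<in> K})"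
      by blast
    then show "openin X {x \<in> topspace X. q x \<in> \<Union>\<K>}"
      using K by auto
  qed
  then show ?thesis
    by (simp add: quotient_top_def topology_inverse')
qed

lemma openin_S2:
  "openin S2 U \<longleftrightarrow> U \<subseteq> S2_set \<and>
     (\<forall>n\<ge>1. openin (top_of_set (S2_compact n)) (S2_compact n \<inter> U))"
proof -
  have "istopology (\<lambda>U. U \<subseteq> S2_set \<and>
     (\<forall>n\<ge>1. openin (top_of_set (S2_compact n)) (S2_compact n \<inter> U)))"
    unfolding istopology_def
  proof (intro conjI allI impI)
    fix S T n
    assume S: "S \<subseteq> S2_set \<and> (\<forall>n\<ge>1. openin (top_of_set (S2_compact n)) (S2_compact n \<inter> S))"
      and T: "T \<subseteq> S2_set \<and> (\<forall>n\<ge>1. openin (top_of_set (S2_compact n)) (S2_compact n \<inter> T))"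
      and "(1::nat) \<le> n"
    have "S2_compact n \<inter> (S \<inter> T) = (S2_compact n \<inter> S) \<inter> (S2_compact n \<inter> T)" by blast
    then show "openin (top_of_set (S2_compact n)) (S2_compact n \<inter> (S \<inter> T))"
      using S T \<open>1 \<le> n\<close> by (metis openin_Int)
  next
    fix \<K> n
    assume K: "\<forall>K\<in>\<K>. K \<subseteq> S2_set \<and> (\<forall>n\<ge>1. openin (top_of_set (S2_compact n)) (S2_compact n \<inter> K))"
      and "(1::nat) \<le> n"
    have "S2_compact n \<inter> \<Union>\<K> = (\<Union>K\<in>\<K>. S2_compact n \<inter> K)" by blast
    moreover have "openin (top_of_set (S2_compact n)) (\<Union>K\<in>\<K>. S2_compact n \<inter> K)"
      by (rule openin_Union) (use K \<open>1 \<le> n\<close> in blast)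
    ultimately show "openin (top_of_set (S2_compact n)) (S2_compact n \<inter> \<Union>\<K>)"
      by simp
  qed blast+
  then show ?thesis
    by (simp add: S2_def topology_inverse')
qed

lemma S2_compact_subset: "S2_compact n \<subseteq> S2_set"
  by (auto simp: S2_compact_def S2_set_def)

lemma topspace_S2: "topspace S2 = S2_set"
proof -
  have "openin S2 S2_set"
    unfolding openin_S2 using S2_compact_subset by (simp add: Int_absorb2)
  then show ?thesis
    by (metis openin_S2 openin_subset openin_topspace subset_antisym)
qed

lemma S2_strongest:
  assumes "topspace T = S2_set"
    and "\<And>n. n \<ge> 1 \<Longrightarrow> subtopology T (S2_compact n) = top_of_set (S2_compact n)"
    and "openin T U"
  shows "openin S2 U"
  unfolding openin_S2
  using assms by (metis inf_commute openin_subset openin_subtopology_Int)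

lemma subtopology_S2:
  assumes "n \<ge> 1"
  shows "subtopology S2 (S2_compact n) = top_of_set (S2_compact n)"
proof (rule topology_eq[THEN iffD2], intro allI iffI)
  fix U assume "openin (subtopology S2 (S2_compact n)) U"
  then obtain V where "openin S2 V" "U = S2_compact n \<inter> V"
    by (auto simp: openin_subtopology)
  then show "openin (top_of_set (S2_compact n)) U"
    using assms by (auto simp: openin_S2)
next
  fix U assume "openin (top_of_set (S2_compact n)) U"
  then obtain V where V: "open V" "U = V \<inter> S2_compact n"
    by (auto simp: openin_subtopology)
  have "S2_compact m \<inter> (V \<inter> S2_set) = V \<inter> S2_compact m" for m
    using S2_compact_subset by blast
  then have "openin S2 (V \<inter> S2_set)"
    using V by (auto simp: openin_S2 openin_subtopology)
  moreover have "U = (V \<inter> S2_set) \<inter> S2_compact n"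
    using V S2_compact_subset by blast
  ultimately show "openin (subtopology S2 (S2_compact n)) U"
    by (metis openin_subtopology)
qed


section \<open>The type of the metrizable space is irrelevant\<close>

lemma precompactin_subset_compact:
  assumes "Hausdorff_space X" "compactin X K" "S \<subseteq> K"
  shows "precompactin X S"
proof -
  have "closedin X K" using assms compactin_imp_closedin by blast
  then have "X closure_of S \<subseteq> K" using assms closure_of_minimal by blast
  then show ?thesis
    using assms unfolding precompactin_def
    by (meson closed_compactin closedin_closure_of compactin_subset_topspace order_trans)
qed

lemma small_metrizable_copy:
  fixes X :: "'a topology" and M :: "'b topology"
  assumes "metrizable_space M" and s: "s \<in> topspace X \<rightarrow> topspace M"
  obtains N :: "(nat \<Rightarrow> 'a) topology" and h g where
    "metrizable_space N"
    "homeomorphic_maps N (subtopology M (M closure_of (s ` topspace X))) h g"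
proof -
  define C where "C = M closure_of (s ` topspace X)"
  obtain Ms d where "Metric_space Ms d" and M: "M = Metric_space.mtopology Ms d"
    using assms(1) unfolding metrizable_space_def by blast
  then interpret Metric_space Ms d by simp
  have "\<exists>y. range y \<subseteq> topspace X \<and> limitin M (\<lambda>n. s (y n)) z sequentially" if z: "z \<in> C" for z
  proof -
    have "\<exists>\<sigma>. range \<sigma> \<subseteq> s ` topspace X \<inter> Ms \<and> limitin M \<sigma> z sequentially"
      using z by (simp add: C_def M closure_of_sequentially)
    then obtain \<sigma> where \<sigma>: "range \<sigma> \<subseteq> s ` topspace X \<inter> Ms" "limitin M \<sigma> z sequentially"
      by (elim exE conjE)
    have "\<exists>x. x \<in> topspace X \<and> s x = \<sigma> n" for n
      using \<sigma>(1) by (metis IntD1 imageE range_subsetD)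
    then obtain y where y: "\<And>n. y n \<in> topspace X" "\<And>n. s (y n) = \<sigma> n" by metis
    show ?thesis
    proof (intro exI[of _ y] conjI)
      show "range y \<subseteq> topspace X" using y(1) by blast
      show "limitin M (\<lambda>n. s (y n)) z sequentially" using \<sigma>(2) by (simp add: y(2))
    qed
  qed
  then obtain e where e: "\<And>z. z \<in> C \<Longrightarrow> limitin M (\<lambda>n. s (e z n)) z sequentially"
    by metis
  have inj: "inj_on e C"
    by (intro inj_onI) (metis e M limitin_metric_unique trivial_limit_sequentially)
  define N where "N = pullback_topology (e ` C) (inv_into C e) (subtopology M C)"
  have CM: "C \<subseteq> topspace M" unfolding C_def by (rule closure_of_subset_topspace)
  then have [simp]: "topspace (subtopology M C) = C" by auto
  have tN: "topspace N = e ` C"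
    unfolding N_def topspace_pullback_topology using inj CM by auto
  have h: "continuous_map N (subtopology M C) (inv_into C e)"
    unfolding N_def by (metis continuous_map_pullback continuous_map_id comp_id id_comp)
  have "continuous_map (subtopology M C) N e"
    unfolding N_def
  proof (rule continuous_map_pullback')
    show "continuous_map (subtopology M C) (subtopology M C) (inv_into C e \<circ> e)"
      by (rule continuous_map_eq[OF continuous_map_id]) (use inj in auto)
    show "topspace (subtopology M C) \<subseteq> e -` (e ` C)" by auto
  qed
  then have hm: "homeomorphic_maps N (subtopology M C) (inv_into C e) e"
    unfolding homeomorphic_maps_def using h inj by (auto simp: tN)
  then have "metrizable_space N"
    using assms(1) metrizable_space_subtopology homeomorphic_metrizable_space
      homeomorphic_space_def by blast
  then show thesis using that hm unfolding C_def by blast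
qed

lemma small_copy_facts:
  fixes X :: "'a topology" and M :: "'b topology"
  assumes M: "metrizable_space M" and f: "continuous_map M X f" and s: "section_of M X f s"
  obtains N :: "(nat \<Rightarrow> 'a) topology" and C h g where
    "metrizable_space N" "closedin M C" "s ` topspace X \<subseteq> C"
    "homeomorphic_maps N (subtopology M C) h g"
    "continuous_map N X (\<lambda>x. f (h x))" "(\<lambda>x. f (h x)) ` topspace N = topspace X"
    "section_of N X (\<lambda>x. f (h x)) (\<lambda>x. g (s x))"
proof -
  have sM: "s \<in> topspace X \<rightarrow> topspace M" using s by (auto simp: section_of_def)
  define C where "C = M closure_of (s ` topspace X)"
  obtain N :: "(nat \<Rightarrow> 'a) topology" and h g
    where N: "metrizable_space N" and hg: "homeomorphic_maps N (subtopology M C) h g"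
    using small_metrizable_copy[OF M sM] unfolding C_def by blast
  have "closedin M C" by (simp add: C_def)
  have sC: "s ` topspace X \<subseteq> C"
    unfolding C_def using sM by (intro closure_of_subset) auto
  have CM: "C \<subseteq> topspace M" using \<open>closedin M C\<close> closedin_subset by blast
  have h: "continuous_map N M h"
    using hg by (auto simp: homeomorphic_maps_def continuous_map_in_subtopology)
  have cont: "continuous_map N X (\<lambda>x. f (h x))"
    using continuous_map_compose[OF h f] by (simp add: o_def)
  have gN: "g z \<in> topspace N" "h (g z) = z" if "z \<in> C" for z
    using hg that CM by (auto simp: homeomorphic_maps_def continuous_map_def)
  have sec: "section_of N X (\<lambda>x. f (h x)) (\<lambda>x. g (s x))"
    using s sC gN by (auto simp: section_of_def)
  then have "(\<lambda>x. f (h x)) ` topspace N = topspace X"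
    using continuous_map_image_subset_topspace[OF cont]
    by (force simp: section_of_def image_iff)
  then show thesis
    using that N \<open>closedin M C\<close> sC hg cont sec by blast
qed

lemma surj_section:
  assumes "f ` Z = topspace X" "Z \<subseteq> topspace M"
  obtains s where "section_of M X f s" "s \<in> topspace X \<rightarrow> Z"
proof
  show "section_of M X f (inv_into Z f)" "inv_into Z f \<in> topspace X \<rightarrow> Z"
    using assms by (auto simp: section_of_def inv_into_into f_inv_into_f subset_iff)
qed

lemma small_copy_precompactin:
  assumes M: "metrizable_space M" and N: "metrizable_space N" and C: "closedin M C"
    and hg: "homeomorphic_maps N (subtopology M C) h g"
    and P: "precompactin M P" and Q: "Q \<subseteq> topspace N" "h ` Q \<subseteq> P"
  shows "precompactin N Q"
proof (rule precompactin_subset_compact)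
  let ?L = "M closure_of P \<inter> C"
  have "compactin M ?L"
    using P C by (auto simp: precompactin_def compact_Int_closedin)
  then have "compactin (subtopology M C) ?L"
    by (simp add: compactin_subtopology)
  then show "compactin N (g ` ?L)"
    using hg image_compactin by (fastforce simp: homeomorphic_maps_def)
  show "Hausdorff_space N" using N metrizable_imp_Hausdorff_space by blast
  have "P \<subseteq> M closure_of P" using P by (simp add: precompactin_def closure_of_subset)
  moreover have "h x \<in> C" "g (h x) = x" if "x \<in> Q" for x
    using hg that Q by (auto simp: homeomorphic_maps_def continuous_map_def Pi_iff)
  ultimately show "Q \<subseteq> g ` ?L" using Q
    by (metis (no_types, lifting) IntI image_eqI image_subset_iff subsetD subsetI)
qed

lemma lasnev_spaceI:
  fixes M :: "'b topology"
  assumes "Hausdorff_space X" and M: "metrizable_space M" and f: "continuous_map M X f"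
    and cl: "closed_map M X f" and onto: "f ` topspace M = topspace X"
  shows "lasnev_space X"
proof -
  obtain s where "section_of M X f s" using surj_section[OF onto] by blast
  then obtain N :: "(nat \<Rightarrow> 'a) topology" and C h g where N: "metrizable_space N" "closedin M C"
    "homeomorphic_maps N (subtopology M C) h g" "continuous_map N X (\<lambda>x. f (h x))"
    "(\<lambda>x. f (h x)) ` topspace N = topspace X"
    using small_copy_facts[OF M f] by metis
  have "closed_map N (subtopology M C) h"
    using N(3) homeomorphic_imp_closed_map homeomorphic_maps_map by blast
  moreover have "closed_map (subtopology M C) X f"
    using cl N(2) by (metis closed_map_def closedin_closed_subtopology)
  ultimately have "closed_map N X (f \<circ> h)" by (rule closed_map_compose)
  then show ?thesis
    unfolding lasnev_space_def o_def using assms(1) N(1,4,5) by blast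
qed

lemma k_metrizableI:
  fixes M :: "'b topology"
  assumes M: "metrizable_space M" and f: "kproper_map M X f" and onto: "f ` topspace M = topspace X"
  shows "k_metrizable X"
proof -
  have cf: "continuous_map M X f" using f by (simp add: kproper_map_def)
  obtain s where "section_of M X f s" using surj_section[OF onto] by blast
  then obtain N :: "(nat \<Rightarrow> 'a) topology" and C h g where N: "metrizable_space N" "closedin M C"
    "homeomorphic_maps N (subtopology M C) h g" "continuous_map N X (\<lambda>x. f (h x))"
    "(\<lambda>x. f (h x)) ` topspace N = topspace X"
    using small_copy_facts[OF M cf] by metis
  have hM: "h x \<in> topspace M" if "x \<in> topspace N" for x
    using N(3) that by (auto simp: homeomorphic_maps_def continuous_map_def Pi_iff)
  have "precompactin N {x \<in> topspace N. f (h x) \<in> K}" if "precompactin X K" for K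
  proof (rule small_copy_precompactin[OF M N(1-3)])
    show "precompactin M {x \<in> topspace M. f x \<in> K}" using f that by (simp add: kproper_map_def)
  qed (use hM in auto)
  then show ?thesis
    unfolding k_metrizable_def kproper_map_def using N by blast
qed

lemma k_star_metrizableI:
  fixes M :: "'b topology"
  assumes M: "metrizable_space M" and f: "subproper_map M X f" and onto: "f ` topspace M = topspace X"
  shows "k_star_metrizable X"
proof -
  have cf: "continuous_map M X f" using f by (simp add: subproper_map_def)
  obtain Z where Z: "Z \<subseteq> topspace M" "f ` Z = topspace X"
    "\<And>K. precompactin X K \<Longrightarrow> precompactin M (Z \<inter> {x \<in> topspace M. f x \<in> K})"
    using f by (auto simp: subproper_map_def)
  obtain s where s: "section_of M X f s" "s \<in> topspace X \<rightarrow> Z"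
    using surj_section[OF Z(2,1)] by blast
  obtain N :: "(nat \<Rightarrow> 'a) topology" and C h g where N: "metrizable_space N" "closedin M C"
    "homeomorphic_maps N (subtopology M C) h g" "continuous_map N X (\<lambda>x. f (h x))"
    "(\<lambda>x. f (h x)) ` topspace N = topspace X" "s ` topspace X \<subseteq> C"
    "section_of N X (\<lambda>x. f (h x)) (\<lambda>x. g (s x))"
    using small_copy_facts[OF M cf s(1)] by metis
  have CM: "C \<subseteq> topspace M" using N(2) closedin_subset by blast
  have hg: "h (g z) = z" if "z \<in> C" for z
    using N(3) that CM by (auto simp: homeomorphic_maps_def)
  define Z' where "Z' = (\<lambda>x. g (s x)) ` topspace X"
  have Z': "Z' \<subseteq> topspace N" "(\<lambda>x. f (h x)) ` Z' = topspace X"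
    using N(7) by (auto simp: Z'_def section_of_def image_image)
  have hZ': "h ` Z' \<subseteq> Z"
    using N(6) hg s(2) by (force simp: Z'_def)
  have "precompactin N (Z' \<inter> {x \<in> topspace N. f (h x) \<in> K})" if "precompactin X K" for K
    by (rule small_copy_precompactin[OF M N(1-3) Z(3)[OF that]]) (use hZ' Z(1) Z' in auto)
  then have "subproper_map N X (\<lambda>x. f (h x))"
    unfolding subproper_map_def using N(4) Z' by blast
  then show ?thesis
    unfolding k_star_metrizable_def using N by blast
qed

lemma cs_metrizableI:
  fixes M :: "'b topology"
  assumes M: "metrizable_space M" and f: "continuous_map M X f" and s: "section_of M X f s"
    and sc: "seq_continuous X M s"
  shows "cs_metrizable X"
proof -
  obtain N :: "(nat \<Rightarrow> 'a) topology" and C h g where N: "metrizable_space N" "closedin M C"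
    "homeomorphic_maps N (subtopology M C) h g" "continuous_map N X (\<lambda>x. f (h x))"
    "(\<lambda>x. f (h x)) ` topspace N = topspace X" "s ` topspace X \<subseteq> C"
    "section_of N X (\<lambda>x. f (h x)) (\<lambda>x. g (s x))"
    using small_copy_facts[OF M f s] by metis
  have "convergent_seq N (\<lambda>n. g (s (y n)))" if y: "convergent_seq X y" for y
  proof -
    obtain l where l: "limitin M (\<lambda>n. s (y n)) l sequentially"
      using sc y unfolding seq_continuous_def convergent_seq_def by meson
    have yX: "range y \<subseteq> topspace X" using y by (simp add: convergent_seq_def)
    have yC: "s (y n) \<in> C" for n using yX N(6) by blast
    have "l \<in> C"
      by (rule limitin_closedin[OF l N(2)]) (use yC in auto)
    then have "limitin (subtopology M C) (\<lambda>n. s (y n)) l sequentially"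
      using l yC by (simp add: limitin_subtopology)
    then have "limitin N (g \<circ> (\<lambda>n. s (y n))) (g l) sequentially"
      using N(3) continuous_map_limit by (fastforce simp: homeomorphic_maps_def)
    then show ?thesis
      using N(7) yX by (auto simp: convergent_seq_def section_of_def o_def)
  qed
  then have "seq_continuous X N (\<lambda>x. g (s x))"
    using N(7) by (auto simp: seq_continuous_def section_of_def)
  then show ?thesis
    unfolding cs_metrizable_def using N by blast
qed

lemma cs_star_metrizableI:
  fixes M :: "'b topology"
  assumes M: "metrizable_space M" and f: "continuous_map M X f" and s: "section_of M X f s"
    and sc: "cs_star_continuous X M s"
  shows "cs_star_metrizable X"
proof -
  obtain N :: "(nat \<Rightarrow> 'a) topology" and C h g where N: "metrizable_space N" "closedin M C"
    "homeomorphic_maps N (subtopology M C) h g" "continuous_map N X (\<lambda>x. f (h x))"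
    "(\<lambda>x. f (h x)) ` topspace N = topspace X" "s ` topspace X \<subseteq> C"
    "section_of N X (\<lambda>x. f (h x)) (\<lambda>x. g (s x))"
    using small_copy_facts[OF M f s] by metis
  have "\<exists>a. accumulation_point N (\<lambda>n. g (s (y n))) a" if y: "convergent_seq X y" for y
  proof -
    obtain a where a: "accumulation_point M (\<lambda>n. s (y n)) a"
      using sc y by (auto simp: cs_star_continuous_def)
    have yX: "range y \<subseteq> topspace X" using y by (simp add: convergent_seq_def)
    have yC: "s (y n) \<in> C" for n using yX N(6) by blast
    have aC: "a \<in> C"
    proof (rule ccontr)
      assume "a \<notin> C"
      then have "openin M (topspace M - C)" "a \<in> topspace M - C"
        using N(2) a by (auto simp: accumulation_point_def)
      with a have "infinite {n. s (y n) \<in> topspace M - C}"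
        unfolding accumulation_point_def by meson
      moreover have "{n. s (y n) \<in> topspace M - C} = {}" using yC by blast
      ultimately show False by (metis finite.emptyI)
    qed
    have g: "continuous_map (subtopology M C) N g"
      using N(3) by (simp add: homeomorphic_maps_def)
    have CM: "topspace (subtopology M C) = C"
      using N(2) closedin_subset by fastforce
    have "infinite {n. g (s (y n)) \<in> U}" if U: "openin N U" "g a \<in> U" for U
    proof -
      have "openin (subtopology M C) {x \<in> C. g x \<in> U}"
        using openin_continuous_map_preimage[OF g U(1)] unfolding CM .
      then obtain V where V: "openin M V" "{x \<in> C. g x \<in> U} = V \<inter> C"
        by (auto simp: openin_subtopology)
      then have "infinite {n. s (y n) \<in> V}"
        using a aC U by (auto simp: accumulation_point_def)
      moreover have "{n. s (y n) \<in> V} \<subseteq> {n. g (s (y n)) \<in> U}"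
        using V(2) yC by blast
      ultimately show ?thesis using finite_subset by blast
    qed
    moreover have "g a \<in> topspace N"
      using g aC CM by (auto simp: continuous_map_def Pi_iff)
    ultimately show ?thesis by (auto simp: accumulation_point_def)
  qed
  then have "cs_star_continuous X N (\<lambda>x. g (s x))"
    using N(7) by (auto simp: cs_star_continuous_def section_of_def)
  then show ?thesis
    unfolding cs_star_metrizable_def using N by blast
qed

end

theory Submission
  imports Defs
begin

text \<open>
  The sequential coreflection of \<open>X\<close> has the same convergent sequences as \<open>X\<close> but more
  open sets. A continuous map from a metrizable space into \<open>X\<close> stays continuous for
  it. Therefore \<open>X\<close> is cs-metrizable if and only if its coreflection is metrizable: a
  sequentially continuous section embeds a sequential space into a metrizable one. In
  a \<open>k\<^sup>*\<close>-metrizable space the coreflection has the same compact sets as \<open>X\<close>, so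
  that its metrizability makes \<open>X\<close> even \<open>k\<close>-metrizable. This reduces the whole theorem
  to two questions: when is a sequential cs*-metrizable space metrizable, and why do
  the two fans not occur in cs-metrizable and in \<open>k\<close>-metrizable spaces?

  The second question is answered by the diagonal property: if \<open>x n k\<close> converges to
  \<open>y n\<close> for each \<open>n\<close> and \<open>y\<close> converges to \<open>l\<close>, then some sequence of points \<open>x n k\<close>
  from strictly increasing rows \<open>n\<close> converges to \<open>l\<close>. Such a diagonal can be chosen in
  a metrizable space to which the double sequence is lifted, and fans have no
  convergent diagonals.

  For the first question, let \<open>X\<close> be a sequential cs*-metrizable space. If \<open>X\<close> is not
  a Frechet--Urysohn space, it contains a closed copy of Arens' fan: lifting the rows
  of a double sequence that witnesses this shows that no sequence visiting infinitely
  many rows converges (\<open>closed_fan_if_sequential_not_frechet_urysohn\<close>). If \<open>X\<close> is a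
  Frechet--Urysohn space, the given map becomes closed on the closure of the range of
  its section, so \<open>X\<close> is a Lasnev space (\<open>frechet_urysohn_cs_star_imp_lasnev\<close>).
  Conversely a closed image of a metrizable space is a Frechet--Urysohn space, and
  every section of a closed map shows that it is \<open>k\<^sup>*\<close>-metrizable
  (\<open>lasnev_imp_k_star_metrizable\<close>). These facts give the characterizations of the
  Lasnev spaces.

  Finally, let \<open>f\<close> be a closed map of a metrizable space onto \<open>X\<close>. If the frontier of
  some fibre is not compact, the images of sequences converging to a closed discrete
  sequence in this frontier form a closed copy of the sequential fan
  (\<open>closed_fan_at_noncompact_frontier\<close>). Otherwise \<open>f\<close> restricts to a perfect map onto
  \<open>X\<close>, and perfect images of metrizable spaces are metrizable
  (\<open>metrizable_perfect_image\<close>). The latter is proved with Frink's metrization theorem,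
  which in turn rests on the construction of a metric from chains of entourages.

  Both fans are handled uniformly as spaces spanned by a double sequence \<open>p\<close>, the
  limits \<open>q n\<close> of its rows and the limit \<open>r\<close> of \<open>q\<close>, whose closed sets are given by a
  condition on the indices (\<open>double_fan\<close>).
\<close>

section \<open>Convergent sequences\<close>

lemma limitin_sequentially_finite:
  "limitin X y l sequentially \<longleftrightarrow>
     l \<in> topspace X \<and> (\<forall>U. openin X U \<and> l \<in> U \<longrightarrow> finite {n. y n \<notin> U})"
  unfolding limitin_def by (simp add: eventually_cofinite flip: cofinite_eq_sequentially)

text \<open>
  Each neighbourhood of the limit misses only finitely many values of \<open>y\<close>, and an
  injective sequence takes each of them at most once. This lets fans be thinned to
  injective ones without keeping track of subsequences.
\<close>

lemma limitin_inj_rearrangement: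
  assumes "limitin X y l sequentially" "inj z" "range z \<subseteq> range y"
  shows "limitin X z l sequentially"
  unfolding limitin_sequentially_finite
proof (intro conjI allI impI)
  show "l \<in> topspace X" using assms(1) by (simp add: limitin_def)
  fix U assume "openin X U \<and> l \<in> U"
  then have "finite (y ` {n. y n \<notin> U})" using assms(1) by (simp add: limitin_sequentially_finite)
  then have "finite (z -` (y ` {n. y n \<notin> U}))" using assms(2) by (rule finite_vimageI)
  moreover have "{n. z n \<notin> U} \<subseteq> z -` (y ` {n. y n \<notin> U})"
    using assms(3) by (force simp: subset_iff image_iff)
  ultimately show "finite {n. z n \<notin> U}" by (rule rev_finite_subset)
qed

lemma infinite_image_of_convergent:
  assumes "Hausdorff_space X" "limitin X y l sequentially" "infinite I" "l \<notin> y ` I"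
  shows "infinite (y ` I)"
proof
  assume fin: "finite (y ` I)"
  let ?F = "y ` I \<inter> topspace X"
  have "closedin X ?F" using fin assms(1) by (simp add: closedin_Hausdorff_finite)
  moreover have "l \<in> topspace X - ?F" using assms by (auto simp: limitin_def)
  ultimately have "finite {n. y n \<notin> topspace X - ?F}"
    using assms(2) unfolding limitin_sequentially_finite by (meson openin_diff openin_topspace)
  then have "finite I" by (rule rev_finite_subset) auto
  then show False using assms(3) by blast
qed

text \<open>
  Either only finitely many terms lie in \<open>C\<close> and \<open>C\<close> is finite, or \<open>C\<close> contains the
  limit and is compact.
\<close>

lemma closedin_part_of_convergent:
  assumes X: "Hausdorff_space X" and lim: "limitin X y l sequentially"
    and C: "C \<subseteq> topspace X" "C \<subseteq> insert l (range y)"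
    and l: "infinite {n. y n \<in> C} \<Longrightarrow> l \<in> C"
  shows "closedin X C"
proof (cases "infinite {n. y n \<in> C}")
  case True
  then have "insert l (C - {l}) = C" using l by blast
  moreover have "compactin X (insert l (C - {l}))"
    by (rule compactin_sequence_with_limit[OF lim]) (use C in auto)
  ultimately show ?thesis using X compactin_imp_closedin by metis
next
  case False
  have "C \<subseteq> insert l (y ` {n. y n \<in> C})" using C(2) by blast
  then have "finite C" using False finite_subset by blast
  then show ?thesis using X C(1) by (simp add: closedin_Hausdorff_finite)
qed

text \<open>
  The pairs of indices are enumerated in one sequence; when the turn of a pair comes,
  only finitely many points have been used, so its infinite set still offers a fresh
  one.
\<close>

lemma injective_choice:
  fixes R :: "nat \<Rightarrow> 'a set"
  assumes "\<And>n. infinite (R n)"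
  shows "\<exists>p :: nat \<Rightarrow> nat \<Rightarrow> 'a. inj (case_prod p) \<and> (\<forall>n m. p n m \<in> R n)"
proof -
  \<comment> \<open>\<open>h\<close> runs through the pairs of indices in the order of \<^const>\<open>prod_decode\<close>.\<close>
  define P where "P = (\<lambda>(h::nat \<Rightarrow> 'a) k v. v \<in> R (fst (prod_decode k)) \<and> v \<notin> h ` {..<k})"
  have "\<exists>h. \<forall>k. P h k (h k)"
  proof (rule dependent_wellorder_choice)
    fix k and h :: "nat \<Rightarrow> 'a"
    have "infinite (R (fst (prod_decode k)) - h ` {..<k})"
      using assms by (simp add: Diff_infinite_finite)
    then show "\<exists>v. P h k v" unfolding P_def by (metis DiffE ex_in_conv finite.emptyI)
  qed (simp add: P_def image_def)
  then obtain h where h: "\<And>k. h k \<in> R (fst (prod_decode k))" "\<And>k. h k \<notin> h ` {..<k}"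
    by (auto simp: P_def)
  have "inj h" by (rule linorder_injI) (metis h(2) imageI lessThan_iff)
  show ?thesis
  proof (intro exI conjI allI)
    show "inj (case_prod (\<lambda>n m. h (prod_encode (n, m))))"
      by (rule injI) (auto dest!: injD[OF \<open>inj h\<close>])
    show "h (prod_encode (n, m)) \<in> R n" for n m
      using h(1)[of "prod_encode (n, m)"] by simp
  qed
qed

lemma infinite_nat_subsequence:
  assumes "infinite (I :: nat set)"
  obtains r :: "nat \<Rightarrow> nat" where "strict_mono r" "\<And>n. r n \<in> I"
  using assms infinite_enumerate by blast

section \<open>Subsequences in metrizable spaces\<close>

lemma accumulation_point_subsequence:
  assumes M: "metrizable_space M" and a: "accumulation_point M y a"
  obtains r :: "nat \<Rightarrow> nat" where "strict_mono r" "limitin M (y \<circ> r) a sequentially"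
proof -
  obtain S d where "Metric_space S d" and Meq: "M = Metric_space.mtopology S d"
    using M unfolding metrizable_space_def by blast
  then interpret Metric_space S d by simp
  have aS: "a \<in> S" using a by (simp add: accumulation_point_def Meq)
  have inf: "infinite {n. y n \<in> mball a e}" if "e > 0" for e
    using a that aS unfolding accumulation_point_def Meq by (meson centre_in_mball_iff openin_mball)
  define P where "P = (\<lambda>k n. y n \<in> mball a (1 / Suc k))"
  have Pinf: "infinite {n. P k n}" for k unfolding P_def by (rule inf) simp
  have "\<exists>n. P 0 n" using infinite_imp_nonempty[OF Pinf[of 0]] by blast
  moreover have "\<exists>n'. P (Suc k) n' \<and> n < n'" for k n
    using Pinf[of "Suc k"] unfolding infinite_nat_iff_unbounded by blast
  ultimately obtain r where r: "\<And>k. P k (r k)" "\<And>k. r k < r (Suc k)"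
    using dependent_nat_choice[of P "\<lambda>k n n'. n < n'"] by metis
  show thesis
  proof
    show "strict_mono r" using r(2) by (simp add: strict_mono_Suc_iff)
    show "limitin M (y \<circ> r) a sequentially"
      unfolding Meq limitin_metric
    proof (intro conjI aS allI impI)
      fix e :: real assume "e > 0"
      then obtain N where N: "inverse (real (Suc N)) < e" using reals_Archimedean by blast
      have "(y \<circ> r) k \<in> S \<and> d ((y \<circ> r) k) a < e" if "k \<ge> N" for k
      proof -
        have "1 / real (Suc k) \<le> 1 / real (Suc N)" using that by (simp add: frac_le)
        then show ?thesis using r(1)[of k] N by (simp add: P_def inverse_eq_divide commute)
      qed
      then show "\<forall>\<^sub>F k in sequentially. (y \<circ> r) k \<in> S \<and> d ((y \<circ> r) k) a < e"
        using eventually_sequentially by blast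
    qed
  qed
qed

lemma accumulation_point_of_subsequence_limit:
  assumes "strict_mono r" "limitin M (y \<circ> r) a sequentially"
  shows "accumulation_point M y a"
  unfolding accumulation_point_def
proof (intro conjI allI impI)
  show "a \<in> topspace M" using assms(2) by (simp add: limitin_def)
  fix U assume "openin M U \<and> a \<in> U"
  then have fin: "finite {k. y (r k) \<notin> U}"
    using assms(2) by (simp add: limitin_sequentially_finite)
  have "infinite (- {k. y (r k) \<notin> U})" using fin by simp
  then have "infinite (r ` (- {k. y (r k) \<notin> U}))"
    using assms(1) by (metis finite_imageD inj_on_subset strict_mono_imp_inj_on subset_UNIV)
  then show "infinite {n. y n \<in> U}" by (rule contrapos_nn) (auto elim: rev_finite_subset)
qed

lemma precompactin_subsequence:
  assumes M: "metrizable_space M" and P: "precompactin M P" and y: "range y \<subseteq> P"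
  obtains l and r :: "nat \<Rightarrow> nat" where "strict_mono r" "limitin M (y \<circ> r) l sequentially"
proof -
  obtain S d where "Metric_space S d" and Meq: "M = Metric_space.mtopology S d"
    using M unfolding metrizable_space_def by blast
  then interpret Metric_space S d by simp
  have "range y \<subseteq> M closure_of P"
    using P y by (metis closure_of_subset order_trans precompactin_def)
  moreover have "compactin M (M closure_of P)" using P by (simp add: precompactin_def)
  ultimately have "\<exists>l r. strict_mono r \<and> limitin M (y \<circ> r) l sequentially"
    unfolding Meq compactin_sequentially by blast
  then show thesis using that by blast
qed

text \<open>
  By the Bolzano--Weierstrass criterion, which speaks of infinite subsets only; this
  is why injective sequences suffice.
\<close>

lemma precompactin_if_subsequences:
  assumes M: "metrizable_space M" and P: "P \<subseteq> topspace M"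
    and sub: "\<And>y :: nat \<Rightarrow> 'a. inj y \<Longrightarrow> range y \<subseteq> P \<Longrightarrow> \<exists>(r :: nat \<Rightarrow> nat) l. strict_mono r \<and> limitin M (y \<circ> r) l sequentially"
  shows "precompactin (M :: 'a topology) P"
proof -
  obtain S d where "Metric_space S d" and Meq: "M = Metric_space.mtopology S d"
    using M unfolding metrizable_space_def by blast
  then interpret Metric_space S d by simp
  have "mtopology derived_set_of T \<noteq> {}" if T: "infinite T" "T \<subseteq> P" for T
  proof -
    obtain y :: "nat \<Rightarrow> 'a" where y: "inj y" "range y \<subseteq> T"
      using infinite_countable_subset[OF T(1)] by blast
    then obtain r l where r: "strict_mono r" and l: "limitin M (y \<circ> r) l sequentially"
      using sub[of y] T(2) by (meson order_trans)
    have inj: "inj (y \<circ> r)" using y(1) r by (simp add: inj_compose strict_mono_imp_inj_on)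
    have "\<exists>x. x \<noteq> l \<and> x \<in> T \<and> x \<in> U" if U: "openin M U" "l \<in> U" for U
    proof -
      have "finite {k. (y \<circ> r) k \<notin> U}" using l U by (simp add: limitin_sequentially_finite)
      moreover have "finite ((y \<circ> r) -` {l})" using inj by (intro finite_vimageI) auto
      ultimately have "finite ({k. (y \<circ> r) k \<notin> U} \<union> (y \<circ> r) -` {l})" by blast
      then obtain k where "k \<notin> {k. (y \<circ> r) k \<notin> U} \<union> (y \<circ> r) -` {l}"
        using ex_new_if_finite infinite_UNIV_nat by blast
      then show ?thesis using y(2) by (intro exI[of _ "(y \<circ> r) k"]) auto
    qed
    then have "l \<in> mtopology derived_set_of T"
      using limitin_topspace[OF l] unfolding Meq in_derived_set_of by blast
    then show ?thesis by blast
  qed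
  then show ?thesis
    unfolding precompactin_def Meq compact_closure_of_eq_Bolzano_Weierstrass
    using P by (auto simp: Meq)
qed

text \<open>
  Sequential continuity only asks that the image sequence converges to some point.
  Interlacing the sequence with its constant limit shows that this point must be the
  image of the limit.
\<close>

lemma seq_continuous_limit:
  assumes s: "seq_continuous X Y s" and Y: "Hausdorff_space Y"
    and y: "range y \<subseteq> topspace X" "limitin X y l sequentially"
  shows "limitin Y (\<lambda>n. s (y n)) (s l) sequentially"
proof -
  define z where "z n = (if even n then y (n div 2) else l)" for n
  have l: "l \<in> topspace X" using y(2) by (simp add: limitin_def)
  have "limitin X z l sequentially"
    unfolding limitin_sequentially
  proof (intro conjI l allI impI)
    fix U assume U: "openin X U \<and> l \<in> U"
    then obtain N where "\<And>n. n \<ge> N \<Longrightarrow> y n \<in> U" using y(2) by (auto simp: limitin_sequentially)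
    then have "z n \<in> U" if "n \<ge> 2 * N" for n using that U by (simp add: z_def)
    then show "\<exists>N. \<forall>n\<ge>N. z n \<in> U" by blast
  qed
  moreover have "range z \<subseteq> topspace X" using y(1) l by (auto simp: z_def)
  ultimately obtain a where a: "limitin Y (\<lambda>n. s (z n)) a sequentially"
    using s unfolding seq_continuous_def convergent_seq_def by blast
  have odd: "limitin Y ((\<lambda>n. s (z n)) \<circ> (\<lambda>n. 2 * n + 1)) a sequentially"
    by (rule limitin_subsequence[OF _ a]) (simp add: strict_mono_def)
  have even: "limitin Y ((\<lambda>n. s (z n)) \<circ> (\<lambda>n. 2 * n)) a sequentially"
    by (rule limitin_subsequence[OF _ a]) (simp add: strict_mono_def)
  have "s l \<in> topspace Y" using s l by (auto simp: seq_continuous_def)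
  then have "limitin Y (\<lambda>n::nat. s l) (s l) sequentially" by simp
  moreover have "limitin Y (\<lambda>n::nat. s l) a sequentially" using odd by (simp add: z_def o_def)
  ultimately have "a = s l" using Y limitin_Hausdorff_unique trivial_limit_sequentially by metis
  then show ?thesis using even by (simp add: z_def o_def)
qed

section \<open>The sequential coreflection\<close>

text \<open>
  The finest topology with the same convergent sequences. Defining it by sequentially
  open sets makes the topology axioms immediate; its closed sets are the sequentially
  closed sets of \<open>X\<close>.
\<close>

definition seq_coreflection :: "'a topology \<Rightarrow> 'a topology" where
  "seq_coreflection X = topology (\<lambda>U. U \<subseteq> topspace X \<and>
     (\<forall>y l. limitin X y l sequentially \<and> l \<in> U \<longrightarrow> (\<forall>\<^sub>F n in sequentially. y n \<in> U)))"

lemma openin_seq_coreflection: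
  "openin (seq_coreflection X) U \<longleftrightarrow> U \<subseteq> topspace X \<and>
     (\<forall>y l. limitin X y l sequentially \<and> l \<in> U \<longrightarrow> (\<forall>\<^sub>F n in sequentially. y n \<in> U))"
proof -
  have "istopology (\<lambda>U. U \<subseteq> topspace X \<and>
     (\<forall>y l. limitin X y l sequentially \<and> l \<in> U \<longrightarrow> (\<forall>\<^sub>F n in sequentially. y n \<in> U)))"
    unfolding istopology_def
  proof (intro conjI allI impI)
    fix \<K> y l
    assume K: "\<forall>K\<in>\<K>. K \<subseteq> topspace X \<and> (\<forall>y l. limitin X y l sequentially \<and> l \<in> K
      \<longrightarrow> (\<forall>\<^sub>F n in sequentially. y n \<in> K))"
    and "limitin X y l sequentially \<and> l \<in> \<Union> \<K>"
    then obtain K where "K \<in> \<K>" "\<forall>\<^sub>F n in sequentially. y n \<in> K" by blast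
    then show "\<forall>\<^sub>F n in sequentially. y n \<in> \<Union> \<K>" by (auto elim: eventually_mono)
  next
    fix S T y l
    assume "S \<subseteq> topspace X \<and> (\<forall>y l. limitin X y l sequentially \<and> l \<in> S
        \<longrightarrow> (\<forall>\<^sub>F n in sequentially. y n \<in> S))"
      and "T \<subseteq> topspace X \<and> (\<forall>y l. limitin X y l sequentially \<and> l \<in> T
        \<longrightarrow> (\<forall>\<^sub>F n in sequentially. y n \<in> T))"
      and "limitin X y l sequentially \<and> l \<in> S \<inter> T"
    then have "\<forall>\<^sub>F n in sequentially. y n \<in> S" "\<forall>\<^sub>F n in sequentially. y n \<in> T" by auto
    then show "\<forall>\<^sub>F n in sequentially. y n \<in> S \<inter> T" by eventually_elim simp
  qed blast+
  then show ?thesis by (simp add: seq_coreflection_def topology_inverse')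
qed

lemma openin_imp_openin_seq_coreflection:
  "openin X U \<Longrightarrow> openin (seq_coreflection X) U"
  unfolding openin_seq_coreflection by (auto simp: limitin_def openin_subset)

lemma topspace_seq_coreflection [simp]: "topspace (seq_coreflection X) = topspace X"
proof
  show "topspace (seq_coreflection X) \<subseteq> topspace X"
    using openin_topspace[of "seq_coreflection X"] unfolding openin_seq_coreflection by blast
  show "topspace X \<subseteq> topspace (seq_coreflection X)"
    by (simp add: openin_imp_openin_seq_coreflection openin_subset)
qed

lemma limitin_seq_coreflection [simp]:
  "limitin (seq_coreflection X) y l sequentially \<longleftrightarrow> limitin X y l sequentially"
proof
  assume "limitin (seq_coreflection X) y l sequentially"
  then show "limitin X y l sequentially"
    by (simp add: limitin_def openin_imp_openin_seq_coreflection)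
next
  assume lim: "limitin X y l sequentially"
  then show "limitin (seq_coreflection X) y l sequentially"
    unfolding limitin_def[of "seq_coreflection X"]
    by (auto simp: openin_seq_coreflection dest: limitin_topspace)
qed

lemma closedin_seq_coreflection: "closedin (seq_coreflection X) A \<longleftrightarrow> seq_closedin X A"
proof
  assume A: "closedin (seq_coreflection X) A"
  show "seq_closedin X A"
    unfolding seq_closedin_def
  proof (intro conjI allI impI)
    show "A \<subseteq> topspace X" using A closedin_subset by fastforce
    fix y l assume y: "range y \<subseteq> A \<and> limitin X y l sequentially"
    then have "limitin (seq_coreflection X) y l sequentially" by simp
    then show "l \<in> A"
      by (rule limitin_closedin[OF _ A]) (use y in \<open>auto intro!: always_eventually\<close>)
  qed
next
  assume A: "seq_closedin X A"
  have "\<forall>\<^sub>F n in sequentially. y n \<in> topspace X - A"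
    if lim: "limitin X y l sequentially" and l: "l \<in> topspace X - A" for y l
  proof -
    have "finite {n. y n \<notin> topspace X}"
      using lim by (simp add: limitin_sequentially_finite limitin_topspace)
    moreover have "finite {n. y n \<in> A}"
    proof (rule ccontr)
      assume "infinite {n. y n \<in> A}"
      then obtain r :: "nat \<Rightarrow> nat" where r: "strict_mono r" "\<And>n. y (r n) \<in> A"
        using infinite_nat_subsequence[of "{n. y n \<in> A}"] by auto
      then have "limitin X (y \<circ> r) l sequentially" "range (y \<circ> r) \<subseteq> A"
        using limitin_subsequence[OF r(1) lim] by auto
      then have "l \<in> A" using A unfolding seq_closedin_def by blast
      then show False using l by blast
    qed
    ultimately have "finite ({n. y n \<notin> topspace X} \<union> {n. y n \<in> A})" by blast
    then have "finite {n. \<not> y n \<in> topspace X - A}" by (rule rev_finite_subset) auto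
    then show ?thesis by (simp add: eventually_cofinite flip: cofinite_eq_sequentially)
  qed
  then show "closedin (seq_coreflection X) A"
    using A by (auto simp: closedin_def openin_seq_coreflection seq_closedin_def)
qed

lemma seq_closedin_seq_coreflection [simp]:
  "seq_closedin (seq_coreflection X) A \<longleftrightarrow> seq_closedin X A"
  by (simp add: seq_closedin_def)

lemma sequential_space_seq_coreflection: "sequential_space (seq_coreflection X)"
  by (simp add: sequential_space_def closedin_seq_coreflection)

lemma Hausdorff_space_seq_coreflection:
  assumes "Hausdorff_space X" shows "Hausdorff_space (seq_coreflection X)"
  unfolding Hausdorff_space_def
proof (intro allI impI)
  fix x y
  assume "x \<in> topspace (seq_coreflection X) \<and> y \<in> topspace (seq_coreflection X) \<and> x \<noteq> y"
  then obtain U V where "openin X U" "openin X V" "x \<in> U" "y \<in> V" "disjnt U V"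
    using assms unfolding Hausdorff_space_def topspace_seq_coreflection by metis
  then show "\<exists>U V. openin (seq_coreflection X) U \<and> openin (seq_coreflection X) V \<and>
      x \<in> U \<and> y \<in> V \<and> disjnt U V"
    using openin_imp_openin_seq_coreflection by blast
qed

lemma closedin_imp_seq_closedin: "closedin X A \<Longrightarrow> seq_closedin X A"
  unfolding closedin_seq_coreflection[symmetric]
  by (simp add: closedin_def openin_imp_openin_seq_coreflection)

lemma metrizable_imp_sequential_space:
  assumes "metrizable_space M" shows "sequential_space M"
proof -
  obtain S d where "Metric_space S d" and Meq: "M = Metric_space.mtopology S d"
    using assms unfolding metrizable_space_def by blast
  then interpret Metric_space S d by simp
  show ?thesis
    by (simp add: sequential_space_def seq_closedin_def Meq metric_closedin_iff_sequentially_closed)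
qed

lemma continuous_map_from_sequential_space:
  assumes X: "sequential_space X" and s: "s \<in> topspace X \<rightarrow> topspace Y"
    and lim: "\<And>y l. range y \<subseteq> topspace X \<Longrightarrow> limitin X y l sequentially \<Longrightarrow>
      limitin Y (\<lambda>n. s (y n)) (s l) sequentially"
  shows "continuous_map X Y s"
  unfolding continuous_map_closedin
proof (intro conjI s allI impI)
  fix C assume C: "closedin Y C"
  have "l \<in> {x \<in> topspace X. s x \<in> C}"
    if y: "range y \<subseteq> {x \<in> topspace X. s x \<in> C}" "limitin X y l sequentially" for y l
  proof -
    have "limitin Y (\<lambda>n. s (y n)) (s l) sequentially" using y by (intro lim) auto
    then have "s l \<in> C"
      by (rule limitin_closedin[OF _ C]) (use y in \<open>auto intro!: always_eventually\<close>)
    then show ?thesis using y(2) limitin_topspace by fastforce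
  qed
  then have "seq_closedin X {x \<in> topspace X. s x \<in> C}"
    unfolding seq_closedin_def by (intro conjI allI impI) (blast, fast)
  then show "closedin X {x \<in> topspace X. s x \<in> C}"
    using X by (simp add: sequential_space_def)
qed

text \<open>
  Maps from a metrizable space see only convergent sequences of the target. Hence
  replacing the topology of \<open>X\<close> by its sequential coreflection does not disturb any of
  the maps occurring in the metrizability notions.
\<close>

lemma continuous_map_into_seq_coreflection:
  assumes M: "metrizable_space M" and f: "continuous_map M X f"
  shows "continuous_map M (seq_coreflection X) f"
proof (rule continuous_map_from_sequential_space)
  show "sequential_space M" using M by (rule metrizable_imp_sequential_space)
  show "f \<in> topspace M \<rightarrow> topspace (seq_coreflection X)" using f by (simp add: continuous_map_def)
  show "limitin (seq_coreflection X) (\<lambda>n. f (y n)) (f l) sequentially"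
    if "limitin M y l sequentially" for y l
    using continuous_map_limit[OF f that] by (simp add: o_def)
qed

section \<open>Fans spanned by double sequences\<close>

lemma closedin_frequent_limit:
  assumes "closedin X C" "limitin X y l sequentially" "infinite {n. y n \<in> C}"
  shows "l \<in> C"
proof (rule ccontr)
  assume "l \<notin> C"
  then have "openin X (topspace X - C)" "l \<in> topspace X - C"
    using assms limitin_topspace by fastforce+
  then have "finite {n. y n \<notin> topspace X - C}"
    using assms(2) unfolding limitin_sequentially_finite by blast
  then have "finite {n. y n \<in> C}" by (rule rev_finite_subset) auto
  then show False using assms(3) by blast
qed

text \<open>
  The closed sets of a fan with rows \<open>p n\<close> converging to \<open>q n\<close> and with \<open>q\<close> converging
  to \<open>r\<close>.
\<close>

definition fan_closed :: "(nat \<Rightarrow> nat \<Rightarrow> 'a) \<Rightarrow> (nat \<Rightarrow> 'a) \<Rightarrow> 'a \<Rightarrow> 'a set \<Rightarrow> bool" where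
  "fan_closed p q r C \<longleftrightarrow>
     (\<forall>n. infinite {m. p n m \<in> C} \<longrightarrow> q n \<in> C) \<and> (infinite {n. q n \<in> C} \<longrightarrow> r \<in> C)"

definition fan_points :: "(nat \<Rightarrow> nat \<Rightarrow> 'a) \<Rightarrow> (nat \<Rightarrow> 'a) \<Rightarrow> 'a \<Rightarrow> 'a set" where
  "fan_points p q r = insert r (range q \<union> range (case_prod p))"

text \<open>
  This covers both fans: \<open>S2\<close> is the case where \<open>q\<close> is injective and avoids \<open>r\<close>, and
  \<open>S_omega\<close> is the case where \<open>q\<close> is constantly \<open>r\<close>.
\<close>

definition double_fan :: "'a topology \<Rightarrow> (nat \<Rightarrow> nat \<Rightarrow> 'a) \<Rightarrow> (nat \<Rightarrow> 'a) \<Rightarrow> 'a \<Rightarrow> bool" where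
  "double_fan T p q r \<longleftrightarrow>
     inj (case_prod p) \<and> (\<forall>n m. p n m \<noteq> r) \<and> (\<forall>n m k. p n m \<noteq> q k) \<and>
     topspace T = fan_points p q r \<and>
     (\<forall>C \<subseteq> topspace T. closedin T C \<longleftrightarrow> fan_closed p q r C)"

lemma fan_points_mem [simp]:
  "r \<in> fan_points p q r" "q n \<in> fan_points p q r" "p n m \<in> fan_points p q r"
  by (auto simp: fan_points_def)

lemma fan_points_cases:
  assumes "x \<in> fan_points p q r"
  obtains "x = r" | n where "x = q n" | n m where "x = p n m"
  using assms by (auto simp: fan_points_def)

lemma double_fan_distinct:
  assumes "double_fan T p q r"
  shows "p n m = p n' m' \<longleftrightarrow> n = n' \<and> m = m'" "p n m \<noteq> r" "p n m \<noteq> q k" "r \<noteq> p n m" "q k \<noteq> p n m"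
proof -
  have "inj (case_prod p)" using assms by (simp add: double_fan_def)
  then show "p n m = p n' m' \<longleftrightarrow> n = n' \<and> m = m'"
    using inj_eq[of "case_prod p" "(n, m)" "(n', m')"] by simp
  show *: "p n m \<noteq> r" "p n m \<noteq> q k" using assms by (simp_all add: double_fan_def)
  show "r \<noteq> p n m" "q k \<noteq> p n m" using *[symmetric] by simp_all
qed

lemma double_fan_closedin:
  assumes "double_fan T p q r"
  shows "closedin T C \<longleftrightarrow> C \<subseteq> fan_points p q r \<and> fan_closed p q r C"
  using assms closedin_subset unfolding double_fan_def by metis

lemma double_fan_limits:
  assumes T: "double_fan T p q r"
  shows "limitin T (p n) (q n) sequentially" "limitin T q r sequentially"
proof -
  have top: "topspace T = fan_points p q r" using T by (simp add: double_fan_def)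
  have C: "fan_closed p q r (topspace T - U)" if "openin T U" for U
    using that double_fan_closedin[OF T] by blast
  show "limitin T (p n) (q n) sequentially"
    unfolding limitin_sequentially_finite
  proof (intro conjI allI impI)
    show "q n \<in> topspace T" by (simp add: top)
    show "finite {m. p n m \<notin> U}" if "openin T U \<and> q n \<in> U" for U
      using C[of U] that by (auto simp: fan_closed_def top)
  qed
  show "limitin T q r sequentially"
    unfolding limitin_sequentially_finite
  proof (intro conjI allI impI)
    show "r \<in> topspace T" by (simp add: top)
    show "finite {m. q m \<notin> U}" if "openin T U \<and> r \<in> U" for U
      using C[of U] that by (auto simp: fan_closed_def top)
  qed
qed

text \<open>
  The values of the diagonal, without the alleged limit, meet each row in at most one
  point and therefore form a closed set.
\<close>

lemma double_fan_no_diagonal: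
  fixes k m :: "nat \<Rightarrow> nat"
  assumes T: "double_fan T p q r" and k: "inj k"
  shows "\<not> limitin T (\<lambda>j. p (k j) (m j)) l sequentially"
proof
  assume lim: "limitin T (\<lambda>j. p (k j) (m j)) l sequentially"
  \<comment> \<open>Leaving out \<open>l\<close> makes this set separate \<open>l\<close> from the diagonal once it is closed.\<close>
  define C where "C = range (\<lambda>j. p (k j) (m j)) - {l}"
  have "finite {i. p n i \<in> C}" for n
  proof (rule finite_subset)
    show "{i. p n i \<in> C} \<subseteq> m ` (k -` {n})"
      using double_fan_distinct[OF T] by (auto simp: C_def)
    show "finite (m ` (k -` {n}))" using k by (simp add: finite_vimageI)
  qed
  moreover have none: "q n \<notin> C" for n using double_fan_distinct[OF T] by (auto simp: C_def)
  moreover have "C \<subseteq> fan_points p q r" by (auto simp: C_def)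
  ultimately have "closedin T C"
    unfolding double_fan_closedin[OF T] fan_closed_def by simp
  moreover have "infinite {j. p (k j) (m j) \<in> C}"
  proof -
    have "inj (\<lambda>j. p (k j) (m j))"
      by (rule injI) (use k double_fan_distinct(1)[OF T] injD in metis)
    then have "finite ((\<lambda>j. p (k j) (m j)) -` {l})" by (simp add: finite_vimageI)
    then have "infinite (- ((\<lambda>j. p (k j) (m j)) -` {l}))" by simp
    moreover have "- ((\<lambda>j. p (k j) (m j)) -` {l}) = {j. p (k j) (m j) \<in> C}"
      by (auto simp: C_def)
    ultimately show ?thesis by simp
  qed
  ultimately have "l \<in> C" using closedin_frequent_limit[OF _ lim] by blast
  then show False by (simp add: C_def)
qed

text \<open>
  Sets that satisfy the combinatorial condition have to be closed in the whole space,
  so the fan itself is a closed subspace. The converse implication comes from the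
  convergence of the rows.
\<close>

lemma double_fan_in_subspace:
  assumes p: "inj (case_prod p)" "\<And>n m. p n m \<noteq> r" "\<And>n m k. p n m \<noteq> q k"
    and lim: "\<And>n. limitin X (p n) (q n) sequentially" "limitin X q r sequentially"
    and cl: "\<And>C. C \<subseteq> fan_points p q r \<Longrightarrow> fan_closed p q r C \<Longrightarrow> closedin X C"
  shows "closedin X (fan_points p q r)"
    and "double_fan (subtopology X (fan_points p q r)) p q r"
proof -
  show D: "closedin X (fan_points p q r)" by (rule cl) (auto simp: fan_closed_def)
  have "fan_closed p q r C" if "closedin X C" for C
    unfolding fan_closed_def using closedin_frequent_limit[OF that] lim by blast
  then have "closedin X C \<longleftrightarrow> fan_closed p q r C" if "C \<subseteq> fan_points p q r" for C
    using cl that by blast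
  moreover have "topspace X \<inter> fan_points p q r = fan_points p q r"
    using D closedin_subset by blast
  ultimately show "double_fan (subtopology X (fan_points p q r)) p q r"
    using p by (simp add: double_fan_def closedin_closed_subtopology[OF D])
qed

text \<open>
  The topology of a fan is determined by the indices, so matching the indices gives a
  homeomorphism. The hypotheses on \<open>q\<close> and \<open>q'\<close> say that both sequences identify the
  same indices.
\<close>

lemma double_fan_homeomorphic:
  assumes T: "double_fan T p q r" and T': "double_fan T' p' q' r'"
    and q: "\<And>n k. q n = q k \<longleftrightarrow> q' n = q' k" "\<And>n. q n = r \<longleftrightarrow> q' n = r'"
  shows "T homeomorphic_space T'"
proof -
  note d = double_fan_distinct[OF T] and d' = double_fan_distinct[OF T']
  define e where "e x = (if x = r then r' else if x \<in> range q then q' (SOME n. q n = x)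
    else case_prod p' (SOME i. case_prod p i = x))" for x
  have e: "e r = r'" "e (q n) = q' n" "e (p n m) = p' n m" for n m
  proof -
    show "e r = r'" by (simp add: e_def)
    show "e (q n) = q' n"
    proof (cases "q n = r")
      case False
      have "q (SOME k. q k = q n) = q n" by (rule someI[of _ n]) simp
      then show ?thesis using False q(1) by (simp add: e_def)
    qed (use q(2)[of n] in \<open>simp add: e_def\<close>)
    have "case_prod p (SOME i. case_prod p i = p n m) = p n m" by (rule someI[of _ "(n, m)"]) simp
    then have "(SOME i. case_prod p i = p n m) = (n, m)"
      using T by (metis double_fan_def inj_eq case_prod_conv)
    then show "e (p n m) = p' n m" using d by (auto simp: e_def)
  qed
  have top: "topspace T = fan_points p q r" "topspace T' = fan_points p' q' r'"
    using T T' by (auto simp: double_fan_def)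
  have inj: "inj_on e (fan_points p q r)"
  proof (rule inj_onI)
    fix x y assume "x \<in> fan_points p q r" "y \<in> fan_points p q r" "e x = e y"
    then show "x = y"
      by (elim fan_points_cases) (auto simp: e d d' q, (metis q)+)
  qed
  have im: "e ` fan_points p q r = fan_points p' q' r'"
    unfolding fan_points_def image_insert image_Un image_image
    by (simp add: e case_prod_unfold)
  have "homeomorphic_map T T' e"
  proof (rule bijective_closed_imp_homeomorphic_map)
    show "continuous_map T T' e"
      unfolding continuous_map_closedin
    proof (intro conjI allI impI)
      show "e \<in> topspace T \<rightarrow> topspace T'" using im by (auto simp: top)
      fix C assume "closedin T' C"
      then show "closedin T {x \<in> topspace T. e x \<in> C}"
        unfolding double_fan_closedin[OF T] double_fan_closedin[OF T'] fan_closed_def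
        by (simp add: top e)
    qed
    show "closed_map T T' e"
      unfolding closed_map_def
    proof (intro allI impI)
      fix C assume "closedin T C"
      then have C: "C \<subseteq> fan_points p q r" "fan_closed p q r C"
        by (auto simp: double_fan_closedin[OF T])
      have mem: "e x \<in> e ` C \<longleftrightarrow> x \<in> C" if "x \<in> fan_points p q r" for x
        using inj_on_image_mem_iff[OF inj that C(1)] .
      have "p' n m \<in> e ` C \<longleftrightarrow> p n m \<in> C" "q' n \<in> e ` C \<longleftrightarrow> q n \<in> C" "r' \<in> e ` C \<longleftrightarrow> r \<in> C" for n m
        using mem[of "p n m"] mem[of "q n"] mem[of r] by (simp_all add: e)
      moreover have "e ` C \<subseteq> fan_points p' q' r'" using C(1) im by blast
      ultimately show "closedin T' (e ` C)"
        using C(2) by (simp add: double_fan_closedin[OF T'] fan_closed_def)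
    qed
    show "e ` topspace T = topspace T'" using im by (simp add: top)
    show "inj_on e (topspace T)" using inj by (simp add: top)
  qed
  then show ?thesis by (rule homeomorphic_map_imp_homeomorphic_space)
qed

section \<open>Coordinates on the two fans\<close>

lemma topspace_quotient_top: "topspace (quotient_top X q) = q ` topspace X"
proof
  show "topspace (quotient_top X q) \<subseteq> q ` topspace X"
    using openin_topspace[of "quotient_top X q"] by (simp only: openin_quotient_top)
  have "{x \<in> topspace X. q x \<in> q ` topspace X} = topspace X" by auto
  then have "openin (quotient_top X q) (q ` topspace X)"
    by (simp add: openin_quotient_top)
  then show "q ` topspace X \<subseteq> topspace (quotient_top X q)" by (rule openin_subset)
qed

lemma closedin_quotient_top:
  "closedin (quotient_top X q) C \<longleftrightarrow>
     C \<subseteq> q ` topspace X \<and> closedin X {x \<in> topspace X. q x \<in> C}"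
proof -
  have "topspace X - {x \<in> topspace X. q x \<in> C} =
      {x \<in> topspace X. q x \<in> q ` topspace X - C}" by auto
  then show ?thesis
    by (auto simp: closedin_def topspace_quotient_top openin_quotient_top)
qed

lemma limitin_powers_of_half: "limitin euclideanreal (\<lambda>m. 1 / 2 ^ m) 0 sequentially"
proof -
  have "(\<lambda>m. (1 / 2) ^ m :: real) \<longlonglongrightarrow> 0" by (rule LIMSEQ_realpow_zero) auto
  then show ?thesis by (simp add: power_one_over)
qed

text \<open>
  The second factor is discrete, so closedness is decided on each copy of the
  convergent sequence separately.
\<close>

lemma closedin_conv_seq_times_omega:
  defines "J \<equiv> insert 0 (range (\<lambda>n::nat. 1 / 2 ^ n)) :: real set"
  assumes S: "S \<subseteq> J \<times> UNIV"
  shows "closedin conv_seq_times_omega S \<longleftrightarrow>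
    (\<forall>n. infinite {m. (1 / 2 ^ m, n) \<in> S} \<longrightarrow> (0, n) \<in> S)"
proof
  assume cl: "closedin conv_seq_times_omega S"
  have "(0, n) \<in> S" if inf: "infinite {m. (1 / 2 ^ m, n) \<in> S}" for n
  proof (rule closedin_frequent_limit[OF cl _ inf])
    have "limitin (top_of_set J) (\<lambda>m. 1 / 2 ^ m) 0 sequentially"
      using limitin_powers_of_half by (simp add: limitin_subtopology J_def)
    then show "limitin conv_seq_times_omega (\<lambda>m. (1 / 2 ^ m, n)) (0, n) sequentially"
      unfolding conv_seq_times_omega_def limitin_pairwise by (simp add: o_def J_def)
  qed
  then show "\<forall>n. infinite {m. (1 / 2 ^ m, n) \<in> S} \<longrightarrow> (0, n) \<in> S" by blast
next
  assume R: "\<forall>n. infinite {m. (1 / 2 ^ m, n) \<in> S} \<longrightarrow> (0, n) \<in> S"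
  have slice: "openin (top_of_set J) {a \<in> J. (a, n) \<notin> S}" for n
  proof -
    have "closedin euclideanreal {a. (a, n) \<in> S}"
    proof (rule closedin_part_of_convergent[OF _ limitin_powers_of_half])
      show "{a. (a, n) \<in> S} \<subseteq> insert 0 (range (\<lambda>m. 1 / 2 ^ m))" using S by (auto simp: J_def)
      show "0 \<in> {a. (a, n) \<in> S}" if "infinite {m. 1 / 2 ^ m \<in> {a. (a, n) \<in> S}}"
        using R that by simp
    qed auto
    then have "open (- {a. (a, n) \<in> S})" by (simp add: open_closed)
    moreover have "{a \<in> J. (a, n) \<notin> S} = J \<inter> - {a. (a, n) \<in> S}" by auto
    ultimately show ?thesis by (simp add: openin_open_Int)
  qed
  have "openin conv_seq_times_omega (J \<times> UNIV - S)"
    unfolding conv_seq_times_omega_def openin_prod_topology_alt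
  proof (intro allI impI)
    fix a n assume "(a, n) \<in> J \<times> UNIV - S"
    then show "\<exists>U V. openin (top_of_set (insert 0 (range (\<lambda>n. 1 / 2 ^ n)))) U \<and>
        openin (discrete_topology UNIV) V \<and> a \<in> U \<and> n \<in> V \<and> U \<times> V \<subseteq> J \<times> UNIV - S"
      using slice[of n] unfolding J_def
      by (intro exI[of _ "{a \<in> insert 0 (range (\<lambda>n. 1 / 2 ^ n)). (a, n) \<notin> S}"] exI[of _ "{n}"]) auto
  qed
  moreover have "topspace conv_seq_times_omega = J \<times> UNIV"
    by (simp add: conv_seq_times_omega_def J_def)
  ultimately show "closedin conv_seq_times_omega S" using S by (simp add: closedin_def)
qed

lemma double_fan_S_omega:
  "double_fan S_omega (\<lambda>n m. {(1 / 2 ^ m, n)}) (\<lambda>n. {0} \<times> UNIV) ({0} \<times> UNIV)"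
proof -
  define p :: "nat \<Rightarrow> nat \<Rightarrow> (real \<times> nat) set" where "p = (\<lambda>n m. {(1 / 2 ^ m, n)})"
  define r :: "(real \<times> nat) set" where "r = {0} \<times> UNIV"
  define J :: "real set" where "J = insert 0 (range (\<lambda>n::nat. 1 / 2 ^ n))"
  have top: "topspace conv_seq_times_omega = J \<times> UNIV"
    by (simp add: conv_seq_times_omega_def J_def)
  have c0: "collapse r (0, n) = r" for n by (simp add: collapse_def r_def)
  have cp: "collapse r (1 / 2 ^ m, n) = p n m" for n m by (simp add: collapse_def r_def p_def)
  have "inj (case_prod p)" by (auto simp: inj_def p_def)
  moreover have "p n m \<noteq> r" for n m
  proof -
    have "(0, Suc n) \<notin> p n m" by (simp add: p_def)
    then show ?thesis by (auto simp: r_def)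
  qed
  moreover have topS: "topspace S_omega = fan_points p (\<lambda>n. r) r"
  proof -
    have "collapse r ` (J \<times> UNIV) = fan_points p (\<lambda>n. r) r" (is "?L = ?R")
    proof
      show "?L \<subseteq> ?R" by (auto simp: J_def c0 cp)
      show "?R \<subseteq> ?L"
      proof
        fix x assume "x \<in> ?R"
        then consider "x = r" | n m where "x = p n m" by (auto elim: fan_points_cases)
        then show "x \<in> ?L"
        proof cases
          case 1 then show ?thesis using c0[of 0] by (auto simp: J_def intro!: image_eqI[of _ _ "(0, 0)"])
        next
          case 2 then show ?thesis using cp by (auto simp: J_def intro!: image_eqI[of _ _ "(1 / 2 ^ m, n)"])
        qed
      qed
    qed
    then show ?thesis by (simp add: S_omega_def topspace_quotient_top top flip: r_def)
  qed
  moreover have "closedin S_omega C \<longleftrightarrow> fan_closed p (\<lambda>n. r) r C" if "C \<subseteq> topspace S_omega" for C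
  proof -
    have "closedin S_omega C \<longleftrightarrow> closedin conv_seq_times_omega {x \<in> J \<times> UNIV. collapse r x \<in> C}"
      using that by (simp add: S_omega_def closedin_quotient_top topspace_quotient_top top flip: r_def)
    also have "\<dots> \<longleftrightarrow> fan_closed p (\<lambda>n. r) r C"
      by (subst closedin_conv_seq_times_omega) (auto simp: fan_closed_def c0 cp J_def)
    finally show ?thesis .
  qed
  ultimately show ?thesis
    unfolding double_fan_def p_def[symmetric] r_def[symmetric] by blast
qed

lemma setcompr_ge_1_eq_range: "{f k | k. k \<ge> (1::nat)} = range (\<lambda>n. f (Suc n))"
proof
  show "{f k | k. k \<ge> 1} \<subseteq> range (\<lambda>n. f (Suc n))"
  proof
    fix x assume "x \<in> {f k | k. k \<ge> 1}"
    then obtain k where "x = f k" "k \<ge> 1" by blast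
    then have "x = f (Suc (k - 1))" by simp
    then show "x \<in> range (\<lambda>n. f (Suc n))" by blast
  qed
  show "range (\<lambda>n. f (Suc n)) \<subseteq> {f k | k. k \<ge> 1}" by force
qed

lemma closedin_S2:
  "closedin S2 C \<longleftrightarrow> C \<subseteq> S2_set \<and> (\<forall>n\<ge>1. closedin (top_of_set (S2_compact n)) (S2_compact n \<inter> C))"
proof -
  have "S2_compact n - S2_compact n \<inter> C = S2_compact n \<inter> (S2_set - C)" for n
    using S2_compact_subset by blast
  then show ?thesis by (auto simp: closedin_def topspace_S2 openin_S2)
qed

text \<open>
  Each compact piece is the union of \<open>q\<close> with its limit and of finitely many rows with
  their limits; a set is closed in such a piece if it meets each of these convergent
  sequences in a closed set.
\<close>

lemma double_fan_S2:
  "double_fan S2 (\<lambda>n m. (1 / real (Suc n), 1 / real (Suc m))) (\<lambda>n. (1 / real (Suc n), 0)) (0, 0)"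
proof -
  define p where "p = (\<lambda>n m. (1 / real (Suc n), 1 / real (Suc m)))"
  define q where "q = (\<lambda>n. (1 / real (Suc n), 0::real))"
  define r :: "real \<times> real" where "r = (0, 0)"
  have S: "S2_set = fan_points p q r"
  proof -
    have "{(1 / real n, 1 / real m) | n m. n \<ge> 1 \<and> m \<ge> 1} = range (case_prod p)" (is "?L = ?R")
    proof
      show "?L \<subseteq> ?R"
      proof
        fix x assume "x \<in> ?L"
        then obtain n m where "x = (1 / real n, 1 / real m)" "n \<ge> 1" "m \<ge> 1" by blast
        then have "x = case_prod p (n - 1, m - 1)" by (simp add: p_def)
        then show "x \<in> ?R" by blast
      qed
      show "?R \<subseteq> ?L" by (force simp: p_def)
    qed
    moreover have "{(1 / real n, 0) | n. n \<ge> 1} = range q"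
      unfolding q_def by (rule setcompr_ge_1_eq_range)
    ultimately show ?thesis unfolding S2_set_def fan_points_def r_def by auto
  qed
  have K: "S2_compact N = insert r (range q) \<union> (\<Union>n<N. range (p n))" for N
  proof -
    have "{(1 / real i, 1 / real j) | i j. j \<ge> 1 \<and> 1 \<le> i \<and> i \<le> N} = (\<Union>n<N. range (p n))" (is "?L = ?R")
    proof
      show "?L \<subseteq> ?R"
      proof
        fix x assume "x \<in> ?L"
        then obtain n m where "x = (1 / real n, 1 / real m)" "n \<ge> 1" "m \<ge> 1" "n \<le> N" by blast
        then have "x = p (n - 1) (m - 1)" "n - 1 < N" by (auto simp: p_def)
        then show "x \<in> ?R" by blast
      qed
      show "?R \<subseteq> ?L" by (force simp: p_def)
    qed
    moreover have "{(1 / real n, 0) | n. n \<ge> 1} = range q"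
      unfolding q_def by (rule setcompr_ge_1_eq_range)
    ultimately show ?thesis unfolding S2_compact_def r_def by auto
  qed
  have half: "(\<lambda>m. 1 / real (Suc m)) \<longlonglongrightarrow> 0"
    using LIMSEQ_inverse_real_of_nat by (simp add: inverse_eq_divide)
  have lp: "limitin euclidean (p n) (q n) sequentially" for n
    using half unfolding p_def q_def limitin_canonical_iff by (intro tendsto_Pair) auto
  have lq: "limitin euclidean q r sequentially"
    using half unfolding q_def r_def limitin_canonical_iff by (intro tendsto_Pair) auto
  have "closedin S2 C \<longleftrightarrow> fan_closed p q r C" if C: "C \<subseteq> fan_points p q r" for C
  proof
    assume "closedin S2 C"
    then have cl: "closedin (top_of_set (S2_compact (Suc n))) (S2_compact (Suc n) \<inter> C)" for n
      by (simp add: closedin_S2)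
    show "fan_closed p q r C"
      unfolding fan_closed_def
    proof (intro conjI allI impI)
      fix n assume inf: "infinite {m. p n m \<in> C}"
      have mem: "p n m \<in> S2_compact (Suc n)" "q n \<in> S2_compact (Suc n)" for m by (auto simp: K)
      have "q n \<in> S2_compact (Suc n) \<inter> C"
      proof (rule closedin_frequent_limit[OF cl])
        show "limitin (top_of_set (S2_compact (Suc n))) (p n) (q n) sequentially"
          using lp mem by (simp add: limitin_subtopology)
        show "infinite {m. p n m \<in> S2_compact (Suc n) \<inter> C}" using inf mem by simp
      qed
      then show "q n \<in> C" by blast
    next
      assume inf: "infinite {n. q n \<in> C}"
      have mem: "q n \<in> S2_compact (Suc 0)" "r \<in> S2_compact (Suc 0)" for n by (auto simp: K)
      have "r \<in> S2_compact (Suc 0) \<inter> C"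
      proof (rule closedin_frequent_limit[OF cl])
        show "limitin (top_of_set (S2_compact (Suc 0))) q r sequentially"
          using lq mem by (simp add: limitin_subtopology)
        show "infinite {n. q n \<in> S2_compact (Suc 0) \<inter> C}" using inf mem by simp
      qed
      then show "r \<in> C" by blast
    qed
  next
    assume R: "fan_closed p q r C"
    have "closed (S2_compact N \<inter> C)" for N
    proof -
      have "closedin euclidean (C \<inter> insert r (range q))"
        by (rule closedin_part_of_convergent[OF _ lq]) (use R in \<open>auto simp: fan_closed_def\<close>)
      moreover have "closedin euclidean (C \<inter> insert (q n) (range (p n)))" for n
        by (rule closedin_part_of_convergent[OF _ lp]) (use R in \<open>auto simp: fan_closed_def\<close>)
      ultimately have "closed (C \<inter> insert r (range q) \<union> (\<Union>n<N. C \<inter> insert (q n) (range (p n))))"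
        by (intro closed_Un closed_UN) (simp_all add: closed_closedin[symmetric])
      moreover have "S2_compact N \<inter> C =
          C \<inter> insert r (range q) \<union> (\<Union>n<N. C \<inter> insert (q n) (range (p n)))"
        unfolding K by blast
      ultimately show ?thesis by simp
    qed
    then have "closedin (top_of_set (S2_compact N)) (S2_compact N \<inter> C)" for N
      by (metis closedin_closed_Int inf_left_idem)
    then show "closedin S2 C" using C by (simp add: closedin_S2 S)
  qed
  moreover have "inj (case_prod p)" by (auto simp: inj_def p_def)
  moreover have "p n m \<noteq> r" "p n m \<noteq> q k" for n m k by (auto simp: p_def q_def r_def)
  moreover have "topspace S2 = fan_points p q r" by (simp add: topspace_S2 S)
  ultimately show ?thesis
    unfolding double_fan_def p_def[symmetric] q_def[symmetric] r_def[symmetric] by simp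
qed

lemma homeomorphic_S2_if_double_fan:
  assumes "double_fan T p q r" "inj q" "r \<notin> range q"
  shows "T homeomorphic_space S2"
proof (rule double_fan_homeomorphic[OF assms(1) double_fan_S2])
  show "q n = q k \<longleftrightarrow> (1 / real (Suc n), 0::real) = (1 / real (Suc k), 0)" for n k
    using assms(2) by (simp add: inj_eq)
  show "q n = r \<longleftrightarrow> (1 / real (Suc n), 0) = (0::real, 0::real)" for n
    using assms(3) by auto
qed

section \<open>Metrization by a sequence of entourages\<close>

text \<open>
  The metric will be the infimum of the lengths of chains, as in the
  Alexandroff--Urysohn metrization theorem.
\<close>

fun chain_length :: "('a \<Rightarrow> 'a \<Rightarrow> real) \<Rightarrow> 'a list \<Rightarrow> real" where
  "chain_length w (x # y # zs) = w x y + chain_length w (y # zs)"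
| "chain_length w _ = 0"

lemma chain_length_nonneg:
  assumes "\<And>x y. w x y \<ge> 0" shows "chain_length w xs \<ge> 0"
  by (induction xs rule: induct_list012) (auto simp: assms)

lemma chain_length_append:
  "chain_length w (xs @ z # ys) = chain_length w (xs @ [z]) + chain_length w (z # ys)"
proof (induction xs)
  case (Cons x xs) then show ?case by (cases xs) auto
qed simp

lemma chain_length_rev:
  assumes "\<And>x y. w x y = w y x"
  shows "chain_length w (rev xs) = chain_length w xs"
proof (induction xs rule: induct_list012)
  case (3 x y zs)
  have "chain_length w (rev (x # y # zs)) = chain_length w (rev zs @ [y]) + chain_length w [y, x]"
    using chain_length_append[of w "rev zs" y "[x]"] by simp
  then show ?case using "3.IH"(2) assms[of y x] by simp
qed auto

text \<open>
  The cut is made at the edge with which the length first exceeds \<open>s\<close>, or at the last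
  edge if this never happens.
\<close>

lemma chain_split:
  assumes "\<And>x y. w x y \<ge> 0"
  shows "length xs \<ge> 2 \<Longrightarrow> s \<ge> 0 \<Longrightarrow> t \<ge> 0 \<Longrightarrow> chain_length w xs \<le> s + t \<Longrightarrow>
    \<exists>us u v vs. xs = us @ u # v # vs \<and> chain_length w (us @ [u]) \<le> s \<and> chain_length w (v # vs) \<le> t"
proof (induction xs arbitrary: s)
  case (Cons x xs)
  then obtain y r where xs: "xs = y # r" by (cases xs) auto
  show ?case
  proof (cases "w x y \<le> s \<and> r \<noteq> []")
    case False
    have "chain_length w (y # r) \<le> t"
    proof (cases "r = []")
      case False
      then show ?thesis using \<open>\<not> (w x y \<le> s \<and> r \<noteq> [])\<close> Cons.prems by (simp add: xs)
    qed (use Cons.prems in simp)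
    then show ?thesis
      using Cons.prems by (intro exI[of _ "[]"] exI[of _ x] exI[of _ y] exI[of _ r]) (simp add: xs)
  next
    case True
    have "length xs \<ge> 2" using True xs by (cases r) auto
    moreover have "chain_length w xs \<le> (s - w x y) + t" using Cons.prems by (simp add: xs)
    ultimately obtain us u v vs where uv: "xs = us @ u # v # vs"
      "chain_length w (us @ [u]) \<le> s - w x y" "chain_length w (v # vs) \<le> t"
      using Cons.IH[of "s - w x y"] True Cons.prems(3) by auto
    have "chain_length w ((x # us) @ [u]) \<le> s"
      using uv xs by (cases us) auto
    then show ?thesis
      using uv by (intro exI[of _ "x # us"] exI[of _ u] exI[of _ v] exI[of _ vs]) simp
  qed
qed simp

text \<open>
  A base of a uniformity in which each entourage contains the threefold composition of
  the next one. The threefold composition is what the cut of a chain into a head, one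
  edge and a tail calls for.
\<close>

locale entourage_sequence =
  fixes E :: "nat \<Rightarrow> 'a \<Rightarrow> 'a \<Rightarrow> bool"
  assumes E_0: "E 0 x y"
    and E_refl: "E n x x"
    and E_sym: "E n x y \<Longrightarrow> E n y x"
    and E_three: "E (Suc n) x y \<Longrightarrow> E (Suc n) y z \<Longrightarrow> E (Suc n) z u \<Longrightarrow> E n x u"
begin

lemma E_antimono: "n \<le> m \<Longrightarrow> E m x y \<Longrightarrow> E n x y"
proof (induction m rule: dec_induct)
  case (step m)
  then show ?case using E_three[of m x y y y] E_refl by blast
qed

definition weight :: "'a \<Rightarrow> 'a \<Rightarrow> real" where
  "weight x y = (if \<forall>n. E n x y then 0 else 1 / 2 ^ (LEAST n. \<not> E (Suc n) x y))"

lemma weight_nonneg: "weight x y \<ge> 0" by (simp add: weight_def)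

lemma weight_sym: "weight x y = weight y x"
proof -
  have "E n x y \<longleftrightarrow> E n y x" for n using E_sym by blast
  then show ?thesis by (simp add: weight_def)
qed

lemma weight_le:
  assumes "E n x y" shows "weight x y \<le> 1 / 2 ^ n"
proof (cases "\<forall>n. E n x y")
  case False
  define k where "k = (LEAST n. \<not> E (Suc n) x y)"
  obtain j where "\<not> E j x y" using False by blast
  then have "\<not> E (Suc (j - 1)) x y" by (cases j) (use E_0 in auto)
  then have "\<not> E (Suc k) x y" unfolding k_def by (rule LeastI)
  then have "n \<le> k" using E_antimono[of "Suc k" n x y] assms by (meson not_less_eq_eq)
  moreover have "weight x y = 1 / 2 ^ k" using False by (auto simp: weight_def k_def)
  ultimately show ?thesis by (simp add: frac_le)
qed (simp add: weight_def)

lemma E_if_weight_less: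
  assumes "weight x y < 1 / 2 ^ n" shows "E (Suc n) x y"
proof (cases "\<forall>n. E n x y")
  case False
  define k where "k = (LEAST n. \<not> E (Suc n) x y)"
  have "weight x y = 1 / 2 ^ k" using False by (auto simp: weight_def k_def)
  then have "(1::real) / 2 ^ k < 1 / 2 ^ n" using assms by simp
  then have "(2::real) ^ n < 2 ^ k" by (simp add: divide_simps)
  then have "n < k" by simp
  then show ?thesis unfolding k_def using not_less_Least by blast
qed simp

text \<open>
  The chain is cut at an edge so that head and tail have at most half of the length.
  By induction both stay in the next entourage, and so does the edge, because the
  weights are powers of two: a weight below \<open>1 / 2 ^ n\<close> is at most \<open>1 / 2 ^ Suc n\<close>.
\<close>

lemma E_if_chain_length_less:
  "xs \<noteq> [] \<Longrightarrow> chain_length weight xs < 1 / 2 ^ n \<Longrightarrow> E n (hd xs) (last xs)"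
proof (induction "length xs" arbitrary: xs n rule: less_induct)
  case less
  show ?case
  proof (cases "length xs \<ge> 2")
    case False
    then obtain x where "xs = [x]" using less.prems(1) by (cases xs; cases "tl xs") auto
    then show ?thesis by (simp add: E_refl)
  next
    case True
    define a where "a = chain_length weight xs"
    have "a \<ge> 0" unfolding a_def by (rule chain_length_nonneg[OF weight_nonneg])
    then obtain us u v vs where xs: "xs = us @ u # v # vs"
      and l: "chain_length weight (us @ [u]) \<le> a / 2" "chain_length weight (v # vs) \<le> a / 2"
      using chain_split[of weight xs "a / 2" "a / 2"] True weight_nonneg by (auto simp: a_def)
    have half: "a / 2 < 1 / 2 ^ Suc n" using less.prems(2) by (simp add: a_def)
    have "a = chain_length weight (us @ [u]) + weight u v + chain_length weight (v # vs)"
      unfolding a_def xs using chain_length_append[of weight us u "v # vs"] by simp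
    moreover have "chain_length weight (us @ [u]) \<ge> 0" "chain_length weight (v # vs) \<ge> 0"
      by (rule chain_length_nonneg[OF weight_nonneg])+
    ultimately have "weight u v \<le> a" by simp
    then have "weight u v < 1 / 2 ^ n" using less.prems(2) by (simp add: a_def)
    then have uv: "E (Suc n) u v" by (rule E_if_weight_less)
    have "E (Suc n) (hd (us @ [u])) (last (us @ [u]))"
      by (rule less.hyps) (use xs l(1) half in auto)
    moreover have "E (Suc n) (hd (v # vs)) (last (v # vs))"
      by (rule less.hyps) (use xs l(2) half in auto)
    ultimately have "E n (hd (us @ [u])) (last (v # vs))"
      using E_three[of n _ u v] uv by simp
    moreover have "hd xs = hd (us @ [u])" by (cases us) (simp_all add: xs)
    ultimately show ?thesis by (simp add: xs)
  qed
qed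

definition chains :: "'a \<Rightarrow> 'a \<Rightarrow> 'a list set" where
  "chains x y = {xs. xs \<noteq> [] \<and> hd xs = x \<and> last xs = y}"

definition chain_dist :: "'a \<Rightarrow> 'a \<Rightarrow> real" where
  "chain_dist x y = (INF xs \<in> chains x y. chain_length weight xs)"

lemma pair_in_chains: "[x, y] \<in> chains x y" by (simp add: chains_def)

lemma bdd_below_chains: "bdd_below (chain_length weight ` chains x y)"
  using chain_length_nonneg[OF weight_nonneg] by (intro bdd_belowI[of _ 0]) auto

lemma chain_dist_le: "xs \<in> chains x y \<Longrightarrow> chain_dist x y \<le> chain_length weight xs"
  unfolding chain_dist_def by (rule cINF_lower[OF bdd_below_chains])

lemma chain_dist_lessE:
  assumes "chain_dist x y < a"
  obtains xs where "xs \<in> chains x y" "chain_length weight xs < a"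
  using assms pair_in_chains[of x y] bdd_below_chains[of x y]
  unfolding chain_dist_def by (subst (asm) cINF_less_iff) blast+

lemma chain_dist_nonneg: "chain_dist x y \<ge> 0"
  unfolding chain_dist_def using pair_in_chains chain_length_nonneg[OF weight_nonneg]
  by (intro cINF_greatest) blast+

lemma chain_dist_triangle: "chain_dist x z \<le> chain_dist x y + chain_dist y z"
proof (rule field_le_epsilon)
  fix e :: real assume "e > 0"
  obtain xs where xs: "xs \<in> chains x y" "chain_length weight xs < chain_dist x y + e / 2"
    using chain_dist_lessE[of x y "chain_dist x y + e / 2"] \<open>e > 0\<close> by auto
  obtain ys where ys: "ys \<in> chains y z" "chain_length weight ys < chain_dist y z + e / 2"
    using chain_dist_lessE[of y z "chain_dist y z + e / 2"] \<open>e > 0\<close> by auto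
  have 1: "xs = butlast xs @ [y]" using xs(1) by (auto simp: chains_def)
  have 2: "ys = y # tl ys" using ys(1) by (auto simp: chains_def)
  have "butlast xs @ y # tl ys \<in> chains x z"
  proof -
    have "hd (butlast xs @ y # tl ys) = hd (butlast xs @ [y])" by (simp add: hd_append)
    then show ?thesis using xs(1) ys(1) 1 2 by (simp add: chains_def)
  qed
  then have "chain_dist x z \<le> chain_length weight (butlast xs @ y # tl ys)" by (rule chain_dist_le)
  also have "\<dots> = chain_length weight xs + chain_length weight ys"
    using chain_length_append[of weight "butlast xs" y "tl ys"] 1 2 by simp
  finally show "chain_dist x z \<le> chain_dist x y + chain_dist y z + e" using xs ys by simp
qed

lemma chain_dist_sym: "chain_dist x y = chain_dist y x"
proof -
  have le: "chain_dist x y \<le> chain_dist y x" for x y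
  proof (rule field_le_epsilon)
    fix e :: real assume "e > 0"
    obtain xs where xs: "xs \<in> chains y x" "chain_length weight xs < chain_dist y x + e"
      using chain_dist_lessE[of y x "chain_dist y x + e"] \<open>e > 0\<close> by auto
    have "rev xs \<in> chains x y" using xs(1) by (auto simp: chains_def hd_rev last_rev)
    then have "chain_dist x y \<le> chain_length weight (rev xs)" by (rule chain_dist_le)
    then show "chain_dist x y \<le> chain_dist y x + e"
      using xs(2) chain_length_rev[of weight, OF weight_sym] by simp
  qed
  show ?thesis using le[of x y] le[of y x] by simp
qed

lemma E_if_chain_dist_less: "chain_dist x y < 1 / 2 ^ n \<Longrightarrow> E n x y"
  using E_if_chain_length_less by (elim chain_dist_lessE) (auto simp: chains_def)

lemma chain_dist_if_E: "E n x y \<Longrightarrow> chain_dist x y \<le> 1 / 2 ^ n"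
  using chain_dist_le[OF pair_in_chains, of x y] weight_le[of n x y] by simp

text \<open>
  The chain metric and the entourages are interleaved: \<open>E n x y\<close> implies that the
  distance is at most \<open>1 / 2 ^ n\<close>, and a smaller distance implies \<open>E n x y\<close>.
\<close>

lemma metrizable_if_entourage_base:
  assumes base: "\<And>U. openin X U \<longleftrightarrow>
      U \<subseteq> topspace X \<and> (\<forall>x\<in>U. \<exists>n. \<forall>y\<in>topspace X. E n x y \<longrightarrow> y \<in> U)"
    and sep: "\<And>x y. x \<in> topspace X \<Longrightarrow> y \<in> topspace X \<Longrightarrow> (\<And>n. E n x y) \<Longrightarrow> x = y"
  shows "metrizable_space X"
proof -
  interpret Metric_space "topspace X" chain_dist
  proof
    show "chain_dist x y \<ge> 0" for x y by (rule chain_dist_nonneg)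
    show "chain_dist x y = chain_dist y x" for x y by (rule chain_dist_sym)
    show "chain_dist x z \<le> chain_dist x y + chain_dist y z" for x y z by (rule chain_dist_triangle)
    show "chain_dist x y = 0 \<longleftrightarrow> x = y" if "x \<in> topspace X" "y \<in> topspace X" for x y
    proof
      assume "chain_dist x y = 0"
      then have "E n x y" for n by (intro E_if_chain_dist_less) simp
      then show "x = y" using sep that by blast
    next
      assume "x = y"
      then show "chain_dist x y = 0"
        using chain_dist_le[of "[x]" x y] chain_dist_nonneg[of x y] by (simp add: chains_def)
    qed
  qed
  have "openin mtopology U \<longleftrightarrow> openin X U" for U
    unfolding openin_mtopology base
  proof (intro conj_cong refl iffI ballI allI impI)
    fix x assume U: "U \<subseteq> topspace X" and x: "x \<in> U"
      and "\<forall>x. x \<in> U \<longrightarrow> (\<exists>r>0. mball x r \<subseteq> U)"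
    then obtain r where r: "r > 0" "mball x r \<subseteq> U" by blast
    obtain n where "(1 / 2) ^ n < r" using real_arch_pow_inv[OF r(1), of "1 / 2"] by auto
    then have "y \<in> U" if "E n x y" "y \<in> topspace X" for y
    proof -
      have "chain_dist x y < r"
        using chain_dist_if_E[OF that(1)] \<open>(1 / 2) ^ n < r\<close> by (simp add: power_one_over)
      then have "y \<in> mball x r" using that(2) U x by auto
      then show ?thesis using r(2) by blast
    qed
    then show "\<exists>n. \<forall>y\<in>topspace X. E n x y \<longrightarrow> y \<in> U" by blast
  next
    fix x assume U: "U \<subseteq> topspace X" and x: "x \<in> U"
      and "\<forall>x\<in>U. \<exists>n. \<forall>y\<in>topspace X. E n x y \<longrightarrow> y \<in> U"
    then obtain n where "\<forall>y\<in>topspace X. E n x y \<longrightarrow> y \<in> U" by blast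
    then have "mball x (1 / 2 ^ n) \<subseteq> U" using E_if_chain_dist_less by auto
    then show "\<exists>r>0. mball x r \<subseteq> U" by (intro exI[of _ "1 / 2 ^ n"]) simp
  qed
  then have "mtopology = X" by (simp add: topology_eq)
  then show ?thesis using metrizable_space_mtopology by simp
qed

end

section \<open>Frink's theorem and perfect images\<close>

text \<open>
  Frink's metrization theorem. Choosing for each point a subsequence of its
  neighbourhoods along which the last hypothesis advances one step at a time gives
  coverings \<open>W k\<close> such that two intersecting members of \<open>W (Suc k)\<close> lie in a common
  member of \<open>W k\<close>. The entourages are those of every second covering, which turns this
  doubling property into the threefold composition property.
\<close>

lemma metrizable_space_if_Frink:
  fixes V :: "nat \<Rightarrow> 'a \<Rightarrow> 'a set"
  assumes T1: "t1_space X"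
    and mem: "\<And>n x. x \<in> topspace X \<Longrightarrow> x \<in> V n x"
    and opn: "\<And>n x. x \<in> topspace X \<Longrightarrow> openin X (V n x)"
    and dec: "\<And>m n x. x \<in> topspace X \<Longrightarrow> m \<le> n \<Longrightarrow> V n x \<subseteq> V m x"
    and base: "\<And>x U. openin X U \<Longrightarrow> x \<in> U \<Longrightarrow> \<exists>n. V n x \<subseteq> U"
    and Frink: "\<And>x n. x \<in> topspace X \<Longrightarrow>
      \<exists>m. \<forall>y\<in>topspace X. V m y \<inter> V m x \<noteq> {} \<longrightarrow> V m y \<subseteq> V n x"
  shows "metrizable_space X"
proof -
  define P where "P x n m \<longleftrightarrow> n < m \<and>
    (\<forall>y\<in>topspace X. V m y \<inter> V m x \<noteq> {} \<longrightarrow> V m y \<subseteq> V n x)" for x n m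
  have "\<exists>m. P x n m" if x: "x \<in> topspace X" for x n
  proof -
    obtain m where m: "\<forall>y\<in>topspace X. V m y \<inter> V m x \<noteq> {} \<longrightarrow> V m y \<subseteq> V n x"
      using Frink[OF x] by blast
    have "V (max m (Suc n)) y \<subseteq> V m y" if "y \<in> topspace X" for y by (rule dec[OF that]) simp
    then have "V (max m (Suc n)) y \<subseteq> V n x"
      if "y \<in> topspace X" "V (max m (Suc n)) y \<inter> V (max m (Suc n)) x \<noteq> {}" for y
      using m x that by (metis disjoint_iff subset_eq)
    then have "P x n (max m (Suc n))" unfolding P_def by simp
    then show ?thesis by blast
  qed
  then obtain M where M: "\<And>x n. x \<in> topspace X \<Longrightarrow> P x n (M x n)" by metis
  define N where "N x k = (M x ^^ k) 0" for x k
  define W where "W k x = V (N x k) x" for k x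
  have N_ge: "k \<le> N x k" if "x \<in> topspace X" for x k
  proof (induction k)
    case (Suc k)
    have "N x k < N x (Suc k)" using M[OF that, of "N x k"] by (simp add: N_def P_def)
    then show ?case using Suc by simp
  qed simp
  have W_mem: "x \<in> W k x" and W_opn: "openin X (W k x)" if "x \<in> topspace X" for x k
    using mem opn that by (auto simp: W_def)
  have W_dec: "W (Suc k) x \<subseteq> W k x" if x: "x \<in> topspace X" for x k
    using M[OF x, of "N x k"] dec[OF x, of "N x k" "N x (Suc k)"] by (simp add: W_def N_def P_def)
  have W_half: "W (Suc k) x \<union> W (Suc k) y \<subseteq> W k y"
    if x: "x \<in> topspace X" and y: "y \<in> topspace X"
      and int: "W (Suc k) x \<inter> W (Suc k) y \<noteq> {}" and le: "N y (Suc k) \<le> N x (Suc k)" for x y k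
  proof -
    have sub: "W (Suc k) x \<subseteq> V (N y (Suc k)) x" unfolding W_def by (rule dec[OF x le])
    then have "V (N y (Suc k)) x \<inter> V (N y (Suc k)) y \<noteq> {}" using int unfolding W_def by blast
    then have "V (N y (Suc k)) x \<subseteq> W k y"
      using M[OF y, of "N y k"] x by (simp add: P_def N_def W_def)
    then show ?thesis using sub W_dec[OF y] by blast
  qed
  define B where "B k x y \<longleftrightarrow> x = y \<or> (\<exists>a\<in>topspace X. x \<in> W k a \<and> y \<in> W k a)" for k x y
  have B_Suc: "B k x y" if "B (Suc k) x y" for k x y using that W_dec unfolding B_def by blast
  have B_trans: "B k x z" if xy: "B (Suc k) x y" and yz: "B (Suc k) y z" for k x y z
  proof (cases "x = y \<or> y = z")
    case True then show ?thesis using B_Suc xy yz by blast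
  next
    case False
    then obtain a b where a: "a \<in> topspace X" "x \<in> W (Suc k) a" "y \<in> W (Suc k) a"
      and b: "b \<in> topspace X" "y \<in> W (Suc k) b" "z \<in> W (Suc k) b"
      using xy yz by (auto simp: B_def)
    then have "W (Suc k) a \<union> W (Suc k) b \<subseteq> W k a \<or> W (Suc k) a \<union> W (Suc k) b \<subseteq> W k b"
      using W_half[of a b k] W_half[of b a k] nle_le[of "N a (Suc k)" "N b (Suc k)"] by blast
    then show ?thesis using a b unfolding B_def by blast
  qed
  \<comment> \<open>The entourage with index 0 has to be everything, so the coverings are shifted by one.\<close>
  define E where "E n x y = (case n of 0 \<Rightarrow> True | Suc k \<Rightarrow> B (2 * k) x y)" for n x y
  interpret entourage_sequence E
  proof
    show "E 0 x y" for x y by (simp add: E_def)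
    show "E n x x" for n x by (simp add: E_def B_def split: nat.split)
    show "E n x y \<Longrightarrow> E n y x" for n x y by (auto simp: E_def B_def split: nat.splits)
    show "E n x u" if "E (Suc n) x y" "E (Suc n) y z" "E (Suc n) z u" for n x y z u
    proof (cases n)
      case (Suc k)
      then have "B (Suc (2 * k)) x z" using that B_trans[of "Suc (2 * k)" x y z] by (simp add: E_def)
      moreover have "B (Suc (2 * k)) z u" using that Suc B_Suc[of "Suc (2 * k)"] by (simp add: E_def)
      ultimately show ?thesis using B_trans by (auto simp: E_def Suc)
    qed (simp add: E_def)
  qed
  have nbhd: "\<exists>n. \<forall>y\<in>topspace X. E n x y \<longrightarrow> y \<in> U" if U: "openin X U" "x \<in> U" for U x
  proof -
    have x: "x \<in> topspace X" using U openin_subset by blast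
    obtain n where n: "V n x \<subseteq> U" using base[OF U] by blast
    define m where "m = M x n"
    have "y \<in> U" if "B (2 * m) x y" for y
    proof (cases "x = y")
      case False
      then obtain a where a: "a \<in> topspace X" "x \<in> W (2 * m) a" "y \<in> W (2 * m) a"
        using \<open>B (2 * m) x y\<close> by (auto simp: B_def)
      have sub: "W (2 * m) a \<subseteq> V m a" using dec[OF a(1)] N_ge[OF a(1), of "2 * m"] by (simp add: W_def)
      have "V m a \<subseteq> V n x"
        using M[OF x, of n] a(1,2) sub mem[OF x, of m] unfolding P_def m_def by blast
      then show ?thesis using a(3) sub n by blast
    qed (use U in simp)
    then show ?thesis by (intro exI[of _ "Suc m"]) (simp add: E_def)
  qed
  show ?thesis
  proof (rule metrizable_if_entourage_base)
    fix U
    show "openin X U \<longleftrightarrow> U \<subseteq> topspace X \<and> (\<forall>x\<in>U. \<exists>n. \<forall>y\<in>topspace X. E n x y \<longrightarrow> y \<in> U)"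
    proof (intro iffI conjI ballI)
      assume R: "U \<subseteq> topspace X \<and> (\<forall>x\<in>U. \<exists>n. \<forall>y\<in>topspace X. E n x y \<longrightarrow> y \<in> U)"
      have "\<exists>T. openin X T \<and> x \<in> T \<and> T \<subseteq> U" if x: "x \<in> U" for x
      proof -
        have xX: "x \<in> topspace X" using x R by blast
        obtain n where n: "\<forall>y\<in>topspace X. E n x y \<longrightarrow> y \<in> U" using R x by blast
        have "y \<in> U" if "y \<in> W (2 * (n - 1)) x" for y
        proof -
          have "E n x y" using that W_mem[OF xX] xX by (auto simp: E_def B_def split: nat.split)
          then show ?thesis using n W_opn[OF xX] openin_subset that by blast
        qed
        then show ?thesis using W_opn[OF xX] W_mem[OF xX] by blast
      qed
      then show "openin X U" by (subst openin_subopen) blast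
    qed (use nbhd openin_subset in blast)+
  next
    fix x y assume xy: "x \<in> topspace X" "y \<in> topspace X" and E: "\<And>n. E n x y"
    show "x = y"
    proof (rule ccontr)
      assume "x \<noteq> y"
      then have "openin X (topspace X - {y})" "x \<in> topspace X - {y}"
        using T1 xy by (auto simp: t1_space_closedin_singleton openin_diff)
      then show False using nbhd[of "topspace X - {y}" x] E xy by blast
    qed
  qed
qed

lemma half_reciprocal:
  assumes "2 * k + 1 \<le> m" shows "1 / real (Suc m) \<le> 1 / real (Suc k) / 2"
proof -
  have "real (2 * Suc k) \<le> real (Suc m)" unfolding of_nat_le_iff using assms by simp
  then have "1 / real (Suc m) \<le> 1 / real (2 * Suc k)" by (intro frac_le) auto
  then show ?thesis by (simp add: mult.commute)
qed

text \<open>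
  The theorem of Hanai, Morita and Stone for perfect maps. The \<open>n\<close>-th neighbourhood of
  \<open>x\<close> consists of the points whose fibre lies within \<open>1 / Suc n\<close> of the fibre of \<open>x\<close>.
  These sets are open because the map is closed, and they form a base because the
  fibres are compact.
\<close>

lemma metrizable_perfect_image:
  assumes M: "metrizable_space M" and X: "Hausdorff_space X"
    and f: "continuous_map M X f" "closed_map M X f" "f ` topspace M = topspace X"
    and fib: "\<And>x. x \<in> topspace X \<Longrightarrow> compactin M {z \<in> topspace M. f z = x}"
  shows "metrizable_space X"
proof -
  obtain S d where "Metric_space S d" and Meq: "M = Metric_space.mtopology S d"
    using M unfolding metrizable_space_def by blast
  then interpret Metric_space S d by simp
  have top: "topspace M = S" by (simp add: Meq)
  define F where "F x = {z \<in> S. f z = x}" for x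
  define G where "G n x = (\<Union>z\<in>F x. mball z (1 / real (Suc n)))" for n x
  define V where "V n x = {y \<in> topspace X. F y \<subseteq> G n x}" for n x
  have G_iff: "z \<in> G n x \<longleftrightarrow> (\<exists>z'\<in>F x. z' \<in> S \<and> z \<in> S \<and> d z' z < 1 / real (Suc n))" for z n x
    by (simp only: G_def UN_iff in_mball)
  have F_ne: "\<exists>z. z \<in> F x" if "x \<in> topspace X" for x
    using f(3) that unfolding F_def top by force
  have F_G: "F x \<subseteq> G n x" for x n by (auto simp: F_def G_def)
  have G_opn: "openin M (G n x)" for n x unfolding G_def Meq by blast
  have fat: "\<exists>n. G n x \<subseteq> U" if x: "x \<in> topspace X" and U: "openin M U" "F x \<subseteq> U" for x U
  proof -
    have "compactin mtopology (F x)" using fib[OF x] by (simp add: F_def Meq)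
    then obtain e where e: "e > 0" "\<And>z. z \<in> F x \<Longrightarrow> mball z e \<subseteq> U"
      using lebesgue_number[of "F x" "{U}"] U by (auto simp: Meq)
    obtain n where n: "inverse (real (Suc n)) < e" using reals_Archimedean[OF e(1)] by blast
    have "mball z (1 / real (Suc n)) \<subseteq> mball z e" for z
      using n by (intro mball_subset_concentric) (simp add: inverse_eq_divide)
    then show ?thesis using e(2) unfolding G_def by (intro exI[of _ n]) blast
  qed
  have V_opn: "openin X (V n x)" for n x
  proof -
    have "V n x = topspace X - f ` (S - G n x)" by (auto simp: V_def F_def)
    moreover have "closedin M (S - G n x)" using closedin_diff[OF closedin_topspace G_opn] by (simp add: top)
    ultimately show ?thesis using f(2) by (simp add: closed_map_def openin_diff)
  qed
  have near: "\<exists>z'\<in>F x. d z' z < 1 / real (Suc n)" if "z \<in> F y" "y \<in> V n x" for x y z n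
  proof -
    have "z \<in> G n x" using that by (auto simp: V_def)
    then show ?thesis unfolding G_iff by blast
  qed
  show ?thesis
  proof (rule metrizable_space_if_Frink[where V = V])
    show "t1_space X" using X by (rule Hausdorff_imp_t1_space)
    show "x \<in> V n x" if "x \<in> topspace X" for n x using that F_G by (auto simp: V_def)
    show "openin X (V n x)" for n x by (rule V_opn)
    show "V n x \<subseteq> V m x" if "m \<le> n" for m n x
    proof -
      have "mball z (1 / real (Suc n)) \<subseteq> mball z (1 / real (Suc m))" for z
        using that by (intro mball_subset_concentric) (simp add: frac_le)
      then have "G n x \<subseteq> G m x" unfolding G_def by blast
      then show ?thesis by (auto simp: V_def)
    qed
    show "\<exists>n. V n x \<subseteq> U" if U: "openin X U" "x \<in> U" for x U
    proof -
      have x: "x \<in> topspace X" using U openin_subset by blast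
      have "openin M {z \<in> S. f z \<in> U}"
        using openin_continuous_map_preimage[OF f(1) U(1)] by (simp add: top)
      then obtain n where n: "G n x \<subseteq> {z \<in> S. f z \<in> U}"
        using fat[OF x] U(2) by (force simp: F_def)
      have "y \<in> U" if y: "y \<in> V n x" for y
      proof -
        obtain z where "z \<in> F y" using F_ne y by (auto simp: V_def)
        then have "f z = y" "z \<in> G n x" using y by (auto simp: V_def F_def)
        then show ?thesis using n by blast
      qed
      then show ?thesis by blast
    qed
    show "\<exists>m. \<forall>y\<in>topspace X. V m y \<inter> V m x \<noteq> {} \<longrightarrow> V m y \<subseteq> V n x" if x: "x \<in> topspace X" for x n
    proof -
      have "openin M {z \<in> S. f z \<in> V (2 * n + 1) x}"
        using openin_continuous_map_preimage[OF f(1) V_opn] by (simp add: top)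
      moreover have "F x \<subseteq> {z \<in> S. f z \<in> V (2 * n + 1) x}" using x F_G by (auto simp: F_def V_def)
      ultimately obtain k where k: "G k x \<subseteq> {z \<in> S. f z \<in> V (2 * n + 1) x}"
        using fat[OF x] by blast
      \<comment> \<open>The triangle inequality will need \<open>2 / Suc m \<le> 1 / Suc k\<close> and
        \<open>1 / Suc m \<le> 1 / (2 * Suc n)\<close>.\<close>
      define m where "m = max (2 * k + 1) (2 * n + 1)"
      have mk: "1 / real (Suc m) \<le> 1 / real (Suc k) / 2"
        by (rule half_reciprocal) (simp add: m_def)
      have mn: "1 / real (Suc m) \<le> 1 / real (Suc n) / 2"
        and nn: "1 / real (Suc (2 * n + 1)) \<le> 1 / real (Suc n) / 2"
        by (rule half_reciprocal, simp add: m_def)+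
      have "V m y \<subseteq> V n x" if y: "y \<in> topspace X" and int: "V m y \<inter> V m x \<noteq> {}" for y
      proof -
        obtain w where w: "w \<in> V m y" "w \<in> V m x" using int by blast
        obtain t where t: "t \<in> F w" using F_ne w(1) by (auto simp: V_def)
        obtain zy where zy: "zy \<in> F y" "d zy t < 1 / real (Suc m)" using near[OF t w(1)] by blast
        obtain zx where zx: "zx \<in> F x" "d zx t < 1 / real (Suc m)" using near[OF t w(2)] by blast
        have S: "zx \<in> S" "zy \<in> S" "t \<in> S" using zx zy t by (auto simp: F_def)
        have "d zx zy < 1 / real (Suc k)"
        proof -
          have "d zx t < 1 / real (Suc k) / 2" by (rule less_le_trans[OF zx(2) mk])
          moreover have "d zy t < 1 / real (Suc k) / 2" by (rule less_le_trans[OF zy(2) mk])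
          ultimately show ?thesis using triangle[OF S(1,3,2)] commute[of zy t] by linarith
        qed
        then have "zy \<in> G k x" unfolding G_iff using zx(1) S by blast
        then have yV: "y \<in> V (2 * n + 1) x" using k zy(1) by (auto simp: F_def)
        show ?thesis
        proof
          fix u assume u: "u \<in> V m y"
          have "z \<in> G n x" if z: "z \<in> F u" for z
          proof -
            obtain a where a: "a \<in> F y" "d a z < 1 / real (Suc m)" using near[OF z u] by blast
            obtain b where b: "b \<in> F x" "d b a < 1 / real (Suc (2 * n + 1))" using near[OF a(1) yV] by blast
            have S: "b \<in> S" "a \<in> S" "z \<in> S" using a b z by (auto simp: F_def)
            have "d b a < 1 / real (Suc n) / 2" "d a z < 1 / real (Suc n) / 2"
              by (rule less_le_trans[OF b(2) nn], rule less_le_trans[OF a(2) mn])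
            then have "d b z < 1 / real (Suc n)" using triangle[OF S] by linarith
            then show ?thesis unfolding G_iff using b(1) S by blast
          qed
          then show "u \<in> V n x" using u unfolding V_def by blast
        qed
      qed
      then show ?thesis by blast
    qed
  qed
qed

section \<open>Families near a sequence without convergent subsequences\<close>

text \<open>
  A point near which infinitely many of the shrinking balls around the \<open>z n\<close> come
  would be an accumulation point of \<open>z\<close>.
\<close>

lemma (in Metric_space) locally_finite_near_sequence:
  assumes z: "range z \<subseteq> M"
    and nosub: "\<And>(r :: nat \<Rightarrow> nat) l. strict_mono r \<Longrightarrow> \<not> limitin mtopology (z \<circ> r) l sequentially"
    and a: "a \<in> M"
  obtains e where "e > 0" "finite {n. \<exists>y \<in> mball a e. d (z n) y < 1 / real (Suc n)}"
proof -
  have "\<not> accumulation_point mtopology z a"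
    using accumulation_point_subsequence[OF metrizable_space_mtopology] nosub by metis
  then obtain U where U: "openin mtopology U" "a \<in> U" "finite {n. z n \<in> U}"
    using a by (auto simp: accumulation_point_def)
  then obtain e where e: "e > 0" "mball a e \<subseteq> U" using openin_mtopology by blast
  obtain N where N: "inverse (real (Suc N)) < e / 2" using reals_Archimedean[of "e / 2"] e(1) by auto
  have "{n. \<exists>y \<in> mball a (e / 2). d (z n) y < 1 / real (Suc n)} \<subseteq> {n. z n \<in> U} \<union> {..N}"
  proof
    fix n assume "n \<in> {n. \<exists>y \<in> mball a (e / 2). d (z n) y < 1 / real (Suc n)}"
    then obtain y where y: "y \<in> M" "d a y < e / 2" "d (z n) y < 1 / real (Suc n)"
      unfolding mem_Collect_eq in_mball Bex_def by blast
    have "z n \<in> U" if "n > N"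
    proof -
      have "1 / real (Suc n) \<le> 1 / real (Suc N)" using that by (intro frac_le) auto
      then have "d (z n) y < e / 2" using y(3) N by (simp add: inverse_eq_divide)
      moreover have zn: "z n \<in> M" using z by blast
      ultimately have "d a (z n) < e" using triangle[OF a y(1) zn] y(2) commute[of y "z n"] by simp
      then have "z n \<in> mball a e" using a zn by simp
      then show ?thesis using e(2) by blast
    qed
    then show "n \<in> {n. z n \<in> U} \<union> {..N}" by (cases "n > N") auto
  qed
  moreover have "finite ({n. z n \<in> U} \<union> {..N})" using U(3) by simp
  ultimately have "finite {n. \<exists>y \<in> mball a (e / 2). d (z n) y < 1 / real (Suc n)}"
    by (rule finite_subset)
  then show thesis using that[of "e / 2"] e(1) by simp
qed

lemma (in Metric_space) closedin_Union_near_sequence: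
  assumes z: "range z \<subseteq> M"
    and nosub: "\<And>(r :: nat \<Rightarrow> nat) l. strict_mono r \<Longrightarrow> \<not> limitin mtopology (z \<circ> r) l sequentially"
    and cl: "\<And>n. closedin mtopology (R n)"
    and near: "\<And>n y. y \<in> R n \<Longrightarrow> d (z n) y < 1 / real (Suc n)"
  shows "closedin mtopology (\<Union>n. R n)"
proof (rule closedin_locally_finite_Union)
  show "closedin mtopology S" if "S \<in> range R" for S using that cl by blast
  show "locally_finite_in mtopology (range R)"
    unfolding locally_finite_in_def
  proof (intro conjI ballI)
    show "\<Union> (range R) \<subseteq> topspace mtopology" using cl closedin_subset by blast
    fix a assume "a \<in> topspace mtopology"
    then have a: "a \<in> M" by simp
    obtain e where e: "e > 0" "finite {n. \<exists>y \<in> mball a e. d (z n) y < 1 / real (Suc n)}"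
      by (rule locally_finite_near_sequence[OF z nosub a])
    have "{S \<in> range R. S \<inter> mball a e \<noteq> {}} \<subseteq>
        R ` {n. \<exists>y \<in> mball a e. d (z n) y < 1 / real (Suc n)}"
      using near by blast
    then have "finite {S \<in> range R. S \<inter> mball a e \<noteq> {}}"
      using e(2) finite_surj by blast
    then show "\<exists>V. openin mtopology V \<and> a \<in> V \<and> finite {U \<in> range R. U \<inter> V \<noteq> {}}"
      using e(1) a by (intro exI[of _ "mball a e"]) auto
  qed
qed

section \<open>Closed images of metrizable spaces\<close>

text \<open>
  If the frontier of the fibre over \<open>x\<close> is not compact, it contains a sequence \<open>z\<close>
  without convergent subsequences. Each \<open>z n\<close> is the limit of points outside the
  fibre, whose images form the \<open>n\<close>-th row of a fan at \<open>x\<close>. A set satisfying the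
  combinatorial condition is the image of a locally finite union of parts of these
  sequences, hence closed because the map is closed.
\<close>

lemma closed_fan_at_noncompact_frontier:
  fixes f :: "'b \<Rightarrow> 'a"
  assumes M: "metrizable_space M" and X: "Hausdorff_space X"
    and f: "continuous_map M X f" "closed_map M X f"
    and x: "x \<in> topspace X"
    and noncompact: "\<not> compactin M (M frontier_of {z \<in> topspace M. f z = x})"
  obtains p where "closedin X (fan_points p (\<lambda>n. x) x)"
    "double_fan (subtopology X (fan_points p (\<lambda>n. x) x)) p (\<lambda>n. x) x"
proof -
  obtain S d where "Metric_space S d" and Meq: "M = Metric_space.mtopology S d"
    using M unfolding metrizable_space_def by blast
  then interpret Metric_space S d by simp
  define F where "F = {z \<in> topspace M. f z = x}"
  have "closedin M F"
    using closedin_continuous_map_preimage[OF f(1), of "{x}"] x X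
    by (simp add: F_def closedin_Hausdorff_singleton)
  then have BF: "M frontier_of F \<subseteq> F" by (rule frontier_of_subset_closedin)
  have FS: "F \<subseteq> S" by (auto simp: F_def Meq)
  have "\<exists>z :: nat \<Rightarrow> 'b. range z \<subseteq> M frontier_of F \<and>
      \<not> (\<exists>l r. l \<in> M frontier_of F \<and> strict_mono r \<and> limitin mtopology (z \<circ> r) l sequentially)"
  proof -
    have "\<not> compactin mtopology (M frontier_of F)" using noncompact unfolding F_def Meq .
    moreover have "M frontier_of F \<subseteq> S" using BF FS by blast
    ultimately show ?thesis by (simp add: compactin_sequentially)
  qed
  then obtain z :: "nat \<Rightarrow> 'b" where z: "range z \<subseteq> M frontier_of F"
    and nz: "\<And>r l. l \<in> M frontier_of F \<Longrightarrow> strict_mono r \<Longrightarrow> \<not> limitin mtopology (z \<circ> r) l sequentially"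
    by blast
  have nosub: "\<not> limitin mtopology (z \<circ> r) l sequentially" if r: "strict_mono r" for r :: "nat \<Rightarrow> nat" and l
  proof
    assume l: "limitin mtopology (z \<circ> r) l sequentially"
    have "closedin mtopology (M frontier_of F)" by (simp add: Meq closedin_frontier_of)
    then have "l \<in> M frontier_of F"
      by (rule limitin_closedin[OF l]) (use z in \<open>auto intro!: always_eventually\<close>)
    then show False using nz r l by blast
  qed
  have zF: "z n \<in> F" and zS: "z n \<in> S" for n using z BF FS by blast+
  have "\<exists>u. range u \<subseteq> (S - F) \<inter> S \<and> limitin mtopology u (z n) sequentially" for n
  proof -
    have "z n \<in> mtopology closure_of (S - F)"
      using z unfolding frontier_of_closures Meq by auto
    then show ?thesis unfolding closure_of_sequentially by blast
  qed
  then obtain u where u: "\<And>n. range (u n) \<subseteq> (S - F) \<inter> S"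
    "\<And>n. limitin mtopology (u n) (z n) sequentially" by metis
  have uF: "u n k \<in> S" "f (u n k) \<noteq> x" for n k using u(1)[of n] by (auto simp: F_def Meq)
  have fu: "limitin X (\<lambda>k. f (u n k)) x sequentially" for n
    using continuous_map_limit[OF f(1), of "u n" "z n"] u(2) zF[of n]
    by (simp add: Meq o_def F_def)
  define I where "I n = {k. d (z n) (u n k) < 1 / real (Suc n)}" for n
  have "infinite (I n)" for n
  proof -
    have "\<forall>\<^sub>F k in sequentially. u n k \<in> S \<and> d (u n k) (z n) < 1 / real (Suc n)"
      using u(2)[of n] unfolding limitin_metric by simp
    then have "finite {k. \<not> (u n k \<in> S \<and> d (u n k) (z n) < 1 / real (Suc n))}"
      by (simp add: eventually_cofinite flip: cofinite_eq_sequentially)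
    then have "finite (- I n)" by (rule rev_finite_subset) (auto simp: I_def commute)
    then show ?thesis using finite_compl infinite_UNIV_nat by blast
  qed
  moreover have "x \<notin> (\<lambda>k. f (u n k)) ` I n" for n using uF(2) by (metis imageE)
  ultimately have inf: "infinite ((\<lambda>k. f (u n k)) ` I n)" for n
    by (intro infinite_image_of_convergent[OF X fu])
  obtain p :: "nat \<Rightarrow> nat \<Rightarrow> 'a" where p: "inj (case_prod p)" "\<And>n m. p n m \<in> (\<lambda>k. f (u n k)) ` I n"
    using injective_choice[of "\<lambda>n. (\<lambda>k. f (u n k)) ` I n", OF inf] by blast
  have "\<exists>k. k \<in> I n \<and> f (u n k) = p n m" for n m using p(2)[of n m] by (metis imageE)
  then obtain k where k: "\<And>n m. k n m \<in> I n" "\<And>n m. f (u n (k n m)) = p n m" by metis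
  define v where "v n m = u n (k n m)" for n m
  have v: "f (v n m) = p n m" "d (z n) (v n m) < 1 / real (Suc n)" "v n m \<in> S" for n m
    using k uF by (auto simp: v_def I_def)
  have "inj (p n)" for n using p(1) by (auto simp: inj_def)
  then have injv: "inj (v n)" for n using v(1) by (metis injD injI)
  have vz: "limitin mtopology (v n) (z n) sequentially" for n
    by (rule limitin_inj_rearrangement[OF u(2) injv]) (auto simp: v_def)
  have px: "limitin X (p n) x sequentially" for n
  proof (rule limitin_inj_rearrangement[OF fu[of n] \<open>inj (p n)\<close>])
    show "range (p n) \<subseteq> range (\<lambda>k. f (u n k))" using k(2)[of n] by (metis image_subsetI rangeI)
  qed
  have pne: "p n m \<noteq> x" for n m using k(2)[of n m] uF(2) by metis
  have cl: "closedin X C" if C: "C \<subseteq> fan_points p (\<lambda>n. x) x" "fan_closed p (\<lambda>n. x) x C" for C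
  proof -
    \<comment> \<open>The points \<open>z n\<close> are needed only if \<open>x \<in> C\<close>; otherwise \<open>C\<close> meets each row
      in a finite set and their images must not be added.\<close>
    define R where "R n = (if x \<in> C then {z n} else {}) \<union> {v n m | m. p n m \<in> C}" for n
    have "closedin mtopology (\<Union>n. R n)"
    proof (rule closedin_Union_near_sequence[OF _ nosub])
      show "range z \<subseteq> S" using zS by blast
      show "d (z n) y < 1 / real (Suc n)" if "y \<in> R n" for n y
        using that v(2) zS by (auto simp: R_def split: if_splits)
      show "closedin mtopology (R n)" for n
      proof (rule closedin_part_of_convergent[OF Hausdorff_space_mtopology vz])
        show "R n \<subseteq> topspace mtopology" using v(3) zS by (auto simp: R_def)
        show "R n \<subseteq> insert (z n) (range (v n))" by (auto simp: R_def)
        assume inf: "infinite {m. v n m \<in> R n}"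
        show "z n \<in> R n"
        proof (cases "x \<in> C")
          case False
          have "v n m \<in> R n \<Longrightarrow> p n m \<in> C" for m using False injv by (auto simp: R_def inj_eq)
          then have "{m. v n m \<in> R n} \<subseteq> {m. p n m \<in> C}" by blast
          then have "infinite {m. p n m \<in> C}" using inf finite_subset by blast
          then show ?thesis using False C(2) by (auto simp: fan_closed_def)
        qed (simp add: R_def)
      qed
    qed
    then have "closedin X (f ` (\<Union>n. R n))" using f(2) by (simp add: closed_map_def Meq)
    moreover have "f ` (\<Union>n. R n) = C"
    proof
      show "f ` (\<Union>n. R n) \<subseteq> C" using zF v(1) by (auto simp: R_def F_def split: if_splits)
      show "C \<subseteq> f ` (\<Union>n. R n)"
      proof
        fix c assume c: "c \<in> C"
        then have "c \<in> fan_points p (\<lambda>n. x) x" using C(1) by blast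
        then consider "c = x" | n m where "c = p n m" by (auto elim: fan_points_cases)
        then show "c \<in> f ` (\<Union>n. R n)"
        proof cases
          case 1
          then have "z 0 \<in> R 0" "f (z 0) = c" using c zF[of 0] by (auto simp: R_def F_def)
          then show ?thesis by blast
        next
          case 2
          then have "v n m \<in> R n" "f (v n m) = c" using c v(1) by (auto simp: R_def)
          then show ?thesis by blast
        qed
      qed
    qed
    ultimately show ?thesis by simp
  qed
  show thesis
  proof (rule that)
    show "closedin X (fan_points p (\<lambda>n. x) x)"
      "double_fan (subtopology X (fan_points p (\<lambda>n. x) x)) p (\<lambda>n. x) x"
      using double_fan_in_subspace[of p x "\<lambda>n. x" X] p(1) pne px x cl by simp_all
  qed
qed

text \<open>
  Discarding the interiors of the fibres leaves a closed subspace on which the map is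
  perfect. Over an isolated point the frontier is empty and one point of the fibre is
  kept instead.
\<close>

lemma closed_image_with_compact_frontiers_metrizable:
  assumes M: "metrizable_space M" and X: "Hausdorff_space X"
    and f: "continuous_map M X f" "closed_map M X f" "f ` topspace M = topspace X"
    and compact: "\<And>x. x \<in> topspace X \<Longrightarrow> compactin M (M frontier_of {z \<in> topspace M. f z = x})"
  shows "metrizable_space X"
proof -
  define F where "F x = {z \<in> topspace M. f z = x}" for x
  have F_cl: "closedin M (F x)" if "x \<in> topspace X" for x
    using closedin_continuous_map_preimage[OF f(1), of "{x}"] that X
    by (simp add: F_def closedin_Hausdorff_singleton)
  have F_ne: "\<exists>z. z \<in> F x" if "x \<in> topspace X" for x using f(3) that by (force simp: F_def)
  define c where "c x = (SOME z. z \<in> F x)" for x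
  have c: "c x \<in> F x" if "x \<in> topspace X" for x unfolding c_def by (rule someI_ex[OF F_ne[OF that]])
  define B where "B x = (if M frontier_of F x = {} then {c x} else M frontier_of F x)" for x
  have BF: "B x \<subseteq> F x" if "x \<in> topspace X" for x
    using c[OF that] frontier_of_subset_closedin[OF F_cl[OF that]] by (auto simp: B_def)
  have B_ne: "B x \<noteq> {}" for x by (simp add: B_def)
  define N where "N = (\<Union>x\<in>topspace X. B x)"
  have NM: "N \<subseteq> topspace M" using BF by (force simp: N_def F_def)
  have N_B: "N \<inter> F x = B x" if "x \<in> topspace X" for x
  proof
    show "N \<inter> F x \<subseteq> B x" using BF by (fastforce simp: N_def F_def)
    show "B x \<subseteq> N \<inter> F x" using BF that by (auto simp: N_def)
  qed
  have rest: "openin M (F x - B x)" if x: "x \<in> topspace X" for x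
  proof (cases "M frontier_of F x = {}")
    case True
    then have "openin M (F x)"
      using F_cl[OF x] by (simp add: frontier_of_eq_empty closedin_subset)
    moreover have "closedin M {c x}"
      using c[OF x] M metrizable_imp_Hausdorff_space closedin_Hausdorff_singleton
      by (fastforce simp: F_def)
    ultimately show ?thesis using True by (simp add: B_def openin_diff)
  next
    case False
    have "F x - M frontier_of F x = M interior_of F x"
      using F_cl[OF x] interior_of_subset[of M "F x"] by (auto simp: frontier_of_def closure_of_closedin)
    then show ?thesis using False by (simp add: B_def)
  qed
  have "topspace M - N = (\<Union>x\<in>topspace X. F x - B x)"
  proof
    show "topspace M - N \<subseteq> (\<Union>x\<in>topspace X. F x - B x)"
    proof
      fix z assume z: "z \<in> topspace M - N"
      then have "f z \<in> topspace X" "z \<in> F (f z)" using f(3) by (auto simp: F_def)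
      then show "z \<in> (\<Union>x\<in>topspace X. F x - B x)" using z by (auto simp: N_def)
    qed
    show "(\<Union>x\<in>topspace X. F x - B x) \<subseteq> topspace M - N"
      using N_B by (auto simp: F_def)
  qed
  moreover have "openin M (\<Union>x\<in>topspace X. F x - B x)" by (rule openin_Union) (use rest in blast)
  ultimately have clN: "closedin M N" using NM by (simp add: closedin_def)
  show ?thesis
  proof (rule metrizable_perfect_image)
    show "metrizable_space (subtopology M N)" using M by (rule metrizable_space_subtopology)
    show "Hausdorff_space X" by (rule X)
    show "continuous_map (subtopology M N) X f" using f(1) by (rule continuous_map_from_subtopology)
    show "closed_map (subtopology M N) X f" using closed_map_from_subtopology[OF f(2) clN] .
    have "x \<in> f ` N" if x: "x \<in> topspace X" for x
    proof -
      obtain z where "z \<in> B x" using B_ne by blast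
      then have "z \<in> N" "f z = x" using N_B[OF x] by (auto simp: F_def)
      then show ?thesis by blast
    qed
    then show "f ` topspace (subtopology M N) = topspace X" using NM f(3) by auto
    show "compactin (subtopology M N) {z \<in> topspace (subtopology M N). f z = x}" if x: "x \<in> topspace X" for x
    proof -
      have "{z \<in> topspace (subtopology M N). f z = x} = B x"
        using N_B[OF x] by (auto simp: F_def)
      moreover have "compactin M (B x)"
        using compact[OF x] c[OF x] by (simp add: B_def F_def)
      moreover have "B x \<subseteq> N" using x by (auto simp: N_def)
      ultimately show ?thesis by (simp add: compactin_subtopology)
    qed
  qed
qed

section \<open>Arens' fans in sequential spaces\<close>

text \<open>
  A set \<open>A\<close> whose limits of sequences do not form a closed set yields \<open>q n\<close> converging
  to \<open>r\<close>, where \<open>q n\<close> is the limit of a sequence in \<open>A\<close> and \<open>r\<close> is not. The section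
  lifts the rows, after thinning, to sequences converging to points \<open>w n\<close>. These have
  no convergent subsequence, since otherwise a diagonal in \<open>A\<close> would converge to \<open>r\<close>.
  Therefore no sequence that visits infinitely many rows converges, for its lift would
  accumulate somewhere; so the rows form a closed fan.
\<close>

lemma closed_fan_if_sequential_not_frechet_urysohn:
  fixes X :: "'a topology" and M :: "'b topology"
  assumes X: "Hausdorff_space X" "sequential_space X"
    and M: "metrizable_space M" and f: "continuous_map M X f"
    and s: "section_of M X f s" "cs_star_continuous X M s"
    and nFU: "\<not> frechet_urysohn_space X"
  obtains p q r where "closedin X (fan_points p q r)"
    "double_fan (subtopology X (fan_points p q r)) p q r" "inj q" "r \<notin> range q"
proof -
  obtain S d where "Metric_space S d" and Meq: "M = Metric_space.mtopology S d"
    using M unfolding metrizable_space_def by blast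
  then interpret Metric_space S d by simp
  have sS: "s x \<in> S" and fs: "f (s x) = x" if "x \<in> topspace X" for x
    using s(1) that by (auto simp: section_of_def Meq)
  obtain A a where A: "A \<subseteq> topspace X" "a \<in> X closure_of A"
    and na: "\<not> (\<exists>y. range y \<subseteq> A \<and> limitin X y a sequentially)"
    using nFU by (auto simp: frechet_urysohn_space_def)
  define A' where "A' = {l. \<exists>y. range y \<subseteq> A \<and> limitin X y l sequentially}"
  have A'X: "A' \<subseteq> topspace X" by (auto simp: A'_def dest: limitin_topspace)
  have AA': "A \<subseteq> A'"
  proof
    fix x assume x: "x \<in> A"
    then have "limitin X (\<lambda>n. x) x sequentially" using A(1) by auto
    moreover have "range (\<lambda>n::nat. x) \<subseteq> A" using x by auto
    ultimately show "x \<in> A'" unfolding A'_def by blast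
  qed
  have "\<not> seq_closedin X A'"
  proof
    assume "seq_closedin X A'"
    then have "closedin X A'" using X(2) by (simp add: sequential_space_def)
    with AA' have "X closure_of A \<subseteq> A'" by (simp add: closure_of_minimal)
    then show False using A(2) na by (auto simp: A'_def)
  qed
  then obtain b r where b: "range b \<subseteq> A'" "limitin X b r sequentially" and r: "r \<notin> A'"
    using A'X by (auto simp: seq_closedin_def)
  have "finite {n. b n \<in> A}"
  proof (rule ccontr)
    assume "infinite {n. b n \<in> A}"
    then obtain k :: "nat \<Rightarrow> nat" where k: "strict_mono k" "\<And>n. b (k n) \<in> A"
      using infinite_nat_subsequence[of "{n. b n \<in> A}"] by auto
    then have "range (b \<circ> k) \<subseteq> A" "limitin X (b \<circ> k) r sequentially"
      using limitin_subsequence[OF k(1) b(2)] by auto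
    then show False using r unfolding A'_def by blast
  qed
  then have "infinite (- {n. b n \<in> A})" by simp
  then have "infinite (b ` (- {n. b n \<in> A}))"
    by (intro infinite_image_of_convergent[OF X(1) b(2)]) (use b(1) r in auto)
  then obtain q :: "nat \<Rightarrow> 'a" where q: "inj q" "range q \<subseteq> b ` (- {n. b n \<in> A})"
    using infinite_countable_subset by blast
  have qA: "q n \<notin> A" "q n \<in> A'" for n
  proof -
    have "q n \<in> b ` (- {n. b n \<in> A})" using q(2) by (rule range_subsetD)
    then show "q n \<notin> A" "q n \<in> A'" using b(1) by auto
  qed
  have qr: "limitin X q r sequentially"
    by (rule limitin_inj_rearrangement[OF b(2) q(1)]) (use q(2) in auto)
  have "\<exists>y w. range y \<subseteq> A \<and> limitin X y (q n) sequentially \<and>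
      limitin mtopology (\<lambda>k. s (y k)) w sequentially" for n
  proof -
    obtain y where y: "range y \<subseteq> A" "limitin X y (q n) sequentially"
      using qA(2) unfolding A'_def by blast
    then have "convergent_seq X y" using A(1) by (auto simp: convergent_seq_def)
    then obtain w where "accumulation_point M (\<lambda>k. s (y k)) w"
      using s(2) by (auto simp: cs_star_continuous_def)
    then obtain k where k: "strict_mono k" "limitin M ((\<lambda>k. s (y k)) \<circ> k) w sequentially"
      by (rule accumulation_point_subsequence[OF M])
    show ?thesis
    proof (intro exI conjI)
      show "range (y \<circ> k) \<subseteq> A" using y(1) by auto
      show "limitin X (y \<circ> k) (q n) sequentially" by (rule limitin_subsequence[OF k(1) y(2)])
      show "limitin mtopology (\<lambda>i. s ((y \<circ> k) i)) w sequentially" using k(2) by (simp add: o_def Meq)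
    qed
  qed
  then obtain y w where y: "\<And>n. range (y n) \<subseteq> A" "\<And>n. limitin X (y n) (q n) sequentially"
    and w: "\<And>n. limitin mtopology (\<lambda>k. s (y n k)) (w n) sequentially" by metis
  have yA: "y n k \<in> A" for n k using y(1) by blast
  have wS: "w n \<in> S" for n using limitin_topspace[OF w] by simp
  have fw: "f (w n) = q n" for n
  proof -
    have "limitin X (\<lambda>k. f (s (y n k))) (f (w n)) sequentially"
      using continuous_map_limit[OF f, of "\<lambda>k. s (y n k)" "w n"] w by (simp add: Meq o_def)
    moreover have "(\<lambda>k. f (s (y n k))) = y n" using fs yA A(1) by blast
    ultimately show ?thesis
      using limitin_Hausdorff_unique[OF _ y(2) trivial_limit_sequentially X(1)] by simp
  qed
  \<comment> \<open>Keeping the lifted \<open>n\<close>-th row within \<open>1 / Suc n\<close> of \<open>w n\<close> forces a sequence of lifts from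
    infinitely many rows to accumulate only where \<open>w\<close> does.\<close>
  define I where "I n = {k. d (w n) (s (y n k)) < 1 / real (Suc n)}" for n
  have "infinite (I n)" for n
  proof -
    have "\<forall>\<^sub>F k in sequentially. s (y n k) \<in> S \<and> d (s (y n k)) (w n) < 1 / real (Suc n)"
      using w[of n] unfolding limitin_metric by simp
    then have "finite {k. \<not> (s (y n k) \<in> S \<and> d (s (y n k)) (w n) < 1 / real (Suc n))}"
      by (simp add: eventually_cofinite flip: cofinite_eq_sequentially)
    then have "finite (- I n)" by (rule rev_finite_subset) (auto simp: I_def commute)
    then show ?thesis using finite_compl infinite_UNIV_nat by blast
  qed
  moreover have "q n \<notin> y n ` I n" for n using yA qA(1)[of n] by (metis imageE)
  ultimately have inf: "infinite (y n ` I n)" for n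
    by (intro infinite_image_of_convergent[OF X(1) y(2)])
  obtain p :: "nat \<Rightarrow> nat \<Rightarrow> 'a" where p: "inj (case_prod p)" "\<And>n m. p n m \<in> y n ` I n"
    using injective_choice[of "\<lambda>n. y n ` I n", OF inf] by blast
  have "\<exists>k. k \<in> I n \<and> y n k = p n m" for n m using p(2)[of n m] by (metis imageE)
  then obtain k where k: "\<And>n m. k n m \<in> I n" "\<And>n m. y n (k n m) = p n m" by metis
  have pA: "p n m \<in> A" for n m using k(2)[of n m] yA by metis
  have pw: "d (w n) (s (p n m)) < 1 / real (Suc n)" for n m
    using k(1)[of n m] unfolding I_def mem_Collect_eq k(2) .
  have "inj (p n)" for n using p(1) by (auto simp: inj_def)
  then have pq: "limitin X (p n) (q n) sequentially" for n
  proof (rule limitin_inj_rearrangement[OF y(2)])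
    show "range (p n) \<subseteq> range (y n)" using k(2)[of n] by (metis image_subsetI rangeI)
  qed
  have nosub: "\<not> limitin mtopology (w \<circ> k) l sequentially" if k: "strict_mono k" for k :: "nat \<Rightarrow> nat" and l
  proof
    assume l: "limitin mtopology (w \<circ> k) l sequentially"
    have "limitin mtopology (\<lambda>j. s (p (k j) 0)) l sequentially"
      unfolding limitin_metric
    proof (intro conjI allI impI)
      show "l \<in> S" using limitin_topspace[OF l] by simp
      fix e :: real assume "e > 0"
      then have e2: "e / 2 > 0" by simp
      then obtain N where N: "inverse (real (Suc N)) < e / 2" using reals_Archimedean by blast
      have "\<forall>\<^sub>F j in sequentially. (w \<circ> k) j \<in> S \<and> d ((w \<circ> k) j) l < e / 2"
        using l e2 unfolding limitin_metric by blast
      moreover have "\<forall>\<^sub>F j in sequentially. j \<ge> N" by (rule eventually_ge_at_top)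
      ultimately show "\<forall>\<^sub>F j in sequentially. s (p (k j) 0) \<in> S \<and> d (s (p (k j) 0)) l < e"
      proof (eventually_elim, intro conjI)
        fix j assume j: "(w \<circ> k) j \<in> S \<and> d ((w \<circ> k) j) l < e / 2" "N \<le> j"
        show "s (p (k j) 0) \<in> S" using sS pA A(1) by blast
        have "N \<le> k j" using j(2) seq_suble[OF k, of j] by simp
        then have "1 / real (Suc (k j)) \<le> 1 / real (Suc N)" by (intro frac_le) auto
        then have "d (w (k j)) (s (p (k j) 0)) < e / 2"
          using pw[of "k j" 0] N by (simp add: inverse_eq_divide)
        then show "d (s (p (k j) 0)) l < e"
          using triangle[OF \<open>s (p (k j) 0) \<in> S\<close> wS \<open>l \<in> S\<close>, of "k j"] j(1)
            commute[of "w (k j)" "s (p (k j) 0)"] by simp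
      qed
    qed
    then have "limitin X (\<lambda>j. f (s (p (k j) 0))) (f l) sequentially"
      using continuous_map_limit[OF f, of "\<lambda>j. s (p (k j) 0)" l] by (simp add: Meq o_def)
    moreover have "(\<lambda>j. f (s (p (k j) 0))) = (\<lambda>j. p (k j) 0)" using fs pA A(1) by blast
    moreover have "f l = r"
    proof -
      have "limitin X (q \<circ> k) (f l) sequentially"
        using continuous_map_limit[OF f, of "w \<circ> k" l] l fw by (simp add: Meq o_def)
      then show ?thesis
        using limitin_Hausdorff_unique[OF _ limitin_subsequence[OF k qr] trivial_limit_sequentially X(1)]
        by blast
    qed
    ultimately have "limitin X (\<lambda>j. p (k j) 0) r sequentially" by simp
    moreover have "range (\<lambda>j. p (k j) 0) \<subseteq> A" using pA by blast
    ultimately show False using r unfolding A'_def by blast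
  qed
  have distinct: "p n m \<noteq> r" "p n m \<noteq> q k" "r \<notin> range q" for n m k
  proof -
    show "p n m \<noteq> r" using pA AA' r by blast
    show "p n m \<noteq> q k" using pA[of n m] qA(1)[of k] by auto
    show "r \<notin> range q" using qA(2) r by blast
  qed
  have cl: "closedin X C" if C: "C \<subseteq> fan_points p q r" "fan_closed p q r C" for C
  proof -
    have "p n m \<in> topspace X" "q n \<in> topspace X" "r \<in> topspace X" for n m
      using pA A(1) qA(2) A'X limitin_topspace[OF qr] by blast+
    then have "fan_points p q r \<subseteq> topspace X" unfolding fan_points_def by auto
    then have CX: "C \<subseteq> topspace X" using C(1) by blast
    have "seq_closedin X C"
      unfolding seq_closedin_def
    proof (intro conjI CX allI impI)
      fix c l assume "range c \<subseteq> C \<and> limitin X c l sequentially"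
      then have c: "\<And>j. c j \<in> C" "limitin X c l sequentially" by auto
      show "l \<in> C"
      proof (rule ccontr)
        assume l: "l \<notin> C"
        have fin: "finite {j. c j \<in> C \<inter> D}" if "closedin X (C \<inter> D)" for D
        proof (rule ccontr)
          assume "infinite {j. c j \<in> C \<inter> D}"
          then have "l \<in> C \<inter> D" by (rule closedin_frequent_limit[OF that c(2)])
          then show False using l by blast
        qed
        have fin_q: "finite {j. c j \<in> C \<inter> insert r (range q)}"
        proof (rule fin, rule closedin_part_of_convergent[OF X(1) qr])
          show "r \<in> C \<inter> insert r (range q)" if "infinite {n. q n \<in> C \<inter> insert r (range q)}"
            using that C(2) by (simp add: fan_closed_def)
        qed (use CX in auto)
        have fin_p: "finite {j. c j \<in> C \<inter> insert (q n) (range (p n))}" for n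
        proof (rule fin, rule closedin_part_of_convergent[OF X(1) pq])
          show "q n \<in> C \<inter> insert (q n) (range (p n))"
            if "infinite {m. p n m \<in> C \<inter> insert (q n) (range (p n))}"
            using that C(2) by (simp add: fan_closed_def)
        qed (use CX in auto)
        have "convergent_seq X c" using c CX by (auto simp: convergent_seq_def)
        then obtain a where "accumulation_point M (\<lambda>j. s (c j)) a"
          using s(2) by (auto simp: cs_star_continuous_def)
        then have aS: "a \<in> S" and acc: "\<And>U. openin M U \<Longrightarrow> a \<in> U \<Longrightarrow> infinite {j. s (c j) \<in> U}"
          by (auto simp: accumulation_point_def Meq)
        have "range w \<subseteq> S" using wS by blast
        then obtain e where e: "e > 0" "finite {n. \<exists>y \<in> mball a e. d (w n) y < 1 / real (Suc n)}"
          by (rule locally_finite_near_sequence[OF _ nosub aS])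
        have "{j. s (c j) \<in> mball a e} \<subseteq> {j. c j \<in> C \<inter> insert r (range q)} \<union>
            (\<Union>n\<in>{n. \<exists>y \<in> mball a e. d (w n) y < 1 / real (Suc n)}.
              {j. c j \<in> C \<inter> insert (q n) (range (p n))})"
        proof
          fix j assume j: "j \<in> {j. s (c j) \<in> mball a e}"
          have "c j \<in> fan_points p q r" using c(1) C(1) by blast
          then consider "c j \<in> insert r (range q)" | n m where "c j = p n m"
            by (auto elim: fan_points_cases)
          then show "j \<in> {j. c j \<in> C \<inter> insert r (range q)} \<union>
            (\<Union>n\<in>{n. \<exists>y \<in> mball a e. d (w n) y < 1 / real (Suc n)}.
              {j. c j \<in> C \<inter> insert (q n) (range (p n))})"
          proof cases
            case 1
            then show ?thesis using c(1) by blast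
          next
            case 2
            then have "\<exists>y \<in> mball a e. d (w n) y < 1 / real (Suc n)"
              using j pw[of n m] by (intro bexI[of _ "s (c j)"]) auto
            moreover have "c j \<in> C \<inter> insert (q n) (range (p n))" using c(1) 2 by blast
            ultimately show ?thesis by blast
          qed
        qed
        moreover have "finite ({j. c j \<in> C \<inter> insert r (range q)} \<union>
            (\<Union>n\<in>{n. \<exists>y \<in> mball a e. d (w n) y < 1 / real (Suc n)}.
              {j. c j \<in> C \<inter> insert (q n) (range (p n))}))"
          using fin_q fin_p e(2) by blast
        ultimately have "finite {j. s (c j) \<in> mball a e}" by (rule finite_subset)
        moreover have "infinite {j. s (c j) \<in> mball a e}"
          by (rule acc) (use e(1) aS in \<open>auto simp: Meq\<close>)
        ultimately show False by blast
      qed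
    qed
    then show ?thesis using X(2) by (simp add: sequential_space_def)
  qed
  show thesis
  proof (rule that)
    show "closedin X (fan_points p q r)" "double_fan (subtopology X (fan_points p q r)) p q r"
      using double_fan_in_subspace[OF p(1) distinct(1,2) pq qr cl] by blast+
    show "inj q" "r \<notin> range q" using q(1) distinct(3) by auto
  qed
qed

section \<open>Frechet--Urysohn spaces\<close>

lemma frechet_urysohn_imp_sequential_space:
  assumes "frechet_urysohn_space X" shows "sequential_space X"
  unfolding sequential_space_def
proof (intro allI impI)
  fix A assume A: "seq_closedin X A"
  have "X closure_of A \<subseteq> A"
  proof
    fix a assume "a \<in> X closure_of A"
    then obtain y where "range y \<subseteq> A" "limitin X y a sequentially"
      using assms A unfolding frechet_urysohn_space_def seq_closedin_def by blast
    then show "a \<in> A" using A unfolding seq_closedin_def by blast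
  qed
  then show "closedin X A" 
    using A closure_of_subset_eq[of A X] unfolding seq_closedin_def by blast
qed

lemma frechet_urysohn_subtopology:
  assumes "frechet_urysohn_space X" shows "frechet_urysohn_space (subtopology X A)"
  unfolding frechet_urysohn_space_def
proof (intro allI impI)
  fix B a assume B: "B \<subseteq> topspace (subtopology X A) \<and> a \<in> subtopology X A closure_of B"
  then have a: "a \<in> A" "a \<in> X closure_of B" and BA: "B \<subseteq> A" "B \<subseteq> topspace X"
    by (auto simp: closure_of_subtopology Int_absorb1)
  then obtain y where y: "range y \<subseteq> B" "limitin X y a sequentially"
    using assms unfolding frechet_urysohn_space_def by blast
  then have "limitin (subtopology X A) y a sequentially"
    using a BA by (auto simp: limitin_subtopology intro!: always_eventually)
  then show "\<exists>y. range y \<subseteq> B \<and> limitin (subtopology X A) y a sequentially" using y(1) by blast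
qed

lemma homeomorphic_frechet_urysohn_space:
  assumes "X homeomorphic_space Y" "frechet_urysohn_space X"
  shows "frechet_urysohn_space Y"
  unfolding frechet_urysohn_space_def
proof (intro allI impI)
  obtain f g where f: "continuous_map X Y f" and g: "continuous_map Y X g"
    and fg: "\<And>y. y \<in> topspace Y \<Longrightarrow> f (g y) = y"
    using assms(1) by (auto simp: homeomorphic_space_def homeomorphic_maps_def)
  fix A a assume A: "A \<subseteq> topspace Y \<and> a \<in> Y closure_of A"
  then have aY: "a \<in> topspace Y" using closure_of_subset_topspace by fastforce
  have "g a \<in> X closure_of (g ` A)"
    using continuous_map_image_closure_subset[OF g, of A] A by blast
  moreover have "g ` A \<subseteq> topspace X" using g A by (auto simp: continuous_map_def)
  ultimately obtain y where y: "range y \<subseteq> g ` A" "limitin X y (g a) sequentially"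
    using assms(2) unfolding frechet_urysohn_space_def by blast
  have "limitin Y (\<lambda>n. f (y n)) a sequentially"
    using continuous_map_limit[OF f y(2)] fg[OF aY] by (simp add: o_def)
  moreover have "f (y n) \<in> A" for n
  proof -
    obtain t where "t \<in> A" "y n = g t" using y(1) by blast
    then show ?thesis using A fg by (metis subsetD)
  qed
  then have "range (\<lambda>n. f (y n)) \<subseteq> A" by blast
  ultimately show "\<exists>y. range y \<subseteq> A \<and> limitin Y y a sequentially" by blast
qed

text \<open>
  The point \<open>r\<close> is in the closure of the rows, but a sequence in the rows converging
  to \<open>r\<close> meets each row finitely often, and then its range is closed.
\<close>

lemma double_fan_not_frechet_urysohn:
  assumes T: "double_fan T p q r" and q: "inj q" and r: "r \<notin> range q"
  shows "\<not> frechet_urysohn_space T"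
proof
  assume FU: "frechet_urysohn_space T"
  let ?P = "range (case_prod p)"
  have P: "?P \<subseteq> topspace T" using T by (auto simp: double_fan_def)
  then have sub: "?P \<subseteq> T closure_of ?P" by (rule closure_of_subset)
  have pP: "p n m \<in> T closure_of ?P" for n m using sub by (auto simp: image_subset_iff)
  then have "q n \<in> T closure_of ?P" for n
    by (intro closedin_frequent_limit[OF closedin_closure_of double_fan_limits(1)[OF T]]) simp
  then have "r \<in> T closure_of ?P"
    by (intro closedin_frequent_limit[OF closedin_closure_of double_fan_limits(2)[OF T]]) simp
  then obtain y where y: "range y \<subseteq> ?P" "limitin T y r sequentially"
    using FU P unfolding frechet_urysohn_space_def by blast
  have "\<exists>k m. y j = p k m" for j using y(1) by (force simp: image_iff)
  then obtain k m where km: "\<And>j. y j = p (k j) (m j)" by metis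
  have fin: "finite {j. k j = n}" for n
  proof (rule ccontr)
    assume inf: "infinite {j. k j = n}"
    have "{i. q i \<in> insert (q n) (range (p n))} \<subseteq> {n}"
      using double_fan_distinct(5)[OF T] q by (auto simp: inj_eq)
    then have "finite {i. q i \<in> insert (q n) (range (p n))}" by (rule finite_subset) simp
    moreover have "q k \<in> insert (q n) (range (p n))"
      if inf: "infinite {m. p k m \<in> insert (q n) (range (p n))}" for k
    proof (cases "k = n")
      case False
      then have "{m. p k m \<in> insert (q n) (range (p n))} = {}"
        using double_fan_distinct[OF T] by auto
      then show ?thesis using inf by (metis finite.emptyI)
    qed simp
    ultimately have "closedin T (insert (q n) (range (p n)))"
      unfolding double_fan_closedin[OF T] fan_closed_def by (auto simp: subset_iff)
    moreover have "infinite {j. y j \<in> insert (q n) (range (p n))}"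
      using inf by (rule contrapos_nn) (auto simp: km elim: rev_finite_subset)
    ultimately have "r \<in> insert (q n) (range (p n))"
      by (intro closedin_frequent_limit[OF _ y(2)])
    then show False using r double_fan_distinct(4)[OF T] by auto
  qed
  have "closedin T (range y)"
    unfolding double_fan_closedin[OF T] fan_closed_def
  proof (intro conjI allI impI)
    show "range y \<subseteq> fan_points p q r" by (auto simp: km)
    have "{i. p n i \<in> range y} \<subseteq> m ` {j. k j = n}" for n
      using double_fan_distinct(1)[OF T] by (auto simp: km)
    then have "finite {i. p n i \<in> range y}" for n
      by (rule finite_subset) (simp add: fin)
    then show "q n \<in> range y" if "infinite {i. p n i \<in> range y}" for n using that by blast
    have "{n. q n \<in> range y} = {}" using double_fan_distinct(5)[OF T] by (auto simp: km)
    then show "r \<in> range y" if "infinite {n. q n \<in> range y}" using that by simp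
  qed
  then have "r \<in> range y"
    by (rule limitin_closedin[OF y(2)]) auto
  then show False using double_fan_distinct(4)[OF T] by (auto simp: km)
qed

lemma lasnev_imp_frechet_urysohn:
  assumes "lasnev_space X" shows "frechet_urysohn_space X"
proof -
  obtain M :: "(nat \<Rightarrow> 'a) topology" and f where M: "metrizable_space M"
    and f: "continuous_map M X f" "closed_map M X f" "f ` topspace M = topspace X"
    using assms unfolding lasnev_space_def by blast
  obtain S d where "Metric_space S d" and Meq: "M = Metric_space.mtopology S d"
    using M unfolding metrizable_space_def by blast
  then interpret Metric_space S d by simp
  show ?thesis
    unfolding frechet_urysohn_space_def
  proof (intro allI impI)
    fix A a assume A: "A \<subseteq> topspace X \<and> a \<in> X closure_of A"
    define B where "B = {z \<in> S. f z \<in> A}"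
    have "B \<subseteq> M closure_of B" by (intro closure_of_subset) (auto simp: B_def Meq)
    moreover have "A \<subseteq> f ` B" using A f(3) by (force simp: B_def Meq)
    ultimately have "A \<subseteq> f ` (M closure_of B)" by blast
    moreover have "closedin X (f ` (M closure_of B))" using f(2) by (simp add: closed_map_def)
    ultimately have "X closure_of A \<subseteq> f ` (M closure_of B)" by (rule closure_of_minimal)
    then obtain z where z: "z \<in> M closure_of B" "a = f z" using A by blast
    then obtain u where u: "range u \<subseteq> B" "limitin M u z sequentially"
      unfolding Meq closure_of_sequentially by blast
    have "limitin X (\<lambda>n. f (u n)) a sequentially"
      using continuous_map_limit[OF f(1) u(2)] z(2) by (simp add: o_def)
    moreover have "range (\<lambda>n. f (u n)) \<subseteq> A" using u(1) by (auto simp: B_def)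
    ultimately show "\<exists>y. range y \<subseteq> A \<and> limitin X y a sequentially" by blast
  qed
qed

section \<open>Implications between the metrizability notions\<close>

text \<open>
  A convergent sequence is precompact, so its image under a section with values in \<open>Z\<close>
  is precompact.
\<close>

lemma k_star_imp_cs_star_metrizable:
  assumes X: "Hausdorff_space X" and k: "k_star_metrizable X"
  shows "cs_star_metrizable X"
proof -
  obtain M :: "(nat \<Rightarrow> 'a) topology" and f where M: "metrizable_space M" and f: "subproper_map M X f"
    using k unfolding k_star_metrizable_def by blast
  obtain Z where Z: "Z \<subseteq> topspace M" "f ` Z = topspace X"
    and pre: "\<And>K. precompactin X K \<Longrightarrow> precompactin M (Z \<inter> {x \<in> topspace M. f x \<in> K})"
    using f unfolding subproper_map_def by blast
  obtain s where s: "section_of M X f s" "s \<in> topspace X \<rightarrow> Z"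
    by (rule surj_section[OF Z(2,1)])
  have "\<exists>a. accumulation_point M (\<lambda>n. s (y n)) a" if conv: "convergent_seq X y" for y
  proof -
    obtain l where y: "range y \<subseteq> topspace X" and l: "limitin X y l sequentially"
      using conv by (auto simp: convergent_seq_def)
    have "precompactin X (range y)"
      by (rule precompactin_subset_compact[OF X compactin_sequence_with_limit[OF l subset_refl y]]) auto
    then have P: "precompactin M (Z \<inter> {x \<in> topspace M. f x \<in> range y})" by (rule pre)
    have "range (\<lambda>n. s (y n)) \<subseteq> Z \<inter> {x \<in> topspace M. f x \<in> range y}"
      using s y Z(1) by (fastforce simp: section_of_def)
    then obtain a r where "strict_mono r" "limitin M ((\<lambda>n. s (y n)) \<circ> r) a sequentially"
      by (rule precompactin_subsequence[OF M P])
    then have "accumulation_point M (\<lambda>n. s (y n)) a"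
      by (rule accumulation_point_of_subsequence_limit)
    then show ?thesis by blast
  qed
  then have "cs_star_continuous X M s"
    using s(1) by (simp add: cs_star_continuous_def section_of_def)
  then show ?thesis
    using cs_star_metrizableI[OF M _ s(1)] f by (simp add: subproper_map_def)
qed

lemma k_imp_k_star_metrizable:
  assumes "k_metrizable X" shows "k_star_metrizable X"
proof -
  obtain M :: "(nat \<Rightarrow> 'a) topology" and f where M: "metrizable_space M" and f: "kproper_map M X f"
    and onto: "f ` topspace M = topspace X"
    using assms unfolding k_metrizable_def by blast
  have "topspace M \<inter> {x \<in> topspace M. f x \<in> K} = {x \<in> topspace M. f x \<in> K}" for K by blast
  then have "subproper_map M X f"
    using f onto unfolding subproper_map_def kproper_map_def
    by (intro conjI exI[of _ "topspace M"]) auto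
  then show ?thesis using k_star_metrizableI[OF M _ onto] by blast
qed

lemma cs_imp_cs_star_metrizable:
  assumes "cs_metrizable X" shows "cs_star_metrizable X"
proof -
  obtain M :: "(nat \<Rightarrow> 'a) topology" and f s where M: "metrizable_space M" and f: "continuous_map M X f"
    and s: "section_of M X f s" "seq_continuous X M s"
    using assms unfolding cs_metrizable_def by blast
  have "\<exists>a. accumulation_point M (\<lambda>n. s (y n)) a" if conv: "convergent_seq X y" for y
  proof -
    have "convergent_seq M (\<lambda>n. s (y n))" using s(2) conv by (simp add: seq_continuous_def)
    then obtain a where "limitin M (\<lambda>n. s (y n)) a sequentially"
      unfolding convergent_seq_def by blast
    then have "accumulation_point M (\<lambda>n. s (y n)) a"
      by (intro accumulation_point_of_subsequence_limit[of id]) (simp_all add: strict_mono_def)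
    then show ?thesis by blast
  qed
  then have "cs_star_continuous X M s"
    using s(2) by (simp add: cs_star_continuous_def seq_continuous_def)
  then show ?thesis by (rule cs_star_metrizableI[OF M f s(1)])
qed

section \<open>Diagonals exclude fans\<close>

lemma metrizable_diagonal_sequence:
  assumes M: "metrizable_space M"
    and a: "\<And>j. limitin M (a j) (b j) sequentially" and b: "limitin M b v sequentially"
  obtains m :: "nat \<Rightarrow> nat" where "limitin M (\<lambda>j. a j (m j)) v sequentially"
proof -
  obtain S d where "Metric_space S d" and Meq: "M = Metric_space.mtopology S d"
    using M unfolding metrizable_space_def by blast
  then interpret Metric_space S d by simp
  have bS: "b j \<in> S" for j using limitin_topspace[OF a] by (simp add: Meq)
  have vS: "v \<in> S" using limitin_topspace[OF b] by (simp add: Meq)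
  have "\<exists>m. a j m \<in> S \<and> d (a j m) (b j) < inverse (real (Suc j))" for j
  proof -
    have "inverse (real (Suc j)) > 0" by simp
    then have "\<forall>\<^sub>F m in sequentially. a j m \<in> S \<and> d (a j m) (b j) < inverse (real (Suc j))"
      using a[of j] unfolding Meq limitin_metric by blast
    then show ?thesis using eventually_happens trivial_limit_sequentially by blast
  qed
  then obtain m where m: "\<And>j. a j (m j) \<in> S" "\<And>j. d (a j (m j)) (b j) < inverse (real (Suc j))"
    by metis
  have "limitin M (\<lambda>j. a j (m j)) v sequentially"
    unfolding Meq limitin_metric
  proof (intro conjI vS allI impI)
    fix e :: real assume e: "e > 0"
    then have "e / 2 > 0" by simp
    then have "\<forall>\<^sub>F j in sequentially. b j \<in> S \<and> d (b j) v < e / 2"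
      using b unfolding Meq limitin_metric by blast
    moreover have "\<forall>\<^sub>F j in sequentially. inverse (real (Suc j)) < e / 2"
      using LIMSEQ_inverse_real_of_nat e by (intro order_tendstoD) auto
    ultimately show "\<forall>\<^sub>F j in sequentially. a j (m j) \<in> S \<and> d (a j (m j)) v < e"
    proof eventually_elim
      case (elim j)
      have "d (a j (m j)) (b j) < e / 2" by (rule less_trans[OF m(2) elim(2)])
      then show ?case using triangle[OF m(1) bS vS, of j j] elim(1) m(1) by force
    qed
  qed
  then show thesis using that by blast
qed

text \<open>
  Fans violate this property, and it is inherited along sequential homeomorphisms onto
  subspaces. Unlike the metrizability of the coreflection, it can be read off directly
  from a proper map.
\<close>

definition diagonal_property :: "'a topology \<Rightarrow> bool" where
  "diagonal_property X \<longleftrightarrow>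
     (\<forall>x y l. (\<forall>n k. x n k \<in> topspace X) \<and> (\<forall>n. limitin X (x n) (y n) sequentially) \<and>
        limitin X y l sequentially \<longrightarrow>
        (\<exists>(k :: nat \<Rightarrow> nat) (m :: nat \<Rightarrow> nat). strict_mono k \<and> limitin X (\<lambda>j. x (k j) (m j)) l sequentially))"

text \<open>
  The section carries the double sequence to a metrizable space, where a diagonal can
  be chosen.
\<close>

lemma cs_metrizable_diagonal_property:
  assumes X: "Hausdorff_space X" and cs: "cs_metrizable X" shows "diagonal_property X"
  unfolding diagonal_property_def
proof (intro allI impI, elim conjE)
  obtain M :: "(nat \<Rightarrow> 'a) topology" and f s where M: "metrizable_space M" and f: "continuous_map M X f"
    and s: "section_of M X f s" "seq_continuous X M s"
    using cs unfolding cs_metrizable_def by blast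
  fix x :: "nat \<Rightarrow> nat \<Rightarrow> 'a" and y :: "nat \<Rightarrow> 'a" and l
  assume x: "\<forall>n k. x n k \<in> topspace X" and lim: "\<forall>n. limitin X (x n) (y n) sequentially"
    "limitin X y l sequentially"
  have yX: "y n \<in> topspace X" and lX: "l \<in> topspace X" for n
    using lim limitin_topspace by metis+
  note slim = seq_continuous_limit[OF s(2) metrizable_imp_Hausdorff_space[OF M]]
  have 1: "limitin M (\<lambda>k. s (x n k)) (s (y n)) sequentially" for n
    by (rule slim) (use x lim in auto)
  have 2: "limitin M (\<lambda>n. s (y n)) (s l) sequentially"
    by (rule slim) (use yX lim in auto)
  obtain m where m: "limitin M (\<lambda>j. s (x j (m j))) (s l) sequentially"
    by (rule metrizable_diagonal_sequence[OF M 1 2])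
  have "limitin X (\<lambda>j. x j (m j)) l sequentially"
    using continuous_map_limit[OF f m] s(1) x lX by (simp add: o_def section_of_def)
  then show "\<exists>(k :: nat \<Rightarrow> nat) (m :: nat \<Rightarrow> nat). strict_mono k \<and> limitin X (\<lambda>j. x (k j) (m j)) l sequentially"
    by (intro exI[of _ "\<lambda>j. j"] exI[of _ m]) (simp add: strict_mono_def)
qed

text \<open>
  Lifts of the rows need not converge, but by properness they have convergent
  subsequences, and the limits of these again have a convergent subsequence. This is
  the reason for allowing a subsequence \<open>k\<close> of rows in the diagonal property.
\<close>

lemma k_metrizable_diagonal_property:
  assumes X: "Hausdorff_space X" and k: "k_metrizable X" shows "diagonal_property X"
  unfolding diagonal_property_def
proof (intro allI impI, elim conjE)
  obtain M :: "(nat \<Rightarrow> 'a) topology" and f where M: "metrizable_space M" and f: "continuous_map M X f"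
    and pre: "\<And>K. precompactin X K \<Longrightarrow> precompactin M {z \<in> topspace M. f z \<in> K}"
    and onto: "f ` topspace M = topspace X"
    using k unfolding k_metrizable_def kproper_map_def by blast
  obtain s where s: "section_of M X f s" by (rule surj_section[OF onto subset_refl])
  fix x :: "nat \<Rightarrow> nat \<Rightarrow> 'a" and y :: "nat \<Rightarrow> 'a" and l
  assume x: "\<forall>n k. x n k \<in> topspace X" and lim: "\<forall>n. limitin X (x n) (y n) sequentially"
    "limitin X y l sequentially"
  have yX: "y n \<in> topspace X" for n using lim limitin_topspace by metis
  have P: "precompactin M {z \<in> topspace M. f z \<in> range t}"
    if "range t \<subseteq> topspace X" "limitin X t u sequentially" for t u
    by (rule pre, rule precompactin_subset_compact[OF X compactin_sequence_with_limit[OF that(2) subset_refl that(1)]]) auto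
  have "\<exists>\<rho> w. limitin M ((\<lambda>i. s (x n i)) \<circ> \<rho>) w sequentially \<and> f w = y n" for n
  proof -
    have "range (\<lambda>i. s (x n i)) \<subseteq> {z \<in> topspace M. f z \<in> range (x n)}"
      using s x by (auto simp: section_of_def)
    moreover have "precompactin M {z \<in> topspace M. f z \<in> range (x n)}"
      by (rule P) (use x lim in auto)
    ultimately obtain w \<rho> where w: "strict_mono (\<rho> :: nat \<Rightarrow> nat)"
      "limitin M ((\<lambda>i. s (x n i)) \<circ> \<rho>) w sequentially"
      using precompactin_subsequence[OF M] by metis
    have "limitin X (x n \<circ> \<rho>) (f w) sequentially"
      using continuous_map_limit[OF f w(2)] s x by (simp add: o_def section_of_def)
    moreover have "limitin X (x n \<circ> \<rho>) (y n) sequentially"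
      by (rule limitin_subsequence[OF w(1)]) (use lim in blast)
    ultimately have "f w = y n"
      by (rule limitin_Hausdorff_unique[OF _ _ trivial_limit_sequentially X])
    then show ?thesis using w(2) by (intro exI conjI)
  qed
  then obtain \<rho> w where w: "\<And>n. limitin M ((\<lambda>i. s (x n i)) \<circ> \<rho> n) (w n) sequentially" "\<And>n. f (w n) = y n"
    by metis
  have "range w \<subseteq> {z \<in> topspace M. f z \<in> range y}"
    using w(2) limitin_topspace[OF w(1)] by auto
  moreover have "precompactin M {z \<in> topspace M. f z \<in> range y}"
    by (rule P) (use yX lim in auto)
  ultimately obtain v k where k: "strict_mono (k :: nat \<Rightarrow> nat)" "limitin M (w \<circ> k) v sequentially"
    using precompactin_subsequence[OF M] by metis
  have "limitin X (y \<circ> k) (f v) sequentially"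
    using continuous_map_limit[OF f k(2)] w(2) by (simp add: o_def)
  then have fv: "f v = l"
    by (rule limitin_Hausdorff_unique[OF _ limitin_subsequence[OF k(1) lim(2)] trivial_limit_sequentially X])
  have 1: "limitin M ((\<lambda>i. s (x (k j) i)) \<circ> \<rho> (k j)) ((w \<circ> k) j) sequentially" for j
    using w(1)[of "k j"] by simp
  obtain m where "limitin M (\<lambda>j. ((\<lambda>i. s (x (k j) i)) \<circ> \<rho> (k j)) (m j)) v sequentially"
    by (rule metrizable_diagonal_sequence[OF M 1 k(2)])
  then have "limitin X (\<lambda>j. x (k j) (\<rho> (k j) (m j))) l sequentially"
    using continuous_map_limit[OF f, of "\<lambda>j. s (x (k j) (\<rho> (k j) (m j)))" v] s x fv
    by (simp add: o_def section_of_def)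
  then show "\<exists>(k :: nat \<Rightarrow> nat) (m :: nat \<Rightarrow> nat). strict_mono k \<and> limitin X (\<lambda>j. x (k j) (m j)) l sequentially"
    using k(1) by (intro exI[of _ k] exI[of _ "\<lambda>j. \<rho> (k j) (m j)"]) simp
qed

lemma diagonal_property_no_fan:
  assumes X: "Hausdorff_space X" "diagonal_property X"
    and T: "double_fan T p q r"
  shows "\<not> seq_homeomorphic (subtopology X A) T"
proof
  let ?A = "subtopology X A"
  assume "seq_homeomorphic ?A T"
  then obtain h where h: "bij_betw h (topspace ?A) (topspace T)" "seq_continuous ?A T h"
    "seq_continuous T ?A (inv_into (topspace ?A) h)"
    unfolding seq_homeomorphic_def by blast
  define g where "g = inv_into (topspace ?A) h"
  have hg: "h (g t) = t" if "t \<in> topspace T" for t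
    using h(1) that unfolding g_def by (simp add: bij_betw_inv_into_right)
  have gA: "g t \<in> topspace ?A" if "t \<in> topspace T" for t
    using h(3) that unfolding g_def seq_continuous_def by blast
  have top: "topspace T = fan_points p q r" using T by (simp add: double_fan_def)
  have HA: "Hausdorff_space ?A" using X(1) by (rule Hausdorff_space_subtopology)
  have lim: "limitin X (\<lambda>n. g (t n)) (g u) sequentially"
    if "range t \<subseteq> topspace T" "limitin T t u sequentially" for t u
    using seq_continuous_limit[OF h(3) HA that] by (simp add: limitin_subtopology g_def)
  have lim_p: "limitin X (\<lambda>k. g (p n k)) (g (q n)) sequentially" for n
    by (rule lim[OF _ double_fan_limits(1)[OF T]]) (auto simp: top)
  have lim_q: "limitin X (\<lambda>n. g (q n)) (g r) sequentially"
    by (rule lim[OF _ double_fan_limits(2)[OF T]]) (auto simp: top)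
  have "\<exists>(k :: nat \<Rightarrow> nat) (m :: nat \<Rightarrow> nat). strict_mono k \<and>
      limitin X (\<lambda>j. g (p (k j) (m j))) (g r) sequentially"
    by (rule X(2)[unfolded diagonal_property_def, rule_format, of "\<lambda>n k. g (p n k)" "\<lambda>n. g (q n)"])
      (use gA lim_p lim_q in \<open>auto simp: top\<close>)
  then obtain k m :: "nat \<Rightarrow> nat" where k: "strict_mono k"
    and l: "limitin X (\<lambda>j. g (p (k j) (m j))) (g r) sequentially" by blast
  have "range (\<lambda>j. g (p (k j) (m j))) \<subseteq> topspace ?A" using gA by (auto simp: top)
  moreover have "limitin ?A (\<lambda>j. g (p (k j) (m j))) (g r) sequentially"
    using l gA by (simp add: limitin_subtopology top)
  ultimately have "convergent_seq T (\<lambda>j. h (g (p (k j) (m j))))"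
    using h(2) unfolding seq_continuous_def convergent_seq_def by blast
  then have "convergent_seq T (\<lambda>j. p (k j) (m j))" by (simp add: hg top)
  then show False
    using double_fan_no_diagonal[OF T strict_mono_imp_inj_on[OF k]] by (auto simp: convergent_seq_def)
qed

section \<open>Generalized metrizability and the coreflection\<close>

lemma convergent_seq_subtopology_seq_coreflection:
  "convergent_seq (subtopology (seq_coreflection X) A) = convergent_seq (subtopology X A)"
  by (simp add: fun_eq_iff convergent_seq_def limitin_subtopology)

lemma seq_homeomorphic_subtopology_seq_coreflection:
  "seq_homeomorphic (subtopology (seq_coreflection X) A) T \<longleftrightarrow> seq_homeomorphic (subtopology X A) T"
  by (simp add: seq_homeomorphic_def seq_continuous_def convergent_seq_subtopology_seq_coreflection)

lemma homeomorphic_imp_seq_homeomorphic: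
  assumes "X homeomorphic_space Y" shows "seq_homeomorphic X Y"
proof -
  obtain f g where fg: "homeomorphic_maps X Y f g" using assms homeomorphic_space_def by blast
  then have f: "continuous_map X Y f" and g: "continuous_map Y X g"
    and id: "\<And>x. x \<in> topspace X \<Longrightarrow> g (f x) = x" "\<And>y. y \<in> topspace Y \<Longrightarrow> f (g y) = y"
    by (auto simp: homeomorphic_maps_def)
  have fX: "f x \<in> topspace Y" if "x \<in> topspace X" for x using f that by (auto simp: continuous_map_def)
  have gY: "g y \<in> topspace X" if "y \<in> topspace Y" for y using g that by (auto simp: continuous_map_def)
  have bij: "bij_betw f (topspace X) (topspace Y)"
    by (rule bij_betw_byWitness[where f' = g]) (use id fX gY in auto)
  have inv: "inv_into (topspace X) f y = g y" if "y \<in> topspace Y" for y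
    using bij id(2)[OF that] gY[OF that] by (metis bij_betw_def inv_into_f_f)
  have cont: "seq_continuous X Y f" if "continuous_map X Y f" for X :: "'c topology" and Y :: "'d topology" and f
    using that continuous_map_limit[OF that]
    by (fastforce simp: seq_continuous_def convergent_seq_def continuous_map_def o_def)
  have "seq_continuous Y X (inv_into (topspace X) f)"
    using cont[OF g] inv by (auto simp: seq_continuous_def convergent_seq_def image_subset_iff)
  then show ?thesis using bij cont[OF f] unfolding seq_homeomorphic_def by blast
qed

lemma cs_star_metrizable_seq_coreflection:
  assumes "cs_star_metrizable X" shows "cs_star_metrizable (seq_coreflection X)"
proof -
  obtain M :: "(nat \<Rightarrow> 'a) topology" and f s where M: "metrizable_space M" and f: "continuous_map M X f"
    and s: "section_of M X f s" "cs_star_continuous X M s"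
    using assms unfolding cs_star_metrizable_def by blast
  have "convergent_seq (seq_coreflection X) = convergent_seq X"
    by (simp add: fun_eq_iff convergent_seq_def)
  then show ?thesis
    using cs_star_metrizableI[OF M continuous_map_into_seq_coreflection[OF M f], of s] s
    by (simp add: section_of_def cs_star_continuous_def)
qed

lemma continuous_map_seq_coreflection_id: "continuous_map (seq_coreflection X) X id"
  by (auto simp: continuous_map_def openin_imp_openin_seq_coreflection Collect_conj_eq Int_absorb1 openin_subset)

lemma cs_metrizable_if_metrizable_seq_coreflection:
  assumes "metrizable_space (seq_coreflection X)" shows "cs_metrizable X"
proof (rule cs_metrizableI[OF assms continuous_map_seq_coreflection_id])
  show "section_of (seq_coreflection X) X id id" by (simp add: section_of_def)
  show "seq_continuous X (seq_coreflection X) id" by (simp add: seq_continuous_def convergent_seq_def)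
qed

text \<open>
  The set is closed in the image of a compact subset of the metrizable space, and that
  image is compact already for the coreflection.
\<close>

lemma compactin_seq_coreflection_if_k_star_metrizable:
  assumes X: "Hausdorff_space X" "k_star_metrizable X" and K: "compactin X K"
  shows "compactin (seq_coreflection X) K"
proof -
  obtain M :: "(nat \<Rightarrow> 'a) topology" and f where M: "metrizable_space M" and f: "subproper_map M X f"
    using X(2) unfolding k_star_metrizable_def by blast
  obtain Z where Z: "Z \<subseteq> topspace M" "f ` Z = topspace X"
    and pre: "\<And>K. precompactin X K \<Longrightarrow> precompactin M (Z \<inter> {x \<in> topspace M. f x \<in> K})"
    using f unfolding subproper_map_def by blast
  define Q where "Q = Z \<inter> {x \<in> topspace M. f x \<in> K}"
  have Q: "precompactin M Q"
    unfolding Q_def by (rule pre[OF precompactin_subset_compact[OF X(1) K subset_refl]])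
  have "continuous_map M X f" using f by (simp add: subproper_map_def)
  then have "continuous_map M (seq_coreflection X) f"
    by (rule continuous_map_into_seq_coreflection[OF M])
  moreover have "compactin M (M closure_of Q)" using Q by (simp add: precompactin_def)
  ultimately have "compactin (seq_coreflection X) (f ` (M closure_of Q))" by (rule image_compactin[rotated])
  moreover have "K \<subseteq> f ` (M closure_of Q)"
  proof -
    have "K \<subseteq> f ` Q"
    proof
      fix x assume x: "x \<in> K"
      then have "x \<in> f ` Z" using compactin_subset_topspace[OF K] Z(2) by blast
      then show "x \<in> f ` Q" using x Z(1) by (auto simp: Q_def)
    qed
    moreover have "Q \<subseteq> M closure_of Q" using Q by (simp add: precompactin_def closure_of_subset)
    ultimately show ?thesis by blast
  qed
  moreover have "closedin (seq_coreflection X) K"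
    using closedin_imp_seq_closedin[OF compactin_imp_closedin[OF X(1) K]]
    by (simp add: closedin_seq_coreflection)
  ultimately show ?thesis by (rule closed_compactin)
qed

lemma k_metrizable_if_metrizable_seq_coreflection:
  assumes X: "Hausdorff_space X" "k_star_metrizable X" and M: "metrizable_space (seq_coreflection X)"
  shows "k_metrizable X"
proof (rule k_metrizableI[OF M])
  show "kproper_map (seq_coreflection X) X id"
    unfolding kproper_map_def
  proof (intro conjI continuous_map_seq_coreflection_id allI impI)
    fix K assume K: "precompactin X K"
    then have "compactin (seq_coreflection X) (X closure_of K)"
      using compactin_seq_coreflection_if_k_star_metrizable[OF X] by (simp add: precompactin_def)
    then show "precompactin (seq_coreflection X) {x \<in> topspace (seq_coreflection X). id x \<in> K}"
    proof (rule precompactin_subset_compact[OF Hausdorff_space_seq_coreflection[OF X(1)]])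
      show "{x \<in> topspace (seq_coreflection X). id x \<in> K} \<subseteq> X closure_of K"
        using K closure_of_subset[of K X] by (auto simp: precompactin_def)
    qed
  qed
qed simp

text \<open>
  On a sequential space the section is continuous, hence an embedding into the
  metrizable space.
\<close>

lemma sequential_cs_metrizable_imp_metrizable:
  assumes X: "sequential_space X" "cs_metrizable X" shows "metrizable_space X"
proof -
  obtain M :: "(nat \<Rightarrow> 'a) topology" and f s where M: "metrizable_space M" and f: "continuous_map M X f"
    and s: "section_of M X f s" "seq_continuous X M s"
    using X(2) unfolding cs_metrizable_def by blast
  have sM: "s \<in> topspace X \<rightarrow> topspace M" and fs: "\<And>x. x \<in> topspace X \<Longrightarrow> f (s x) = x"
    using s(1) by (auto simp: section_of_def)
  have "continuous_map X M s"
    by (rule continuous_map_from_sequential_space[OF X(1) sM])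
      (rule seq_continuous_limit[OF s(2) metrizable_imp_Hausdorff_space[OF M]])
  then have "homeomorphic_maps X (subtopology M (s ` topspace X)) s f"
    using f fs sM
    by (auto simp: homeomorphic_maps_def continuous_map_in_subtopology intro: continuous_map_from_subtopology)
  then have "X homeomorphic_space subtopology M (s ` topspace X)" using homeomorphic_space_def by blast
  then show ?thesis using homeomorphic_metrizable_space metrizable_space_subtopology[OF M] by blast
qed

lemma k_metrizable_k_space_imp_sequential:
  assumes X: "Hausdorff_space X" "k_star_metrizable X" "k_space X" shows "sequential_space X"
  unfolding sequential_space_def
proof (intro allI impI)
  fix A assume A: "seq_closedin X A"
  have "closedin (subtopology X K) (K \<inter> A)" if K: "compactin X K" for K
  proof -
    have "compactin (seq_coreflection X) (K \<inter> A)"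
      using compactin_seq_coreflection_if_k_star_metrizable[OF X(1,2) K] A
      by (simp add: compact_Int_closedin closedin_seq_coreflection)
    then have "compactin X (id ` (K \<inter> A))"
      by (rule image_compactin[OF _ continuous_map_seq_coreflection_id])
    then have "closedin X (K \<inter> A)" using compactin_imp_closedin[OF X(1)] by simp
    then show ?thesis by (simp add: closedin_subset_topspace)
  qed
  then show "closedin X A" using X(3) A by (simp add: k_space_def seq_closedin_def)
qed

section \<open>Characterizing the Lasnev spaces\<close>

text \<open>
  Every section works. Suppose that infinitely many points of its range lie over a
  compact set and have no convergent subsequence. Then every set of these points is
  closed, and so is its image; thus the compact set contains an infinite closed
  discrete set.
\<close>

lemma lasnev_imp_k_star_metrizable:
  assumes "lasnev_space X" shows "k_star_metrizable X"
proof -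
  obtain M :: "(nat \<Rightarrow> 'a) topology" and f where X: "Hausdorff_space X" and M: "metrizable_space M"
    and f: "continuous_map M X f" "closed_map M X f" "f ` topspace M = topspace X"
    using assms unfolding lasnev_space_def by blast
  obtain S d where "Metric_space S d" and Meq: "M = Metric_space.mtopology S d"
    using M unfolding metrizable_space_def by blast
  then interpret Metric_space S d by simp
  obtain s where s: "section_of M X f s" by (rule surj_section[OF f(3) subset_refl])
  define Z where "Z = s ` topspace X"
  have fs: "f (s x) = x" if "x \<in> topspace X" for x using s that by (simp add: section_of_def)
  have ZM: "Z \<subseteq> topspace M" using s by (auto simp: Z_def section_of_def)
  have "precompactin M (Z \<inter> {z \<in> topspace M. f z \<in> K})" if K: "precompactin X K" for K
  proof (rule precompactin_if_subsequences[OF M])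
    show "Z \<inter> {z \<in> topspace M. f z \<in> K} \<subseteq> topspace M" using ZM by blast
    fix y :: "nat \<Rightarrow> nat \<Rightarrow> 'a"
    assume y: "inj y" "range y \<subseteq> Z \<inter> {z \<in> topspace M. f z \<in> K}"
    show "\<exists>(r :: nat \<Rightarrow> nat) l. strict_mono r \<and> limitin M (y \<circ> r) l sequentially"
    proof (rule ccontr)
      assume "\<nexists>(r :: nat \<Rightarrow> nat) l. strict_mono r \<and> limitin M (y \<circ> r) l sequentially"
      then have nosub: "\<not> limitin mtopology (y \<circ> r) l sequentially" if "strict_mono r" for r :: "nat \<Rightarrow> nat" and l
        using that by (auto simp: Meq)
      have yS: "y j \<in> S" and fy: "f (y j) \<in> K" and yZ: "y j \<in> Z" for j
        using y(2) by (auto simp: Meq)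
      have cl: "closedin X ((\<lambda>j. f (y j)) ` J)" for J
      proof -
        have "closedin mtopology (\<Union>j. if j \<in> J then {y j} else {})"
        proof (rule closedin_Union_near_sequence[OF _ nosub])
          show "range y \<subseteq> S" using yS by blast
          show "closedin mtopology (if j \<in> J then {y j} else {})" for j
            using yS by (simp add: closedin_Hausdorff_singleton[OF Hausdorff_space_mtopology])
          show "d (y j) z < 1 / real (Suc j)" if "z \<in> (if j \<in> J then {y j} else {})" for j z
            using that yS by (simp split: if_splits)
        qed auto
        moreover have "(\<Union>j. if j \<in> J then {y j} else {}) = y ` J" by auto
        ultimately have "closedin M (y ` J)" by (simp add: Meq)
        then have "closedin X (f ` y ` J)" using f(2) unfolding closed_map_def by blast
        then show ?thesis by (simp add: image_image)
      qed
      have inj: "inj (\<lambda>j. f (y j))"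
      proof (rule injI)
        fix i j assume "f (y i) = f (y j)"
        moreover have "y k = s (f (y k))" for k using yZ[of k] fs by (auto simp: Z_def)
        ultimately have "y i = y j" by metis
        then show "i = j" using y(1) by (rule injD[rotated])
      qed
      have "infinite (range (\<lambda>j. f (y j)))" using inj by (simp add: finite_image_iff)
      moreover have "range (\<lambda>j. f (y j)) \<subseteq> X closure_of K"
        using fy K closure_of_subset[of K X] by (auto simp: precompactin_def)
      ultimately obtain l where l: "l \<in> X derived_set_of (range (\<lambda>j. f (y j)))"
        using K compactin_imp_Bolzano_Weierstrass[of X "X closure_of K" "range (\<lambda>j. f (y j))"]
        by (auto simp: precompactin_def)
      define J where "J = {j. f (y j) \<noteq> l}"
      \<comment> \<open>Removing all images other than \<open>l\<close> leaves a neighbourhood that isolates \<open>l\<close>.\<close>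
      define U where "U = topspace X - (\<lambda>j. f (y j)) ` J"
      have "openin X U" unfolding U_def using cl by (rule openin_diff[OF openin_topspace])
      moreover have "l \<in> U" using l by (auto simp: in_derived_set_of U_def J_def)
      moreover have "\<forall>T. l \<in> T \<and> openin X T \<longrightarrow> (\<exists>t. t \<noteq> l \<and> t \<in> range (\<lambda>j. f (y j)) \<and> t \<in> T)"
        using l by (simp add: in_derived_set_of)
      ultimately obtain t where "t \<noteq> l" "t \<in> range (\<lambda>j. f (y j))" "t \<in> U" by meson
      then show False by (auto simp: J_def U_def)
    qed
  qed
  moreover have "f ` Z = topspace X" using fs by (simp add: Z_def image_image)
  ultimately have "subproper_map M X f"
    unfolding subproper_map_def using f(1) ZM by (intro conjI exI[of _ Z]) auto
  then show ?thesis by (rule k_star_metrizableI[OF M _ f(3)])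
qed

text \<open>
  The map becomes closed when restricted to the closure of the range of the section.
  Let \<open>z n\<close> be points of a closed set \<open>F\<close> there whose images \<open>y n\<close> converge to \<open>l\<close>.
  Approximate \<open>z n\<close> by points of the range of the section. The images of these
  accumulate at \<open>l\<close>, so by the Frechet--Urysohn property a sequence of them converges
  to \<open>l\<close>. Its lift has an accumulation point, which lies in \<open>F\<close> because the
  approximations get closer from row to row.
\<close>

lemma frechet_urysohn_cs_star_imp_lasnev:
  assumes X: "Hausdorff_space X" and FU: "frechet_urysohn_space X" and cs: "cs_star_metrizable X"
  shows "lasnev_space X"
proof -
  obtain M :: "(nat \<Rightarrow> 'a) topology" and f s where M: "metrizable_space M" and f: "continuous_map M X f"
    and s: "section_of M X f s" "cs_star_continuous X M s"
    using cs unfolding cs_star_metrizable_def by blast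
  obtain S d where "Metric_space S d" and Meq: "M = Metric_space.mtopology S d"
    using M unfolding metrizable_space_def by blast
  then interpret Metric_space S d by simp
  have sS: "s x \<in> S" and fs: "f (s x) = x" if "x \<in> topspace X" for x
    using s(1) that by (auto simp: section_of_def Meq)
  define C where "C = M closure_of (s ` topspace X)"
  have sC: "s x \<in> C" if "x \<in> topspace X" for x
  proof -
    have "s ` topspace X \<subseteq> C" unfolding C_def by (rule closure_of_subset) (use sS in \<open>auto simp: Meq\<close>)
    then show ?thesis using that by blast
  qed
  have clC: "closedin M C" by (simp add: C_def)
  have "closedin X (f ` F)" if F: "closedin M F" "F \<subseteq> C" for F
  proof -
    have FS: "F \<subseteq> S" using closedin_subset[OF F(1)] by (simp add: Meq)
    have "seq_closedin X (f ` F)"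
      unfolding seq_closedin_def
    proof (intro conjI allI impI)
      show "f ` F \<subseteq> topspace X" using f FS by (auto simp: continuous_map_def Meq)
      fix y l assume yl: "range y \<subseteq> f ` F \<and> limitin X y l sequentially"
      then have "\<exists>z. z \<in> F \<and> f z = y n" for n by (metis imageE range_subsetD)
      then obtain z where z: "\<And>n. z n \<in> F" "\<And>n. f (z n) = y n" by metis
      have lim: "limitin X y l sequentially" using yl by blast
      show "l \<in> f ` F"
      proof (rule ccontr)
        assume l: "l \<notin> f ` F"
        then have ynl: "y n \<noteq> l" for n using z by (metis imageI)
        have "\<exists>u. range u \<subseteq> s ` topspace X \<and> limitin M u (z n) sequentially" for n
        proof -
          have "z n \<in> mtopology closure_of (s ` topspace X)" using z(1) F(2) by (auto simp: C_def Meq)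
          then show ?thesis unfolding closure_of_sequentially Meq by blast
        qed
        then obtain u where u: "\<And>n. range (u n) \<subseteq> s ` topspace X" "\<And>n. limitin M (u n) (z n) sequentially"
          by metis
        define x where "x n m = f (u n m)" for n m
        have "u n m \<in> s ` topspace X" for n m using u(1) by blast
        then have xX: "x n m \<in> topspace X" and sx: "s (x n m) = u n m" for n m
          using fs unfolding x_def by (metis imageE)+
        have xy: "limitin X (x n) (y n) sequentially" for n
          using continuous_map_limit[OF f u(2)[of n]] z(2)[of n] by (simp add: o_def x_def[abs_def])
        define I where "I n = {m. d (z n) (u n m) < 1 / real (Suc n) \<and> x n m \<noteq> l}" for n
        have finI: "finite (- I n)" for n
        proof -
          have "\<forall>\<^sub>F m in sequentially. u n m \<in> S \<and> d (u n m) (z n) < 1 / real (Suc n)"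
            using u(2)[of n] unfolding Meq limitin_metric by simp
          then have "finite {m. \<not> (u n m \<in> S \<and> d (u n m) (z n) < 1 / real (Suc n))}"
            by (simp add: eventually_cofinite flip: cofinite_eq_sequentially)
          moreover have "finite {m. x n m \<notin> topspace X - {l}}"
          proof -
            have "l \<in> topspace X" using lim by (rule limitin_topspace)
            then have "openin X (topspace X - {l})" "y n \<in> topspace X - {l}"
              using X ynl limitin_topspace[OF xy] by (auto simp: closedin_Hausdorff_singleton openin_diff)
            then show ?thesis using xy[of n] unfolding limitin_sequentially_finite by blast
          qed
          ultimately have "finite ({m. \<not> (u n m \<in> S \<and> d (u n m) (z n) < 1 / real (Suc n))} \<union>
              {m. x n m \<notin> topspace X - {l}})" by blast
          then show ?thesis by (rule rev_finite_subset) (auto simp: I_def commute)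
        qed
        define A where "A = (\<Union>n. x n ` I n)"
        have AX: "A \<subseteq> topspace X" using xX by (auto simp: A_def)
        have yA: "y n \<in> X closure_of A" for n
        proof (rule closedin_frequent_limit[OF closedin_closure_of xy])
          have "I n \<subseteq> {m. x n m \<in> X closure_of A}"
            using closure_of_subset[OF AX] by (auto simp: A_def)
          moreover have "infinite (I n)" using finI[of n] by (metis finite_compl infinite_UNIV_nat)
          ultimately show "infinite {m. x n m \<in> X closure_of A}" using finite_subset by blast
        qed
        have "l \<in> X closure_of A"
          by (rule closedin_frequent_limit[OF closedin_closure_of lim]) (simp add: yA)
        then obtain a where a: "range a \<subseteq> A" "limitin X a l sequentially"
          using FU AX unfolding frechet_urysohn_space_def by blast
        have "\<exists>n m. m \<in> I n \<and> a j = x n m" for j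
        proof -
          have "a j \<in> A" using a(1) by blast
          then show ?thesis by (auto simp: A_def)
        qed
        then obtain n m where nm: "\<And>j. m j \<in> I (n j)" "\<And>j. a j = x (n j) (m j)" by metis
        have row: "finite {j. n j = k}" for k
        proof (rule ccontr)
          assume inf: "infinite {j. n j = k}"
          have "closedin X (insert (y k) (x k ` I k))"
          proof (rule closedin_part_of_convergent[OF X xy])
            show "insert (y k) (x k ` I k) \<subseteq> topspace X" using xX limitin_topspace[OF xy] by auto
          qed auto
          moreover have "{j. n j = k} \<subseteq> {j. a j \<in> insert (y k) (x k ` I k)}" using nm by auto
          then have "infinite {j. a j \<in> insert (y k) (x k ` I k)}" using inf finite_subset by blast
          ultimately have "l \<in> insert (y k) (x k ` I k)" by (intro closedin_frequent_limit[OF _ a(2)])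
          then show False using ynl[of k] by (auto simp: I_def)
        qed
        have "convergent_seq X a" using a AX by (auto simp: convergent_seq_def)
        then obtain c where c: "accumulation_point M (\<lambda>j. s (a j)) c"
          using s(2) by (auto simp: cs_star_continuous_def)
        then have cS: "c \<in> S" by (simp add: accumulation_point_def Meq)
        obtain r where r: "strict_mono r" "limitin M ((\<lambda>j. s (a j)) \<circ> r) c sequentially"
          by (rule accumulation_point_subsequence[OF M c])
        have "limitin X (a \<circ> r) (f c) sequentially"
          using continuous_map_limit[OF f r(2)] fs AX a(1) nm xX by (simp add: o_def)
        then have fc: "f c = l"
          by (rule limitin_Hausdorff_unique[OF _ limitin_subsequence[OF r(1) a(2)] trivial_limit_sequentially X])
        have "c \<in> F"
        proof (rule ccontr)
          assume "c \<notin> F"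
          then have "openin mtopology (S - F)" "c \<in> S - F"
            using openin_diff[OF openin_topspace F(1)] cS by (auto simp: Meq)
          then obtain e where e: "e > 0" "mball c e \<subseteq> S - F" unfolding openin_mtopology by blast
          then have "e / 2 > 0" by simp
          then obtain N where N: "inverse (real (Suc N)) < e / 2" using reals_Archimedean by blast
          have "{j. s (a j) \<in> mball c (e / 2)} \<subseteq> (\<Union>k<N. {j. n j = k})"
          proof
            fix j assume j: "j \<in> {j. s (a j) \<in> mball c (e / 2)}"
            have "n j < N"
            proof (rule ccontr)
              assume "\<not> n j < N"
              then have "1 / real (Suc (n j)) \<le> 1 / real (Suc N)" by (intro frac_le) auto
              moreover have "d (z (n j)) (u (n j) (m j)) < 1 / real (Suc (n j))"
                using nm(1)[of j] unfolding I_def by blast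
              ultimately have 1: "d (z (n j)) (s (a j)) < e / 2"
                using N by (simp add: nm(2) sx inverse_eq_divide)
              have 2: "d c (s (a j)) < e / 2" "s (a j) \<in> S" using j by auto
              have zS: "z (n j) \<in> S" using z(1) FS by blast
              have "d c (z (n j)) < e"
                using triangle[OF cS 2(2) zS] 1 2(1) commute[of "z (n j)" "s (a j)"] by linarith
              then have "z (n j) \<in> mball c e" using cS zS by simp
              then show False using e(2) z(1) by blast
            qed
            then show "j \<in> (\<Union>k<N. {j. n j = k})" by blast
          qed
          moreover have "finite (\<Union>k<N. {j. n j = k})" using row by blast
          ultimately have "finite {j. s (a j) \<in> mball c (e / 2)}" by (rule finite_subset)
          moreover have "infinite {j. s (a j) \<in> mball c (e / 2)}"
          proof -
            have "openin M (mball c (e / 2)) \<and> c \<in> mball c (e / 2)"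
              using \<open>e / 2 > 0\<close> cS by (simp add: Meq)
            then show ?thesis using c unfolding accumulation_point_def by blast
          qed
          ultimately show False by blast
        qed
        then show False using fc l by blast
      qed
    qed
    then show ?thesis using frechet_urysohn_imp_sequential_space[OF FU] by (simp add: sequential_space_def)
  qed
  then have "closed_map (subtopology M C) X f"
    unfolding closed_map_def closedin_closed_subtopology[OF clC] by blast
  moreover have "f ` topspace (subtopology M C) = topspace X"
  proof
    show "f ` topspace (subtopology M C) \<subseteq> topspace X" using f by (auto simp: continuous_map_def)
    show "topspace X \<subseteq> f ` topspace (subtopology M C)"
    proof
      fix x assume x: "x \<in> topspace X"
      then have "s x \<in> topspace (subtopology M C)" using sC sS by (simp add: Meq)
      then show "x \<in> f ` topspace (subtopology M C)" using fs[OF x] by (metis imageI)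
    qed
  qed
  ultimately show ?thesis
    by (intro lasnev_spaceI[OF X metrizable_space_subtopology[OF M] continuous_map_from_subtopology[OF f]])
qed

section \<open>The equivalences\<close>

lemma closed_S2_if_not_frechet_urysohn:
  assumes "Hausdorff_space X" "sequential_space X" "cs_star_metrizable X" "\<not> frechet_urysohn_space X"
  obtains A where "closedin X A" "subtopology X A homeomorphic_space S2"
proof -
  obtain M :: "(nat \<Rightarrow> 'a) topology" and f s where M: "metrizable_space M" "continuous_map M X f"
    "section_of M X f s" "cs_star_continuous X M s"
    using assms(3) unfolding cs_star_metrizable_def by blast
  obtain p q r where p: "closedin X (fan_points p q r)"
    "double_fan (subtopology X (fan_points p q r)) p q r" "inj q" "r \<notin> range q"
    by (rule closed_fan_if_sequential_not_frechet_urysohn[OF assms(1,2) M assms(4)])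
  show thesis by (rule that[OF p(1) homeomorphic_S2_if_double_fan[OF p(2-4)]])
qed

text \<open>
  Arens' fan appears if the Frechet--Urysohn property fails. If it holds, the space is
  a closed image of a metrizable space, and the sequential fan appears if the frontier
  of some fibre is not compact.
\<close>

lemma metrizable_or_closed_fan:
  assumes X: "Hausdorff_space X" "sequential_space X" "cs_star_metrizable X" and nM: "\<not> metrizable_space X"
  obtains A where "closedin X A"
    "subtopology X A homeomorphic_space S_omega \<or> subtopology X A homeomorphic_space S2"
proof (cases "frechet_urysohn_space X")
  case False
  then obtain A where A: "closedin X A" "subtopology X A homeomorphic_space S2"
    by (rule closed_S2_if_not_frechet_urysohn[OF X])
  show thesis using that[OF A(1)] A(2) by blast
next
  case True
  then have "lasnev_space X" by (rule frechet_urysohn_cs_star_imp_lasnev[OF X(1) _ X(3)])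
  then obtain M :: "(nat \<Rightarrow> 'a) topology" and f where M: "metrizable_space M"
    and f: "continuous_map M X f" "closed_map M X f" "f ` topspace M = topspace X"
    unfolding lasnev_space_def by blast
  obtain x where x: "x \<in> topspace X" "\<not> compactin M (M frontier_of {z \<in> topspace M. f z = x})"
    using closed_image_with_compact_frontiers_metrizable[OF M X(1) f] nM by blast
  obtain p where p: "closedin X (fan_points p (\<lambda>n. x) x)"
    "double_fan (subtopology X (fan_points p (\<lambda>n. x) x)) p (\<lambda>n. x) x"
    by (rule closed_fan_at_noncompact_frontier[OF M X(1) f(1,2) x])
  have "subtopology X (fan_points p (\<lambda>n. x) x) homeomorphic_space S_omega"
    by (rule double_fan_homeomorphic[OF p(2) double_fan_S_omega]) auto
  then show thesis using that[OF p(1)] by blast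
qed

lemma seq_closed_fan_if_not_cs_metrizable:
  assumes X: "Hausdorff_space X" "cs_star_metrizable X" and n: "\<not> metrizable_space (seq_coreflection X)"
  obtains A where "seq_closedin X A"
    "seq_homeomorphic (subtopology X A) S_omega \<or> seq_homeomorphic (subtopology X A) S2"
proof -
  obtain A where A: "closedin (seq_coreflection X) A"
    "subtopology (seq_coreflection X) A homeomorphic_space S_omega \<or>
     subtopology (seq_coreflection X) A homeomorphic_space S2"
    by (rule metrizable_or_closed_fan[OF Hausdorff_space_seq_coreflection[OF X(1)]
          sequential_space_seq_coreflection cs_star_metrizable_seq_coreflection[OF X(2)] n])
  show thesis
  proof (rule that)
    show "seq_closedin X A" using A(1) by (simp add: closedin_seq_coreflection)
    have "seq_homeomorphic (subtopology (seq_coreflection X) A) S_omega \<or>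
        seq_homeomorphic (subtopology (seq_coreflection X) A) S2"
      using A(2) homeomorphic_imp_seq_homeomorphic by metis
    then show "seq_homeomorphic (subtopology X A) S_omega \<or> seq_homeomorphic (subtopology X A) S2"
      unfolding seq_homeomorphic_subtopology_seq_coreflection .
  qed
qed

theorem theorem7p1:
  fixes X :: "'a topology"
  assumes "Hausdorff_space X"
  shows
    "((lasnev_space X \<longleftrightarrow> frechet_urysohn_space X \<and> k_star_metrizable X) \<and>
      (lasnev_space X \<longleftrightarrow> frechet_urysohn_space X \<and> cs_star_metrizable X) \<and>
      (lasnev_space X \<longleftrightarrow> sequential_space X \<and> cs_star_metrizable X \<and>
         \<not> (\<exists>A \<subseteq> topspace X. subtopology X A homeomorphic_space S2)))
     \<and>
     ((cs_metrizable X \<longleftrightarrow> cs_star_metrizable X \<and>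
         \<not> (\<exists>A \<subseteq> topspace X. seq_homeomorphic (subtopology X A) S_omega \<or>
                              seq_homeomorphic (subtopology X A) S2)) \<and>
      (cs_metrizable X \<longleftrightarrow> cs_star_metrizable X \<and>
         \<not> (\<exists>A. seq_closedin X A \<and>
                 (seq_homeomorphic (subtopology X A) S_omega \<or>
                  seq_homeomorphic (subtopology X A) S2))))
     \<and>
     ((k_metrizable X \<longleftrightarrow> k_star_metrizable X \<and>
         \<not> (\<exists>A \<subseteq> topspace X. seq_homeomorphic (subtopology X A) S_omega \<or>
                              seq_homeomorphic (subtopology X A) S2)) \<and>
      (k_metrizable X \<longleftrightarrow> k_star_metrizable X \<and>
         \<not> (\<exists>A. seq_closedin X A \<and>
                 (seq_homeomorphic (subtopology X A) S_omega \<or>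
                  seq_homeomorphic (subtopology X A) S2))))
     \<and>
     ((metrizable_space X \<longleftrightarrow> sequential_space X \<and> cs_metrizable X) \<and>
      (metrizable_space X \<longleftrightarrow> k_metrizable X \<and> k_space X))"
proof -
  note X = assms
  define Y where "Y = seq_coreflection X"
  define fan where "fan A \<longleftrightarrow> seq_homeomorphic (subtopology X A) S_omega \<or>
    seq_homeomorphic (subtopology X A) S2" for A
  have k_cs: "cs_star_metrizable X" if "k_star_metrizable X"
    using k_star_imp_cs_star_metrizable[OF X that] .
  have no_fan: "\<not> fan A" if "diagonal_property X" for A
    using diagonal_property_no_fan[OF X that double_fan_S_omega]
      diagonal_property_no_fan[OF X that double_fan_S2] by (simp add: fan_def)
  have sub: "A \<subseteq> topspace X" if "seq_closedin X A" for A using that by (simp add: seq_closedin_def)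
  have Y: "metrizable_space Y" if cs: "cs_star_metrizable X" and nofan: "\<not> (\<exists>A. seq_closedin X A \<and> fan A)"
  proof (rule ccontr)
    assume "\<not> metrizable_space Y"
    then obtain A where "seq_closedin X A"
      "seq_homeomorphic (subtopology X A) S_omega \<or> seq_homeomorphic (subtopology X A) S2"
      unfolding Y_def by (rule seq_closed_fan_if_not_cs_metrizable[OF X cs])
    then show False using nofan unfolding fan_def by blast
  qed

  have FU_S2: "\<not> subtopology X A homeomorphic_space S2" if "frechet_urysohn_space X" for A
  proof
    assume "subtopology X A homeomorphic_space S2"
    then have "frechet_urysohn_space S2"
      by (rule homeomorphic_frechet_urysohn_space) (rule frechet_urysohn_subtopology[OF that])
    moreover have "\<not> frechet_urysohn_space S2"
      by (rule double_fan_not_frechet_urysohn[OF double_fan_S2]) (auto simp: inj_def)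
    ultimately show False by blast
  qed
  have S2: "frechet_urysohn_space X" if seq: "sequential_space X" and cs: "cs_star_metrizable X"
    and nofan: "\<not> (\<exists>A \<subseteq> topspace X. subtopology X A homeomorphic_space S2)"
  proof (rule ccontr)
    assume "\<not> frechet_urysohn_space X"
    then obtain A where "closedin X A" "subtopology X A homeomorphic_space S2"
      by (rule closed_S2_if_not_frechet_urysohn[OF X seq cs])
    then show False using nofan closedin_subset by blast
  qed
  have 1: "(lasnev_space X \<longleftrightarrow> frechet_urysohn_space X \<and> k_star_metrizable X) \<and>
      (lasnev_space X \<longleftrightarrow> frechet_urysohn_space X \<and> cs_star_metrizable X) \<and>
      (lasnev_space X \<longleftrightarrow> sequential_space X \<and> cs_star_metrizable X \<and>
         \<not> (\<exists>A \<subseteq> topspace X. subtopology X A homeomorphic_space S2))"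
    using lasnev_imp_frechet_urysohn[of X] lasnev_imp_k_star_metrizable[of X] k_cs
      frechet_urysohn_cs_star_imp_lasnev[OF X] frechet_urysohn_imp_sequential_space[of X] FU_S2 S2
    by blast

  have cs1: "cs_star_metrizable X \<and> \<not> (\<exists>A \<subseteq> topspace X. fan A)" if "cs_metrizable X"
    using cs_imp_cs_star_metrizable[OF that] no_fan[OF cs_metrizable_diagonal_property[OF X that]] by blast
  have cs2: "cs_metrizable X" if "cs_star_metrizable X" "\<not> (\<exists>A. seq_closedin X A \<and> fan A)"
    using cs_metrizable_if_metrizable_seq_coreflection Y[OF that] by (simp add: Y_def)
  have k1: "k_star_metrizable X \<and> \<not> (\<exists>A \<subseteq> topspace X. fan A)" if "k_metrizable X"
    using k_imp_k_star_metrizable[OF that] no_fan[OF k_metrizable_diagonal_property[OF X that]] by blast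
  have k2: "k_metrizable X" if "k_star_metrizable X" "\<not> (\<exists>A. seq_closedin X A \<and> fan A)"
    using k_metrizable_if_metrizable_seq_coreflection[OF X that(1)] Y[OF k_cs[OF that(1)] that(2)]
    by (simp add: Y_def)

  have m1: "sequential_space X \<and> cs_metrizable X \<and> k_metrizable X \<and> k_space X" if M: "metrizable_space X"
  proof (intro conjI)
    show "sequential_space X" by (rule metrizable_imp_sequential_space[OF M])
    show "cs_metrizable X"
      by (rule cs_metrizableI[OF M continuous_map_id, of id])
        (simp_all add: section_of_def seq_continuous_def)
    have "kproper_map X X id"
      by (auto simp: kproper_map_def precompactin_def Int_absorb1 Collect_conj_eq)
    then show "k_metrizable X" by (rule k_metrizableI[OF M]) simp
    show "k_space X" using M by (rule metrizable_imp_k_space)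
  qed
  have m2: "metrizable_space X" if "k_metrizable X" "k_space X"
    using sequential_cs_metrizable_imp_metrizable k_metrizable_k_space_imp_sequential[OF X]
      k1[OF that(1)] k_cs cs2 sub that(2) by blast
  have nsub: "\<not> (\<exists>A. seq_closedin X A \<and> fan A)" if "\<not> (\<exists>A \<subseteq> topspace X. fan A)"
    using that sub by blast
  have 2: "(cs_metrizable X \<longleftrightarrow> cs_star_metrizable X \<and> \<not> (\<exists>A \<subseteq> topspace X. fan A)) \<and>
      (cs_metrizable X \<longleftrightarrow> cs_star_metrizable X \<and> \<not> (\<exists>A. seq_closedin X A \<and> fan A))"
    using cs1 cs2 nsub by meson
  have 3: "(k_metrizable X \<longleftrightarrow> k_star_metrizable X \<and> \<not> (\<exists>A \<subseteq> topspace X. fan A)) \<and>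
      (k_metrizable X \<longleftrightarrow> k_star_metrizable X \<and> \<not> (\<exists>A. seq_closedin X A \<and> fan A))"
    using k1 k2 nsub by meson
  have 4: "(metrizable_space X \<longleftrightarrow> sequential_space X \<and> cs_metrizable X) \<and>
      (metrizable_space X \<longleftrightarrow> k_metrizable X \<and> k_space X)"
    using m1 m2 sequential_cs_metrizable_imp_metrizable[of X] by meson
  show ?thesis
    unfolding fan_def[symmetric] by (intro conjI 1[THEN conjunct1] 1[THEN conjunct2, THEN conjunct1]
      1[THEN conjunct2, THEN conjunct2] 2[THEN conjunct1] 2[THEN conjunct2]
      3[THEN conjunct1] 3[THEN conjunct2] 4[THEN conjunct1] 4[THEN conjunct2])
qed

end
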